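(* Let $G$ be a finite nonabelian group with $V_3(G)<G_3$ (proper containment). Define subgroups $Z$ and $C$ of $G$ containing $V_3(G)$ by $Z/V_3(G)=\mathbf{Z}(G/V_3(G))$ and $C/V_3(G)=\mathbf{C}_{G/V_3(G)}(G'/V_3(G))$. Then the following are true: (1) $|G:V_1(G)|=|G':V_2(G)|^2$. (2) $V_2(G)=Z\cap G'$. (3) Either $|G:C|=|G':V_2(G)|$ or $C=V_1(G)$. (4) $V(C)\le V_1(G)$. (5) If $V_1(G)<C$, then $C'=V_2(G)$. (6) If $V_1(G)<C$ and $[V_1(G),C]<V_2(G)$, then $|G:C|$ is a square.
   Context: For a finite group $G$, $\mathrm{nl}(G)$ is the set of irreducible complex characters of $G$ of degree greater than $1$. The vanishing-off subgroup is $V(G)=\langle g\in G \mid \text{there exists } \chi\in\mathrm{nl}(G) \text{ such that } \chi(g)\neq 0\rangle$, defined for nonabelian $G$; in item (4), if $C$ happens to be abelian, the same formula is used, giving $V(C)=1$. Set $V_1(G)=V(G)$ and $V_i(G)=[V_{i-1}(G),G]$ for $i\ge 2$. The lower central series is $G_1=G$, $G_i=[G_{i-1},G]$ for $i\ge 2$; $G'=G_2$ is the derived subgroup. $\mathbf{Z}(\cdot)$ denotes the center, $\mathbf{C}_H(\cdot)$ the centralizer in $H$, and $<$ between subgroups means proper containment. *)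

theory Defs
  imports "HOL-Algebra.Algebra" "Jordan_Normal_Form.VS_Connect"
begin

definition center :: "('a, 'b) monoid_scheme \<Rightarrow> 'a set" where
  "center G = {z \<in> carrier G. \<forall>x\<in>carrier G. z \<otimes>\<^bsub>G\<^esub> x = x \<otimes>\<^bsub>G\<^esub> z}"

definition centralizer :: "('a, 'b) monoid_scheme \<Rightarrow> 'a set \<Rightarrow> 'a set" where
  "centralizer G S = {x \<in> carrier G. \<forall>s\<in>S. x \<otimes>\<^bsub>G\<^esub> s = s \<otimes>\<^bsub>G\<^esub> x}"

text \<open>The commutator convention is that of \<^const>\<open>derived\<close>; for subgroups \<open>H\<close> and \<open>K\<close>
  the other convention, with inverses first, generates the same subgroup.\<close>

definition commutator_subgroup :: "('a, 'b) monoid_scheme \<Rightarrow> 'a set \<Rightarrow> 'a set \<Rightarrow> 'a set" where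
  "commutator_subgroup G H K =
     generate G (\<Union>h\<in>H. \<Union>k\<in>K. {h \<otimes>\<^bsub>G\<^esub> k \<otimes>\<^bsub>G\<^esub> (inv\<^bsub>G\<^esub> h) \<otimes>\<^bsub>G\<^esub> (inv\<^bsub>G\<^esub> k)})"

text \<open>The index \<open>|H : K|\<close> of \<open>K\<close> in \<open>H\<close>, for subgroups \<open>K \<le> H\<close> of \<open>G\<close>.\<close>

definition group_index :: "('a, 'b) monoid_scheme \<Rightarrow> 'a set \<Rightarrow> 'a set \<Rightarrow> nat" where
  "group_index G H K = card (rcosets\<^bsub>G\<lparr>carrier := H\<rparr>\<^esub> K)"

definition general_linear :: "nat \<Rightarrow> complex mat monoid" where
  "general_linear n = units_of (ring_mat TYPE(complex) n ())"

definition irreducible_rep ::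
    "('a, 'b) monoid_scheme \<Rightarrow> nat \<Rightarrow> ('a \<Rightarrow> complex mat) \<Rightarrow> bool" where
  "irreducible_rep G n \<rho> \<longleftrightarrow>
     0 < n \<and> \<rho> \<in> hom G (general_linear n) \<and>
     (\<forall>W. VectorSpace.subspace class_ring W (module_vec TYPE(complex) n) \<longrightarrow>
        (\<forall>g\<in>carrier G. \<forall>w\<in>W. \<rho> g *\<^sub>v w \<in> W) \<longrightarrow>
        W = {0\<^sub>v n} \<or> W = carrier_vec n)"

definition mat_trace :: "complex mat \<Rightarrow> complex" where
  "mat_trace A = (\<Sum>i<dim_row A. A $$ (i, i))"

text \<open>Characters are restricted to the carrier, so that a character is determined by its
  values on the group.\<close>

definition character :: "('a, 'b) monoid_scheme \<Rightarrow> ('a \<Rightarrow> complex mat) \<Rightarrow> 'a \<Rightarrow> complex" where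
  "character G \<rho> = (\<lambda>g\<in>carrier G. mat_trace (\<rho> g))"

definition irreducible_characters :: "('a, 'b) monoid_scheme \<Rightarrow> ('a \<Rightarrow> complex) set" where
  "irreducible_characters G = {character G \<rho> | n \<rho>. irreducible_rep G n \<rho>}"

text \<open>The degree of a character \<open>\<chi>\<close> is the natural number \<open>\<chi> 1\<close>.\<close>

definition nl :: "('a, 'b) monoid_scheme \<Rightarrow> ('a \<Rightarrow> complex) set" where
  "nl G = {\<chi> \<in> irreducible_characters G. \<exists>d::nat. \<chi> \<one>\<^bsub>G\<^esub> = of_nat d \<and> 1 < d}"

definition vanishing_off :: "('a, 'b) monoid_scheme \<Rightarrow> 'a set" where
  "vanishing_off G = generate G {g \<in> carrier G. \<exists>\<chi>\<in>nl G. \<chi> g \<noteq> 0}"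

text \<open>Both series are indexed from 1; the index 0 is not used.\<close>

definition vanishing_series :: "('a, 'b) monoid_scheme \<Rightarrow> nat \<Rightarrow> 'a set" where
  "vanishing_series G i =
     ((\<lambda>H. commutator_subgroup G H (carrier G)) ^^ (i - 1)) (vanishing_off G)"

definition lower_central :: "('a, 'b) monoid_scheme \<Rightarrow> nat \<Rightarrow> 'a set" where
  "lower_central G i =
     ((\<lambda>H. commutator_subgroup G H (carrier G)) ^^ (i - 1)) (carrier G)"

end

theory Submission
  imports Defs "Jordan_Normal_Form.Spectral_Radius" "HOL-Number_Theory.Number_Theory"
begin

text \<open>
  All nonlinear irreducible characters vanish at \<open>g\<close> if and only if the conjugacy class of \<open>g\<close> is the
  coset \<open>gG'\<close>. Hence every \<open>g\<close> outside \<open>V = V\<^sub>1\<close> satisfies \<open>{[g,x] | x \<in> G} = G'\<close>, and the theorem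
  becomes a statement about commutators.

  Modulo \<open>V\<^sub>2\<close> the commutator is an alternating pairing \<open>G/V \<times> G/V \<rightarrow> G'/V\<^sub>2\<close> of elementary abelian
  \<open>p\<close>-groups, and \<open>[g,-]\<close> is onto for \<open>g \<noteq> 1\<close>. So every nonzero functional on \<open>G'/V\<^sub>2\<close> gives a
  nondegenerate alternating form, and an argument of Chevalley-Warning type yields
  \<open>|G':V\<^sub>2|\<^sup>2 \<le> |G:V|\<close>. For odd \<open>p\<close> it sums the power \<open>(p-1)/2\<close> of the determinant, which is a square, over
  all functionals; for \<open>p = 2\<close> it sums the Gauss sums of associated quadratic forms.

  For the converse take a nontrivial linear character \<open>\<mu>\<close> of \<open>G\<^sub>3/V\<^sub>3\<close>. The pairing \<open>\<mu>[y,x]\<close> of \<open>G'\<close>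
  with \<open>G\<close> has kernels \<open>L \<ge> V\<^sub>2\<close> and \<open>C\<^sub>\<mu> \<ge> C\<close> with \<open>|G':L| = |G:C\<^sub>\<mu>|\<close>. The function \<open>\<mu>[[a,b],c]\<close>
  is trilinear and satisfies the Jacobi identity (Hall-Witt), so for \<open>c\<close> outside \<open>C\<^sub>\<mu>\<close> the subgroup
  \<open>C\<^sub>\<mu>\<close> is isotropic for an alternating form on \<open>G\<close> with radical \<open>V\<close>. This gives
  \<open>|G:V| \<le> |G:C\<^sub>\<mu>|\<^sup>2 = |G':L|\<^sup>2 \<le> |G':V\<^sub>2|\<^sup>2\<close>; hence equality holds throughout and \<open>L = V\<^sub>2\<close>. For
  \<open>g\<close> in \<open>C\<close> outside \<open>V\<close> the Jacobi identity also gives \<open>C\<^sub>\<mu> = {x | [g,x] \<in> V\<^sub>2}\<close>, which does not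
  depend on \<open>\<mu>\<close>, so \<open>C = C\<^sub>\<mu>\<close>. The remaining assertions follow from this description of \<open>C\<close>.
\<close>

section \<open>Matrix representations\<close>

text \<open>The criterion for elements outside \<open>V\<close> uses neither complete reducibility
  nor orthogonality relations. A weighted sum of traces that is nonzero on the regular
  representation is nonzero on some irreducible one, and suitable weights force the latter to be the
  one wanted. The same device produces the linear characters of \<open>G3/V3\<close>. A single
  nondegenerate alternating form only shows that the dimension \<open>m\<close> of
  \<open>G/V\<close> is even. The bound \<open>2 * n \<le> m\<close>, with \<open>n\<close> the
  dimension of \<open>D/V2\<close>, needs all functionals at once, hence a count. For odd
  \<open>p\<close> a square is recognized by its power \<open>(p - 1) / 2\<close>; for
  \<open>p = 2\<close> the sign of a Gauss sum is lost modulo the next power of 2, and this takes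
  the place of the Legendre symbol. The strict inclusion of \<open>V3\<close> in \<open>G3\<close>
  enters through the existence of \<open>\<mu>\<close>. Since \<open>D \<le> V\<close> gives
  \<open>G3 \<le> V2\<close>, the quotient \<open>G3/V3\<close> is central in \<open>G/V3\<close>.
  So conjugations disappear under \<open>\<mu>\<close>, and commutator identities become exact
  multiplicative laws. With complex values, orders of kernels can be compared by summing all values
  of a form.\<close>

lemma hom_general_linear_iff:
  assumes "group G"
  shows "\<rho> \<in> hom G (general_linear n) \<longleftrightarrow>
    (\<forall>g\<in>carrier G. \<rho> g \<in> carrier_mat n n) \<and>
    (\<forall>g\<in>carrier G. \<forall>h\<in>carrier G. \<rho> (g \<otimes>\<^bsub>G\<^esub> h) = \<rho> g * \<rho> h) \<and> \<rho> \<one>\<^bsub>G\<^esub> = 1\<^sub>m n"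
    (is "?L \<longleftrightarrow> ?R")
proof
  interpret G: group G by fact
  interpret R: ring "ring_mat TYPE(complex) n ()" by (rule ring_mat)
  have gl: "group (general_linear n)"
    unfolding general_linear_def by (rule R.units_group)
  have car: "carrier (general_linear n) = Units (ring_mat TYPE(complex) n ())"
    and mul: "\<And>A B. A \<otimes>\<^bsub>general_linear n\<^esub> B = A * B"
    and one: "\<one>\<^bsub>general_linear n\<^esub> = 1\<^sub>m n"
    by (auto simp: general_linear_def units_of_def ring_mat_simps)
  {
    assume L: ?L
    interpret group_hom G "general_linear n" \<rho>
      using L gl by (simp add: group_hom_def group_hom_axioms_def assms)
    show ?R
      using L hom_one by (auto simp: hom_def car mul one Units_def ring_mat_simps Pi_iff)
  next
    assume R: ?R
    have "\<rho> g \<in> Units (ring_mat TYPE(complex) n ())" if g: "g \<in> carrier G" for g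
    proof -
      have "\<rho> g * \<rho> (inv\<^bsub>G\<^esub> g) = 1\<^sub>m n" "\<rho> (inv\<^bsub>G\<^esub> g) * \<rho> g = 1\<^sub>m n"
        using R g by (metis G.inv_closed G.r_inv G.l_inv)+
      then show ?thesis
        using R g unfolding Units_def ring_mat_simps by auto
    qed
    then show ?L
      using R by (auto simp: hom_def car mul)
  }
qed

lemma module_vec_subspace_iff:
  fixes W :: "'a :: field vec set"
  shows "VectorSpace.subspace class_ring W (module_vec TYPE('a) n) \<longleftrightarrow>
    W \<subseteq> carrier_vec n \<and> 0\<^sub>v n \<in> W \<and> (\<forall>v\<in>W. \<forall>w\<in>W. v + w \<in> W) \<and> (\<forall>c. \<forall>v\<in>W. c \<cdot>\<^sub>v v \<in> W)"
  unfolding subspace_def submodule_def using vec_vs[where 'a='a and n=n] vec_module[where 'a='a and n=n]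
  by (auto simp: module_vec_simps class_ring_simps)

text \<open>Columns of an invertible matrix lying in the subspace are exchanged for new ones as long as possible.\<close>

lemma subspace_adapted_basis:
  fixes W :: "'a :: field vec set"
  assumes sub: "W \<subseteq> carrier_vec n" "0\<^sub>v n \<in> W" "\<forall>v\<in>W. \<forall>w\<in>W. v + w \<in> W"
    "\<forall>c. \<forall>v\<in>W. c \<cdot>\<^sub>v v \<in> W"
  shows "\<exists>P\<in>carrier_mat n n. \<exists>Q\<in>carrier_mat n n. \<exists>r\<le>n. P * Q = 1\<^sub>m n \<and> Q * P = 1\<^sub>m n \<and>
    (\<forall>j<r. col P j \<in> W) \<and> (\<forall>w\<in>W. \<forall>i<n. r \<le> i \<longrightarrow> (Q *\<^sub>v w) $ i = 0)"
proof -
  define Pr where "Pr r \<longleftrightarrow> r \<le> n \<and> (\<exists>P\<in>carrier_mat n n. det P \<noteq> 0 \<and> (\<forall>j<r. col P j \<in> W))" for r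
  have "Pr 0" unfolding Pr_def by (auto intro!: bexI[of _ "1\<^sub>m n"])
  moreover have "\<And>r. Pr r \<Longrightarrow> r \<le> n" by (simp add: Pr_def)
  ultimately have ex: "Pr (Greatest Pr)" and gr: "\<And>r. Pr r \<Longrightarrow> r \<le> Greatest Pr"
    by (metis GreatestI_nat, metis Greatest_le_nat)
  define r where "r = Greatest Pr"
  obtain P where P: "P \<in> carrier_mat n n" "det P \<noteq> 0" and cols: "\<And>j. j < r \<Longrightarrow> col P j \<in> W" and rn: "r \<le> n"
    using ex unfolding Pr_def r_def by auto
  obtain Q where Q: "Q \<in> carrier_mat n n" "P * Q = 1\<^sub>m n" "Q * P = 1\<^sub>m n"
    using det_non_zero_imp_unit[OF P, of "()"] unfolding Units_def ring_mat_simps by auto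
  have "(Q *\<^sub>v w) $ i = 0" if w: "w \<in> W" and i: "r \<le> i" "i < n" for w i
  proof (rule ccontr)
    assume ne: "(Q *\<^sub>v w) $ i \<noteq> 0"
    define c where "c = Q *\<^sub>v w"
    have wn: "w \<in> carrier_vec n" using w sub by auto
    have c: "c \<in> carrier_vec n" unfolding c_def using Q wn by auto
    have ci: "c $ i \<noteq> 0" using ne unfolding c_def .
    have Pc: "P *\<^sub>v c = w"
      unfolding c_def using P Q wn by (metis assoc_mult_mat_vec one_mult_mat_vec)
    \<comment> \<open>\<open>P * E\<close> has \<open>w\<close> as column \<open>r\<close> and the
      old column \<open>r\<close> as column \<open>i\<close>; all other columns are those of
      \<open>P\<close>. For \<open>i = r\<close> only column \<open>r\<close> changes. Invertibility
      comes from \<open>c $ i \<noteq> 0\<close>.\<close>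
    define E where "E = mat n n (\<lambda>(k,l). if l = r then c $ k else if l = i then (if k = r then 1 else 0)
        else if k = l then 1 else 0)"
    have E: "E \<in> carrier_mat n n" unfolding E_def by simp
    have rlt: "r < n" using i by simp
    have det: "det E \<noteq> 0"
    proof
      assume "det E = 0"
      then obtain v where v: "v \<in> carrier_vec n" "v \<noteq> 0\<^sub>v n" "E *\<^sub>v v = 0\<^sub>v n"
        using det_0_iff_vec_prod_zero_field[OF E] by auto
      have eq: "(\<Sum>l<n. E $$ (k,l) * v $ l) = 0" if "k < n" for k
      proof -
        have "(E *\<^sub>v v) $ k = (\<Sum>l<n. E $$ (k,l) * v $ l)"
          using that E v(1) by (simp add: scalar_prod_def lessThan_atLeast0)
        then show ?thesis using v(3) that by simp
      qed
      have row: "(\<Sum>l<n. E $$ (k,l) * v $ l) =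
          c $ k * v $ r + (\<Sum>l\<in>{..<n}-{r}. E $$ (k,l) * v $ l)" if "k < n" for k
        using that rlt by (subst sum.remove[of _ r]) (auto simp: E_def)
      have "(\<Sum>l\<in>{..<n}-{r}. E $$ (i,l) * v $ l) = 0"
        by (rule sum.neutral) (use i in \<open>auto simp: E_def\<close>)
      then have vr: "v $ r = 0" using eq[OF i(2)] row[OF i(2)] ci by simp
      have vk: "v $ k = 0" if k: "k < n" "k \<noteq> r" "k \<noteq> i" for k
      proof -
        have "(\<Sum>l\<in>{..<n}-{r}. E $$ (k,l) * v $ l) = (\<Sum>l\<in>{..<n}-{r}. if l = k then v $ k else 0)"
          by (rule sum.cong) (use k in \<open>auto simp: E_def\<close>)
        also have "\<dots> = v $ k" using k by (simp add: sum.delta)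
        finally show ?thesis using eq[OF k(1)] row[OF k(1)] vr by simp
      qed
      have "v $ i = 0" if "i \<noteq> r"
      proof -
        have "(\<Sum>l\<in>{..<n}-{r}. E $$ (r,l) * v $ l) = (\<Sum>l\<in>{..<n}-{r}. if l = i then v $ i else 0)"
          by (rule sum.cong) (use rlt that in \<open>auto simp: E_def\<close>)
        also have "\<dots> = v $ i" using i that by (simp add: sum.delta)
        finally show ?thesis using eq[OF rlt] row[OF rlt] vr by simp
      qed
      then have "v $ k = 0" if "k < n" for k using vr vk that by metis
      then have "v = 0\<^sub>v n" using v(1) by (intro eq_vecI) auto
      then show False using v by simp
    qed
    have PE: "P * E \<in> carrier_mat n n" using P E by simp
    have colPE: "col (P * E) j = P *\<^sub>v col E j" if "j < n" for j
      using P(1) E that by (rule col_mult2)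
    have "col (P * E) j \<in> W" if j: "j < Suc r" for j
    proof (cases "j = r")
      case True
      have "col E r = c" using c rlt by (intro eq_vecI) (auto simp: E_def)
      then show ?thesis using colPE[of r] True rlt Pc w by simp
    next
      case False
      then have jr: "j < r" using j by simp
      have "col E j = unit_vec n j" using jr rlt i by (intro eq_vecI) (auto simp: E_def unit_vec_def)
      then have "col (P * E) j = col P j" using colPE[of j] jr rlt P(1)
        by (intro eq_vecI) auto
      then show ?thesis using cols jr by simp
    qed
    then have "Pr (Suc r)" unfolding Pr_def using PE rlt det P E
      by (auto intro!: bexI[of _ "P * E"] simp: det_mult)
    from gr[OF this] show False unfolding r_def by simp
  qed
  then show ?thesis using P Q rn cols by (intro bexI[of _ P] bexI[of _ Q] exI[of _ r]) auto
qed

lemma mat_trace_mult_commute: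
  assumes "A \<in> carrier_mat n n" "B \<in> carrier_mat n n"
  shows "mat_trace (A * B) = mat_trace (B * A)"
proof -
  have "mat_trace (A * B) = (\<Sum>i<n. \<Sum>j<n. A $$ (i,j) * B $$ (j,i))"
    using assms unfolding mat_trace_def by (auto simp: scalar_prod_def lessThan_atLeast0 intro!: sum.cong)
  also have "\<dots> = (\<Sum>j<n. \<Sum>i<n. B $$ (j,i) * A $$ (i,j))"
    by (subst sum.swap) (simp add: mult.commute)
  also have "\<dots> = mat_trace (B * A)"
    using assms unfolding mat_trace_def by (auto simp: scalar_prod_def lessThan_atLeast0 intro!: sum.cong)
  finally show ?thesis .
qed

lemma mat_trace_scalar: "mat_trace (c \<cdot>\<^sub>m 1\<^sub>m n) = of_nat n * c"
  unfolding mat_trace_def by simp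

text \<open>When \<open>B\<close> is a representation, this is the image of the sum of
  \<open>K\<close> in the group algebra. The entrywise definition reduces its laws to sums of
  complex numbers.\<close>

definition mat_sum :: "nat \<Rightarrow> ('i \<Rightarrow> complex mat) \<Rightarrow> 'i set \<Rightarrow> complex mat" where
  "mat_sum n B K = mat n n (\<lambda>(i,j). \<Sum>k\<in>K. B k $$ (i,j))"

lemma mat_sum_carrier [simp]: "mat_sum n B K \<in> carrier_mat n n"
  unfolding mat_sum_def by simp

lemma mult_mat_sum:
  assumes "A \<in> carrier_mat n n" "\<And>k. k \<in> K \<Longrightarrow> B k \<in> carrier_mat n n"
  shows "A * mat_sum n B K = mat_sum n (\<lambda>k. A * B k) K"
proof (rule eq_matI)
  fix i j assume ij: "i < dim_row (mat_sum n (\<lambda>k. A * B k) K)" "j < dim_col (mat_sum n (\<lambda>k. A * B k) K)"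
  then have ij: "i < n" "j < n" by (auto simp: mat_sum_def)
  have "(A * mat_sum n B K) $$ (i,j) = (\<Sum>l<n. \<Sum>k\<in>K. A $$ (i,l) * B k $$ (l,j))"
    using ij assms(1) by (simp add: mat_sum_def scalar_prod_def lessThan_atLeast0 sum_distrib_left)
  also have "\<dots> = (\<Sum>k\<in>K. \<Sum>l<n. A $$ (i,l) * B k $$ (l,j))" by (rule sum.swap)
  also have "\<dots> = (\<Sum>k\<in>K. (A * B k) $$ (i,j))"
    by (rule sum.cong) (use ij assms in \<open>force simp: scalar_prod_def lessThan_atLeast0\<close>)+
  finally show "(A * mat_sum n B K) $$ (i,j) = mat_sum n (\<lambda>k. A * B k) K $$ (i,j)"
    using ij by (simp add: mat_sum_def)
qed (use assms in \<open>auto simp: mat_sum_def\<close>)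

lemma mat_sum_mult:
  assumes "A \<in> carrier_mat n n" "\<And>k. k \<in> K \<Longrightarrow> B k \<in> carrier_mat n n"
  shows "mat_sum n B K * A = mat_sum n (\<lambda>k. B k * A) K"
proof (rule eq_matI)
  fix i j assume ij: "i < dim_row (mat_sum n (\<lambda>k. B k * A) K)" "j < dim_col (mat_sum n (\<lambda>k. B k * A) K)"
  then have ij: "i < n" "j < n" by (auto simp: mat_sum_def)
  have "(mat_sum n B K * A) $$ (i,j) = (\<Sum>l<n. \<Sum>k\<in>K. B k $$ (i,l) * A $$ (l,j))"
    using ij assms(1) by (simp add: mat_sum_def scalar_prod_def lessThan_atLeast0 sum_distrib_right)
  also have "\<dots> = (\<Sum>k\<in>K. \<Sum>l<n. B k $$ (i,l) * A $$ (l,j))" by (rule sum.swap)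
  also have "\<dots> = (\<Sum>k\<in>K. (B k * A) $$ (i,j))"
    by (rule sum.cong) (use ij assms in \<open>force simp: scalar_prod_def lessThan_atLeast0\<close>)+
  finally show "(mat_sum n B K * A) $$ (i,j) = mat_sum n (\<lambda>k. B k * A) K $$ (i,j)"
    using ij by (simp add: mat_sum_def)
qed (use assms in \<open>auto simp: mat_sum_def\<close>)

lemma mat_sum_cong:
  "(\<And>k. k \<in> K \<Longrightarrow> B k = B' k) \<Longrightarrow> mat_sum n B K = mat_sum n B' K"
  unfolding mat_sum_def by (auto intro!: sum.cong)

lemma mat_sum_reindex:
  "inj_on h K \<Longrightarrow> mat_sum n B (h ` K) = mat_sum n (\<lambda>k. B (h k)) K"
  unfolding mat_sum_def by (simp add: sum.reindex)

lemma mat_trace_mat_sum: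
  assumes "\<And>k. k \<in> K \<Longrightarrow> B k \<in> carrier_mat n n"
  shows "mat_trace (mat_sum n B K) = (\<Sum>k\<in>K. mat_trace (B k))"
proof -
  have "mat_trace (mat_sum n B K) = (\<Sum>i<n. \<Sum>k\<in>K. B k $$ (i,i))"
    by (simp add: mat_trace_def mat_sum_def)
  also have "\<dots> = (\<Sum>k\<in>K. \<Sum>i<n. B k $$ (i,i))" by (rule sum.swap)
  also have "\<dots> = (\<Sum>k\<in>K. mat_trace (B k))"
    by (rule sum.cong) (use assms in \<open>auto simp: mat_trace_def\<close>)
  finally show ?thesis .
qed

lemma mat_eq_vecI:
  fixes A B :: "'a :: comm_ring_1 mat"
  assumes "A \<in> carrier_mat n n" "B \<in> carrier_mat n n"
    and "\<And>v. v \<in> carrier_vec n \<Longrightarrow> A *\<^sub>v v = B *\<^sub>v v"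
  shows "A = B"
proof (rule eq_matI)
  fix i j assume ij: "i < dim_row B" "j < dim_col B"
  then have "(A *\<^sub>v unit_vec n j) $ i = (B *\<^sub>v unit_vec n j) $ i" using assms by auto
  then show "A $$ (i,j) = B $$ (i,j)" using ij assms(1,2) by auto
qed (use assms in auto)

lemma rep_carrier:
  assumes "group G" "\<rho> \<in> hom G (general_linear n)" "g \<in> carrier G"
  shows "\<rho> g \<in> carrier_mat n n"
  using assms hom_general_linear_iff by blast

lemma rep_mult:
  assumes "group G" "\<rho> \<in> hom G (general_linear n)" "g \<in> carrier G" "h \<in> carrier G"
  shows "\<rho> (g \<otimes>\<^bsub>G\<^esub> h) = \<rho> g * \<rho> h"
  using assms hom_general_linear_iff by blast

lemma rep_one:
  assumes "group G" "\<rho> \<in> hom G (general_linear n)"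
  shows "\<rho> \<one>\<^bsub>G\<^esub> = 1\<^sub>m n"
  using assms hom_general_linear_iff by blast

lemma irreducible_repD:
  assumes "irreducible_rep G n \<rho>"
  shows "0 < n" "\<rho> \<in> hom G (general_linear n)"
  using assms unfolding irreducible_rep_def by auto

lemma irreducible_rep_invariant:
  assumes "irreducible_rep G n \<rho>"
    and "W \<subseteq> carrier_vec n" "0\<^sub>v n \<in> W" "\<And>v w. v \<in> W \<Longrightarrow> w \<in> W \<Longrightarrow> v + w \<in> W"
    "\<And>c v. v \<in> W \<Longrightarrow> c \<cdot>\<^sub>v v \<in> W"
    "\<And>g w. g \<in> carrier G \<Longrightarrow> w \<in> W \<Longrightarrow> \<rho> g *\<^sub>v w \<in> W"
  shows "W = {0\<^sub>v n} \<or> W = carrier_vec n"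
  using assms unfolding irreducible_rep_def module_vec_subspace_iff by auto

text \<open>In a basis adapted to an invariant subspace a representation is block triangular, and the
  diagonal blocks are representations whose traces add up.\<close>

lemma exists_irreducible_rep_sum_trace:
  fixes G (structure)
  assumes G: "group G"
    and "\<rho> \<in> hom G (general_linear n)" "(\<Sum>x\<in>S. a x * mat_trace (\<rho> x)) \<noteq> 0" "S \<subseteq> carrier G"
  shows "\<exists>m \<sigma>. irreducible_rep G m \<sigma> \<and> (\<Sum>x\<in>S. a x * mat_trace (\<sigma> x)) \<noteq> 0"
  using assms(2,3)
proof (induction n arbitrary: \<rho> rule: less_induct)
  case (less n)
  note hom = less.prems(1)
  note car = rep_carrier[OF G hom] and mul = rep_mult[OF G hom] and one = rep_one[OF G hom]
  show ?case
  proof (cases "irreducible_rep G n \<rho>")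
    case True
    then show ?thesis using less.prems by blast
  next
    case False
    have n0: "n > 0"
    proof (rule ccontr)
      assume "\<not> n > 0"
      then have "mat_trace (\<rho> x) = 0" if "x \<in> S" for x
        using car[of x] that assms(4) by (auto simp: mat_trace_def)
      then show False using less.prems(2) by simp
    qed
    then obtain W where W: "W \<subseteq> carrier_vec n" "0\<^sub>v n \<in> W" "\<forall>v\<in>W. \<forall>w\<in>W. v + w \<in> W"
        "\<forall>c. \<forall>v\<in>W. c \<cdot>\<^sub>v v \<in> W"
      and inv: "\<forall>g\<in>carrier G. \<forall>w\<in>W. \<rho> g *\<^sub>v w \<in> W"
      and ne: "W \<noteq> {0\<^sub>v n}" "W \<noteq> carrier_vec n"
      using False hom unfolding irreducible_rep_def module_vec_subspace_iff by metis
    obtain P Q r where PQ: "P \<in> carrier_mat n n" "Q \<in> carrier_mat n n" "P * Q = 1\<^sub>m n" "Q * P = 1\<^sub>m n"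
      and r: "r \<le> n" and colW: "\<forall>j<r. col P j \<in> W"
      and QW: "\<forall>w\<in>W. \<forall>i<n. r \<le> i \<longrightarrow> (Q *\<^sub>v w) $ i = 0"
      using subspace_adapted_basis[OF W] by blast
    have PQv: "P *\<^sub>v (Q *\<^sub>v v) = v" "Q *\<^sub>v (P *\<^sub>v v) = v" if "v \<in> carrier_vec n" for v
      using that PQ assoc_mult_mat_vec[OF PQ(1,2) that, symmetric] assoc_mult_mat_vec[OF PQ(2,1) that, symmetric] by simp_all
    have "r \<noteq> 0"
    proof
      assume r0: "r = 0"
      have "w = 0\<^sub>v n" if w: "w \<in> W" for w
      proof -
        have wn: "w \<in> carrier_vec n" using w W by auto
        have "Q *\<^sub>v w = 0\<^sub>v n" using QW w r0 PQ wn by (intro eq_vecI) auto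
        moreover have "P *\<^sub>v (Q *\<^sub>v w) = w" by (rule PQv(1)[OF wn])
        ultimately have "w = P *\<^sub>v 0\<^sub>v n" by metis
        also have "\<dots> = 0\<^sub>v n" using PQ(1) by auto
        finally show ?thesis .
      qed
      then show False using ne(1) W(2) by blast
    qed
    moreover have "r \<noteq> n"
    proof
      assume rn: "r = n"
      have lin: "finsum_vec TYPE(complex) n f A \<in> W" if "finite A" "\<And>j. j \<in> A \<Longrightarrow> f j \<in> W"
        for f :: "nat \<Rightarrow> complex vec" and A
        using that
      proof (induction A rule: finite_induct)
        case empty
        then show ?case using W by (simp add: finsum_vec_empty)
      next
        case (insert x F)
        then show ?case using W by (subst finsum_vec_insert) auto
      qed
      have "v \<in> W" if v: "v \<in> carrier_vec n" for v
      proof -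
        define c where "c = Q *\<^sub>v v"
        have c: "c \<in> carrier_vec n" using PQ v by (auto simp: c_def)
        have f: "(\<lambda>j. c $ j \<cdot>\<^sub>v col P j) \<in> {..<n} \<rightarrow> carrier_vec n" using PQ by auto
        have "v = finsum_vec TYPE(complex) n (\<lambda>j. c $ j \<cdot>\<^sub>v col P j) {..<n}"
        proof (rule eq_vecI)
          fix i assume "i < dim_vec (finsum_vec TYPE(complex) n (\<lambda>j. c $ j \<cdot>\<^sub>v col P j) {..<n})"
          then have i: "i < n" using finsum_vec_closed[OF f] by simp
          have "v $ i = (P *\<^sub>v c) $ i" using PQv[OF v] by (simp add: c_def)
          also have "\<dots> = (\<Sum>j<n. P $$ (i,j) * c $ j)"
            using i PQ(1) c by (simp add: scalar_prod_def lessThan_atLeast0)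
          also have "\<dots> = (\<Sum>j<n. (c $ j \<cdot>\<^sub>v col P j) $ i)"
            by (rule sum.cong) (use i PQ(1) in \<open>auto simp: mult.commute\<close>)
          also have "\<dots> = finsum_vec TYPE(complex) n (\<lambda>j. c $ j \<cdot>\<^sub>v col P j) {..<n} $ i"
            by (rule index_finsum_vec[symmetric]) (use i f in auto)
          finally show "v $ i = finsum_vec TYPE(complex) n (\<lambda>j. c $ j \<cdot>\<^sub>v col P j) {..<n} $ i" .
        qed (use v finsum_vec_closed[OF f] in auto)
        also have "\<dots> \<in> W" by (rule lin) (use colW rn W in auto)
        finally show ?thesis .
      qed
      then show False using ne(2) W(1) by blast
    qed
    ultimately have r: "0 < r" "r < n" using r by auto
    \<comment> \<open>\<open>M\<close> is \<open>\<rho>\<close> in the basis of the columns of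
      \<open>P\<close>. The first \<open>r\<close> of them span the invariant subspace, hence the
      zero block below them in \<open>Mz\<close>.\<close>
    define M where "M g = Q * \<rho> g * P" for g
    have M: "M g \<in> carrier_mat n n" if "g \<in> carrier G" for g
      using PQ car[OF that] by (auto simp: M_def)
    have Mmul: "M (g \<otimes> h) = M g * M h" if gh: "g \<in> carrier G" "h \<in> carrier G" for g h
    proof -
      note c = PQ(1,2) car[OF gh(1)] car[OF gh(2)]
      have "P * (Q * Y) = Y" if "Y \<in> carrier_mat n n" for Y :: "complex mat"
        using that PQ assoc_mult_mat[OF PQ(1,2) that, symmetric] by simp
      then show ?thesis
        using c by (simp add: M_def mul gh assoc_mult_mat[of _ n n _ n _ n])
    qed
    have Mone: "M \<one> = 1\<^sub>m n" using PQ by (simp add: M_def one)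
    have Mz: "M g $$ (i,j) = 0" if g: "g \<in> carrier G" and ij: "r \<le> i" "i < n" "j < r" for g i j
    proof -
      have "M g = Q * (\<rho> g * P)"
        unfolding M_def using PQ(1,2) car[OF g] by (simp add: assoc_mult_mat[of _ n n _ n _ n])
      then have "col (M g) j = Q *\<^sub>v col (\<rho> g * P) j"
        using PQ(1,2) car[OF g] ij r by (simp only:) (rule col_mult2[of _ n n _ n], auto)
      also have "col (\<rho> g * P) j = \<rho> g *\<^sub>v col P j"
        using PQ(1,2) car[OF g] ij r by (intro col_mult2[of _ n n _ n]) auto
      finally have "col (M g) j = Q *\<^sub>v (\<rho> g *\<^sub>v col P j)" .
      then have "M g $$ (i,j) = (Q *\<^sub>v (\<rho> g *\<^sub>v col P j)) $ i"
        using M[OF g] ij r by (metis (no_types, lifting) carrier_matD index_col order_less_trans)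
      then show ?thesis using QW inv g colW ij by simp
    qed
    define A where "A g = mat r r (\<lambda>(i,j). M g $$ (i,j))" for g
    define B where "B g = mat (n - r) (n - r) (\<lambda>(i,j). M g $$ (i + r, j + r))" for g
    have split: "(\<Sum>k<n. f k) = (\<Sum>k<r. f k) + (\<Sum>k<n-r. f (k + r))" for f :: "nat \<Rightarrow> complex"
      using sum.atLeastLessThan_concat[of 0 r n f] sum.shift_bounds_nat_ivl[of f 0 r "n - r"] r
      by (simp add: lessThan_atLeast0)
    have Mind: "M (g \<otimes> h) $$ (i,j) = (\<Sum>k<n. M g $$ (i,k) * M h $$ (k,j))"
      if "g \<in> carrier G" "h \<in> carrier G" "i < n" "j < n" for g h i j
      using that M[of g] M[of h] by (simp add: Mmul scalar_prod_def lessThan_atLeast0)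
    have "A \<in> hom G (general_linear r)"
      unfolding hom_general_linear_iff[OF G]
    proof (intro conjI ballI)
      show "A g \<in> carrier_mat r r" for g by (simp add: A_def)
      show "A \<one> = 1\<^sub>m r" using r by (intro eq_matI) (auto simp: A_def Mone)
      fix g h assume gh: "g \<in> carrier G" "h \<in> carrier G"
      show "A (g \<otimes> h) = A g * A h"
        by (rule eq_matI) (use r gh in \<open>auto simp: A_def Mind Mz scalar_prod_def split simp flip: lessThan_atLeast0\<close>)
    qed
    moreover have "B \<in> hom G (general_linear (n - r))"
      unfolding hom_general_linear_iff[OF G]
    proof (intro conjI ballI)
      show "B g \<in> carrier_mat (n - r) (n - r)" for g by (simp add: B_def)
      show "B \<one> = 1\<^sub>m (n - r)" using r by (intro eq_matI) (auto simp: B_def Mone)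
      fix g h assume gh: "g \<in> carrier G" "h \<in> carrier G"
      show "B (g \<otimes> h) = B g * B h"
        by (rule eq_matI) (use r gh in \<open>auto simp: B_def Mind Mz scalar_prod_def split simp flip: lessThan_atLeast0\<close>)
    qed
    moreover have tr: "mat_trace (\<rho> g) = mat_trace (A g) + mat_trace (B g)" if g: "g \<in> carrier G" for g
    proof -
      have "mat_trace (M g) = mat_trace (P * (Q * \<rho> g))"
        unfolding M_def using PQ car[OF g] by (intro mat_trace_mult_commute[of _ n]) auto
      also have "P * (Q * \<rho> g) = \<rho> g"
        using PQ car[OF g] assoc_mult_mat[OF PQ(1,2) car[OF g], symmetric] by simp
      finally show ?thesis using M[OF g] split[of "\<lambda>i. M g $$ (i,i)"]
        by (simp add: mat_trace_def A_def B_def)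
    qed
    have "(\<Sum>x\<in>S. a x * mat_trace (\<rho> x)) =
        (\<Sum>x\<in>S. a x * mat_trace (A x)) + (\<Sum>x\<in>S. a x * mat_trace (B x))"
      unfolding sum.distrib[symmetric] using assms(4)
      by (intro sum.cong) (auto simp: tr distrib_left)
    then have "(\<Sum>x\<in>S. a x * mat_trace (A x)) \<noteq> 0 \<or> (\<Sum>x\<in>S. a x * mat_trace (B x)) \<noteq> 0"
      using less.prems(2) by auto
    ultimately show ?thesis using less.IH[of r A] less.IH[of "n - r" B] r by auto
  qed
qed

section \<open>Schur's lemma and sums over normal subgroups\<close>

lemma scalar_mat_mult_vec:
  fixes c :: complex
  assumes "v \<in> carrier_vec n"
  shows "(c \<cdot>\<^sub>m 1\<^sub>m n) *\<^sub>v v = c \<cdot>\<^sub>v v"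
  using assms by (intro eq_vecI) (auto simp: smult_scalar_prod_distrib[of _ n])

text \<open>Over the complex numbers \<open>A\<close> has an eigenvalue, and its eigenspace is
  invariant because \<open>A\<close> commutes with every \<open>\<rho> g\<close>.\<close>

lemma schur_scalar:
  assumes G: "group G" and irr: "irreducible_rep G n \<rho>" and A: "A \<in> carrier_mat n n"
    and comm: "\<And>g. g \<in> carrier G \<Longrightarrow> A * \<rho> g = \<rho> g * A"
  obtains c where "A = c \<cdot>\<^sub>m 1\<^sub>m n"
proof -
  note car = rep_carrier[OF G irreducible_repD(2)[OF irr]]
  obtain k where "k \<in> spectrum A"
    using spectrum_non_empty[OF A irreducible_repD(1)[OF irr]] by auto
  then obtain v where v: "v \<in> carrier_vec n" "v \<noteq> 0\<^sub>v n" "A *\<^sub>v v = k \<cdot>\<^sub>v v"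
    using A unfolding spectrum_def eigenvalue_def eigenvector_def by auto
  define W where "W = {w \<in> carrier_vec n. A *\<^sub>v w = k \<cdot>\<^sub>v w}"
  have "W = {0\<^sub>v n} \<or> W = carrier_vec n"
  proof (rule irreducible_rep_invariant[OF irr])
    show "0\<^sub>v n \<in> W" using A by (auto simp: W_def)
    show "v + w \<in> W" if "v \<in> W" "w \<in> W" for v w
      using that A by (auto simp: W_def mult_add_distrib_mat_vec smult_add_distrib_vec)
    show "c \<cdot>\<^sub>v v \<in> W" if "v \<in> W" for c v
      using that A by (auto simp: W_def mult_mat_vec smult_smult_assoc mult.commute)
    show "\<rho> g *\<^sub>v w \<in> W" if g: "g \<in> carrier G" and w: "w \<in> W" for g w
    proof -
      have "A *\<^sub>v (\<rho> g *\<^sub>v w) = (A * \<rho> g) *\<^sub>v w"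
        using A car[OF g] w by (simp add: W_def assoc_mult_mat_vec)
      also have "\<dots> = \<rho> g *\<^sub>v (A *\<^sub>v w)"
        unfolding comm[OF g] using A car[OF g] w by (simp add: W_def assoc_mult_mat_vec)
      also have "\<dots> = k \<cdot>\<^sub>v (\<rho> g *\<^sub>v w)"
        using w car[OF g] by (auto simp: W_def mult_mat_vec)
      finally show ?thesis using w car[OF g] by (auto simp: W_def)
    qed
  qed (auto simp: W_def)
  then have W: "W = carrier_vec n" using v unfolding W_def by blast
  have "A = k \<cdot>\<^sub>m 1\<^sub>m n"
  proof (rule mat_eq_vecI[OF A])
    show "A *\<^sub>v v = (k \<cdot>\<^sub>m 1\<^sub>m n) *\<^sub>v v" if "v \<in> carrier_vec n" for v
      using that W unfolding W_def by (auto simp: scalar_mat_mult_vec)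
  qed auto
  then show ?thesis by (rule that)
qed

text \<open>Scalar matrices preserve every subspace, so for \<open>n > 1\<close> the coordinate
  hyperplane \<open>w $ 1 = 0\<close> is a proper nonzero invariant one.\<close>

lemma irreducible_rep_scalar_degree:
  assumes irr: "irreducible_rep G n \<rho>"
    and sc: "\<And>g. g \<in> carrier G \<Longrightarrow> \<exists>c. \<rho> g = c \<cdot>\<^sub>m 1\<^sub>m n"
  shows "n = 1"
proof (rule ccontr)
  assume "n \<noteq> 1"
  then have n: "1 < n" using irreducible_repD(1)[OF irr] by simp
  define W where "W = {w \<in> carrier_vec n. w $ 1 = (0::complex)}"
  have "W = {0\<^sub>v n} \<or> W = carrier_vec n"
  proof (rule irreducible_rep_invariant[OF irr])
    show "\<rho> g *\<^sub>v w \<in> W" if g: "g \<in> carrier G" and w: "w \<in> W" for g w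
    proof -
      obtain c where "\<rho> g = c \<cdot>\<^sub>m 1\<^sub>m n" using sc[OF g] by blast
      then have "\<rho> g *\<^sub>v w = c \<cdot>\<^sub>v w" using w by (auto simp: W_def scalar_mat_mult_vec)
      then show ?thesis using w n by (auto simp: W_def)
    qed
  qed (use n in \<open>auto simp: W_def\<close>)
  moreover have "unit_vec n 0 \<in> W" "unit_vec n 0 \<noteq> (0\<^sub>v n :: complex vec)"
    using n by (auto simp: W_def)
  moreover have "unit_vec n 1 \<notin> W" using n by (auto simp: W_def)
  ultimately show False by auto
qed

text \<open>Normality makes the space of vectors fixed by \<open>K\<close> invariant under
  \<open>G\<close>, so it is everything or zero. The image of \<open>mat_sum n \<rho> K\<close>
  consists of fixed vectors and vanishes in the second case.\<close>

lemma rep_trivial_on_normal_or_sum_zero: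
  fixes G (structure)
  assumes irr: "irreducible_rep G n \<rho>" and K: "K \<lhd> G"
  shows "(\<forall>k\<in>K. \<rho> k = 1\<^sub>m n) \<or> mat_sum n \<rho> K = 0\<^sub>m n n"
proof -
  interpret K: normal K G by fact
  note G = K.is_group
  note hom = irreducible_repD(2)[OF irr]
  note car = rep_carrier[OF G hom] and mul = rep_mult[OF G hom]
  define W where "W = {w \<in> carrier_vec n. \<forall>k\<in>K. \<rho> k *\<^sub>v w = w}"
  have "W = {0\<^sub>v n} \<or> W = carrier_vec n"
  proof (rule irreducible_rep_invariant[OF irr])
    have "\<rho> k *\<^sub>v 0\<^sub>v n = 0\<^sub>v n" if "k \<in> K" for k
      using car[of k] that by auto
    then show "0\<^sub>v n \<in> W" by (auto simp: W_def)
    show "v + w \<in> W" if "v \<in> W" "w \<in> W" for v w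
      using that by (auto simp: W_def mult_add_distrib_mat_vec[OF car])
    show "c \<cdot>\<^sub>v v \<in> W" if "v \<in> W" for c v
      using that by (auto simp: W_def mult_mat_vec[OF car])
    show "\<rho> g *\<^sub>v w \<in> W" if g: "g \<in> carrier G" and w: "w \<in> W" for g w
    proof -
      have "\<rho> k *\<^sub>v (\<rho> g *\<^sub>v w) = \<rho> g *\<^sub>v w" if k: "k \<in> K" for k
      proof -
        define h where "h = inv g \<otimes> k \<otimes> g"
        have h: "h \<in> K" unfolding h_def using K.inv_op_closed1[OF g k] .
        have kc: "k \<in> carrier G" and hc: "h \<in> carrier G" using k h by auto
        have "g \<otimes> h = k \<otimes> g"
          unfolding h_def using g kc by (simp add: K.m_assoc[symmetric])
        then have "\<rho> k * \<rho> g = \<rho> g * \<rho> h" using mul g kc hc by metis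
        then have "\<rho> k *\<^sub>v (\<rho> g *\<^sub>v w) = \<rho> g *\<^sub>v (\<rho> h *\<^sub>v w)"
          using assoc_mult_mat_vec[OF car[OF kc] car[OF g], of w]
            assoc_mult_mat_vec[OF car[OF g] car[OF hc], of w] w by (simp add: W_def)
        then show ?thesis using w h by (simp add: W_def)
      qed
      then show ?thesis using w car[OF g] by (auto simp: W_def)
    qed
  qed (auto simp: W_def)
  then show ?thesis
  proof
    assume W: "W = carrier_vec n"
    have "\<rho> k = 1\<^sub>m n" if k: "k \<in> K" for k
    proof (rule mat_eq_vecI[OF car])
      show "\<rho> k *\<^sub>v v = 1\<^sub>m n *\<^sub>v v" if "v \<in> carrier_vec n" for v
        using that W k unfolding W_def by auto
    qed (use k in auto)
    then show ?thesis by blast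
  next
    assume W: "W = {0\<^sub>v n}"
    let ?E = "mat_sum n \<rho> K"
    have E: "\<rho> k * ?E = ?E" if k: "k \<in> K" for k
    proof -
      have kc: "k \<in> carrier G" using k by auto
      have img: "(\<lambda>x. k \<otimes> x) ` K = K"
      proof
        show "K \<subseteq> (\<lambda>x. k \<otimes> x) ` K"
        proof
          fix x assume x: "x \<in> K"
          then have "x = k \<otimes> (inv k \<otimes> x)" using k by (simp add: K.m_assoc[symmetric])
          then show "x \<in> (\<lambda>x. k \<otimes> x) ` K" using x k by blast
        qed
      qed (use k in auto)
      have inj: "inj_on (\<lambda>x. k \<otimes> x) K" using k by (auto intro!: inj_onI)
      have "\<rho> k * ?E = mat_sum n (\<lambda>x. \<rho> k * \<rho> x) K"
        by (rule mult_mat_sum) (use kc car in auto)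
      also have "\<dots> = mat_sum n (\<lambda>x. \<rho> (k \<otimes> x)) K"
        by (rule mat_sum_cong) (use kc mul in auto)
      also have "\<dots> = mat_sum n \<rho> ((\<lambda>x. k \<otimes> x) ` K)"
        by (rule mat_sum_reindex[OF inj, symmetric])
      finally show ?thesis by (simp only: img)
    qed
    have "?E = 0\<^sub>m n n"
    proof (rule mat_eq_vecI[of _ n])
      fix v :: "complex vec" assume v: "v \<in> carrier_vec n"
      have "\<rho> k *\<^sub>v (?E *\<^sub>v v) = ?E *\<^sub>v v" if k: "k \<in> K" for k
        using assoc_mult_mat_vec[OF car mat_sum_carrier v, of k \<rho> K] E[OF k] k by auto
      moreover have "?E *\<^sub>v v \<in> carrier_vec n" using mat_sum_carrier v by (rule mult_mat_vec_carrier)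
      ultimately have "?E *\<^sub>v v \<in> W" unfolding W_def by auto
      then show "?E *\<^sub>v v = 0\<^sub>m n n *\<^sub>v v" using W v by auto
    qed auto
    then show ?thesis by blast
  qed
qed

lemma rep_trivial_on_derived:
  fixes G (structure)
  assumes G: "group G" and hom: "\<rho> \<in> hom G (general_linear n)"
    and comm: "\<And>g h. g \<in> carrier G \<Longrightarrow> h \<in> carrier G \<Longrightarrow> \<rho> g * \<rho> h = \<rho> h * \<rho> g"
    and y: "y \<in> derived G (carrier G)"
  shows "\<rho> y = 1\<^sub>m n"
proof -
  interpret G: group G by fact
  note car = rep_carrier[OF G hom] and mul = rep_mult[OF G hom] and one = rep_one[OF G hom]
  have inv: "\<rho> g * \<rho> (inv g) = 1\<^sub>m n" if "g \<in> carrier G" for g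
    using that mul[of g "inv g"] one by simp
  have "y \<in> carrier G \<and> \<rho> y = 1\<^sub>m n"
    using y unfolding derived_def
  proof (induction rule: generate.induct)
    case one
    then show ?case using rep_one[OF G hom] by simp
  next
    case (incl h)
    then obtain a b where ab: "a \<in> carrier G" "b \<in> carrier G"
      and h: "h = a \<otimes> b \<otimes> inv a \<otimes> inv b" by auto
    have "\<rho> h = \<rho> (a \<otimes> b) * \<rho> (inv (b \<otimes> a))"
      unfolding h using ab by (simp add: mul[symmetric] G.inv_mult_group G.m_assoc)
    also have "\<rho> (a \<otimes> b) = \<rho> (b \<otimes> a)" using ab comm by (simp add: mul)
    finally show ?case using inv ab h by auto
  next
    case (inv h)
    then obtain a b where ab: "a \<in> carrier G" "b \<in> carrier G"
      and h: "h = a \<otimes> b \<otimes> inv a \<otimes> inv b" by auto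
    have "inv h = (b \<otimes> a) \<otimes> inv (a \<otimes> b)"
      unfolding h using ab by (simp add: G.inv_mult_group G.m_assoc)
    then have "\<rho> (inv h) = \<rho> (b \<otimes> a) * \<rho> (inv (a \<otimes> b))"
      using ab by (simp add: mul[symmetric])
    also have "\<rho> (b \<otimes> a) = \<rho> (a \<otimes> b)" using ab comm by (simp add: mul)
    finally show ?case using assms(1) \<open>\<And>g. g \<in> carrier G \<Longrightarrow> \<rho> g * \<rho> (inv g) = 1\<^sub>m n\<close> ab h by auto
  next
    case (eng h1 h2)
    then show ?case by (simp add: mul)
  qed
  then show ?thesis by blast
qed

lemma derived_normal:
  assumes "group G"
  shows "derived G (carrier G) \<lhd> G"
  using assms by (simp add: group.derived_self_is_normal)

text \<open>The alternative to a zero sum is a trivial action of the derived subgroup. Then all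
  \<open>\<rho> g\<close> commute, are scalar by Schur's lemma, and the degree is 1.\<close>

lemma nl_sum_derived_zero:
  fixes G (structure)
  assumes G: "group G" and irr: "irreducible_rep G n \<rho>" and n: "n \<noteq> 1"
  shows "mat_sum n \<rho> (derived G (carrier G)) = 0\<^sub>m n n"
proof (rule ccontr)
  assume "mat_sum n \<rho> (derived G (carrier G)) \<noteq> 0\<^sub>m n n"
  then have triv: "\<rho> k = 1\<^sub>m n" if "k \<in> derived G (carrier G)" for k
    using rep_trivial_on_normal_or_sum_zero[OF irr derived_normal[OF G]] that by blast
  interpret G: group G by fact
  note hom = irreducible_repD(2)[OF irr]
  note car = rep_carrier[OF G hom] and mul = rep_mult[OF G hom]
  have "\<exists>c. \<rho> g = c \<cdot>\<^sub>m 1\<^sub>m n" if g: "g \<in> carrier G" for g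
  proof -
    have "\<rho> g * \<rho> h = \<rho> h * \<rho> g" if h: "h \<in> carrier G" for h
    proof -
      define k where "k = g \<otimes> h \<otimes> inv g \<otimes> inv h"
      have k: "k \<in> derived G (carrier G)"
        unfolding derived_def k_def using g h by (intro generate.incl) blast
      have kc: "k \<in> carrier G" using g h by (simp add: k_def)
      have "g \<otimes> h = k \<otimes> (h \<otimes> g)"
        unfolding k_def using g h by (simp add: G.m_assoc G.inv_solve_left')
      then have "\<rho> g * \<rho> h = \<rho> k * (\<rho> h * \<rho> g)"
        using g h kc mul by (metis G.m_closed)
      then show ?thesis
        using triv[OF k] left_mult_one_mat[OF mult_carrier_mat[OF car[OF h] car[OF g]]] by simp
    qed
    then show ?thesis using schur_scalar[OF G irr car[OF g]] by metis
  qed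
  then have "n = 1" by (rule irreducible_rep_scalar_degree[OF irr])
  then show False using n by simp
qed

section \<open>The regular representation and the existence of linear characters\<close>

lemma exists_regular_rep:
  fixes G (structure)
  assumes G: "group G" and fin: "finite (carrier G)"
  obtains \<rho> where "\<rho> \<in> hom G (general_linear (card (carrier G)))"
    "\<And>x. x \<in> carrier G \<Longrightarrow> mat_trace (\<rho> x) = (if x = \<one> then of_nat (card (carrier G)) else 0)"
proof -
  interpret G: group G by fact
  let ?N = "card (carrier G)"
  obtain e where e: "bij_betw e {..<?N} (carrier G)"
    using ex_bij_betw_nat_finite[OF fin] by (auto simp: lessThan_atLeast0)
  have ec: "e i \<in> carrier G" if "i < ?N" for i using e that by (auto simp: bij_betw_def)
  have einj: "e i = e j \<longleftrightarrow> i = j" if "i < ?N" "j < ?N" for i j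
    using e that by (auto simp: bij_betw_def inj_on_def)
  define \<rho> where "\<rho> x = mat ?N ?N (\<lambda>(i,j). if x \<otimes> e j = e i then 1 else (0::complex))" for x
  have "\<rho> \<in> hom G (general_linear ?N)"
    unfolding hom_general_linear_iff[OF G]
  proof (intro conjI ballI)
    show "\<rho> g \<in> carrier_mat ?N ?N" for g by (simp add: \<rho>_def)
    show "\<rho> \<one> = 1\<^sub>m ?N" by (rule eq_matI) (auto simp: \<rho>_def ec einj)
    fix g h assume gh: "g \<in> carrier G" "h \<in> carrier G"
    show "\<rho> (g \<otimes> h) = \<rho> g * \<rho> h"
    proof (rule eq_matI)
      fix i j assume "i < dim_row (\<rho> g * \<rho> h)" "j < dim_col (\<rho> g * \<rho> h)"
      then have ij: "i < ?N" "j < ?N" by (auto simp: \<rho>_def)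
      have "h \<otimes> e j \<in> e ` {..<?N}" using e gh ec[OF ij(2)] by (auto simp: bij_betw_def)
      then obtain l where l: "l < ?N" "h \<otimes> e j = e l" by auto
      have "(\<rho> g * \<rho> h) $$ (i,j) = (\<Sum>k<?N. (if g \<otimes> e k = e i then 1 else 0) * (if h \<otimes> e j = e k then 1 else 0))"
        using ij by (simp add: \<rho>_def scalar_prod_def lessThan_atLeast0)
      also have "\<dots> = (\<Sum>k<?N. if k = l then (if g \<otimes> e k = e i then 1 else 0) else 0)"
        by (rule sum.cong) (use l einj in auto)
      also have "\<dots> = (if g \<otimes> e l = e i then 1 else 0)" using l by simp
      also have "\<dots> = \<rho> (g \<otimes> h) $$ (i,j)"
        using ij gh ec l by (simp add: \<rho>_def G.m_assoc)
      finally show "\<rho> (g \<otimes> h) $$ (i,j) = (\<rho> g * \<rho> h) $$ (i,j)" by simp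
    qed (auto simp: \<rho>_def)
  qed
  moreover have "mat_trace (\<rho> x) = (if x = \<one> then of_nat ?N else 0)" if x: "x \<in> carrier G" for x
  proof -
    have "mat_trace (\<rho> x) = (\<Sum>i<?N. if x \<otimes> e i = e i then 1 else 0)"
      by (simp add: mat_trace_def \<rho>_def)
    also have "\<dots> = (\<Sum>i<?N. if x = \<one> then 1 else 0)"
      by (rule sum.cong) (use x ec in \<open>auto simp: G.r_cancel_one'\<close>)
    finally show ?thesis by simp
  qed
  ultimately show ?thesis by (rule that)
qed

text \<open>The weights 1 on \<open>K\<close> and -1 on the coset of \<open>z\<close> give
  \<open>card (carrier H)\<close> on the regular representation, so some irreducible
  \<open>\<rho>\<close> separates \<open>K\<close> from that coset in trace. A zero sum over
  \<open>K\<close> would kill both traces, so \<open>K\<close> acts trivially. As \<open>K\<close>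
  contains the derived subgroup, the sum over the latter is nonzero and \<open>\<rho>\<close> has
  degree 1.\<close>

lemma exists_linear_character:
  fixes H (structure)
  assumes K: "K \<lhd> H" and fin: "finite (carrier H)" and der: "derived H (carrier H) \<subseteq> K"
    and z: "z \<in> carrier H" "z \<notin> K"
  shows "\<exists>\<mu>::'a \<Rightarrow> complex. (\<forall>x\<in>carrier H. \<forall>y\<in>carrier H. \<mu> (x \<otimes> y) = \<mu> x * \<mu> y) \<and>
    (\<forall>k\<in>K. \<mu> k = 1) \<and> \<mu> z \<noteq> 1"
proof -
  interpret K: normal K H by fact
  note H = K.is_group
  have finK: "finite K" using fin K.subset finite_subset by blast
  obtain R where R: "R \<in> hom H (general_linear (card (carrier H)))"
    and trR: "\<And>x. x \<in> carrier H \<Longrightarrow> mat_trace (R x) = (if x = \<one> then of_nat (card (carrier H)) else 0)"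
    using exists_regular_rep[OF H fin] by blast
  let ?zK = "(\<lambda>k. k \<otimes> z) ` K"
  define a :: "'a \<Rightarrow> complex" where "a x = (if x \<in> K then 1 else -1)" for x
  have zK: "?zK \<subseteq> carrier H" using z by auto
  have disj: "K \<inter> ?zK = {}"
  proof (rule ccontr)
    assume "K \<inter> ?zK \<noteq> {}"
    then obtain k where k: "k \<in> K" "k \<otimes> z \<in> K" by auto
    then have "inv k \<otimes> (k \<otimes> z) \<in> K" by blast
    then show False using k z by (simp add: K.m_assoc[symmetric])
  qed
  have inj: "inj_on (\<lambda>k. k \<otimes> z) K" using z by (auto intro!: inj_onI)
  have sum: "(\<Sum>x\<in>K \<union> ?zK. a x * f x) = (\<Sum>k\<in>K. f k) - (\<Sum>k\<in>K. f (k \<otimes> z))" for f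
  proof -
    have "(\<Sum>x\<in>?zK. a x * f x) = (\<Sum>x\<in>?zK. - f x)"
      by (rule sum.cong) (use disj in \<open>auto simp: a_def\<close>)
    then show ?thesis
      using finK disj by (simp add: sum.union_disjoint a_def sum.reindex[OF inj] sum_negf)
  qed
  have "(\<Sum>x\<in>K \<union> ?zK. a x * mat_trace (R x)) = of_nat (card (carrier H))"
  proof -
    have "(\<Sum>k\<in>K. mat_trace (R k)) = (\<Sum>k\<in>K. if k = \<one> then of_nat (card (carrier H)) else 0)"
      by (rule sum.cong) (auto simp: trR)
    moreover have "(\<Sum>k\<in>K. mat_trace (R (k \<otimes> z))) = 0"
    proof (rule sum.neutral, rule ballI)
      fix k assume k: "k \<in> K"
      have "k \<otimes> z \<in> ?zK" using k by blast
      then have "k \<otimes> z \<notin> K" using disj by blast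
      then have "\<one> \<noteq> k \<otimes> z" using subgroup.one_closed[OF normal_imp_subgroup[OF K]] by metis
      then show "mat_trace (R (k \<otimes> z)) = 0" using trR k z by auto
    qed
    ultimately show ?thesis unfolding sum using finK by simp
  qed
  moreover have "card (carrier H) \<noteq> 0" using fin by auto
  ultimately obtain n \<rho> where irr: "irreducible_rep H n \<rho>"
    and ne: "(\<Sum>x\<in>K \<union> ?zK. a x * mat_trace (\<rho> x)) \<noteq> 0"
    using exists_irreducible_rep_sum_trace[OF H R, where S="K \<union> ?zK" and a=a] zK K.subset by auto
  note hom = irreducible_repD(2)[OF irr]
  note car = rep_carrier[OF H hom] and mul = rep_mult[OF H hom]
  have ne': "(\<Sum>k\<in>K. mat_trace (\<rho> k)) \<noteq> (\<Sum>k\<in>K. mat_trace (\<rho> (k \<otimes> z)))"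
    using ne unfolding sum by simp
  have triv: "\<forall>k\<in>K. \<rho> k = 1\<^sub>m n"
  proof (rule ccontr)
    assume "\<not> ?thesis"
    then have E: "mat_sum n \<rho> K = 0\<^sub>m n n"
      using rep_trivial_on_normal_or_sum_zero[OF irr K] by blast
    have "(\<Sum>k\<in>K. mat_trace (\<rho> k)) = mat_trace (mat_sum n \<rho> K)"
      by (rule mat_trace_mat_sum[symmetric]) (simp add: car)
    moreover have "(\<Sum>k\<in>K. mat_trace (\<rho> (k \<otimes> z))) = mat_trace (mat_sum n (\<lambda>k. \<rho> k * \<rho> z) K)"
    proof -
      have "mat_trace (mat_sum n (\<lambda>k. \<rho> k * \<rho> z) K) = (\<Sum>k\<in>K. mat_trace (\<rho> k * \<rho> z))"
        by (rule mat_trace_mat_sum) (use z in \<open>simp add: mult_carrier_mat[OF car car]\<close>)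
      then show ?thesis using mul z by auto
    qed
    moreover have "mat_sum n (\<lambda>k. \<rho> k * \<rho> z) K = mat_sum n \<rho> K * \<rho> z"
      by (rule mat_sum_mult[symmetric]) (use car z in auto)
    moreover have "0\<^sub>m n n * \<rho> z = 0\<^sub>m n n" using car[OF z(1)] by simp
    ultimately show False using ne' E by simp
  qed
  have "mat_sum n \<rho> (derived H (carrier H)) \<noteq> 0\<^sub>m n n"
  proof
    assume "mat_sum n \<rho> (derived H (carrier H)) = 0\<^sub>m n n"
    then have "0 = mat_trace (mat_sum n \<rho> (derived H (carrier H)))"
      by (simp add: mat_trace_def)
    also have "\<dots> = (\<Sum>k\<in>derived H (carrier H). mat_trace (\<rho> k))"
      by (rule mat_trace_mat_sum) (use der K.subset car in auto)
    also have "\<dots> = (\<Sum>k\<in>derived H (carrier H). of_nat n)"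
      by (rule sum.cong) (use der triv in \<open>auto simp: mat_trace_def\<close>)
    also have "\<dots> = of_nat (card (derived H (carrier H)) * n)" by simp
    finally have "card (derived H (carrier H)) * n = 0" by (metis of_nat_eq_0_iff)
    moreover have "finite (derived H (carrier H))" "derived H (carrier H) \<noteq> {}"
      using der finK finite_subset generate.one unfolding derived_def by blast+
    ultimately show False using irreducible_repD(1)[OF irr] by simp
  qed
  then have n: "n = 1" using nl_sum_derived_zero[OF H irr] by blast
  show ?thesis
  proof (intro exI conjI ballI)
    fix x y assume xy: "x \<in> carrier H" "y \<in> carrier H"
    show "mat_trace (\<rho> (x \<otimes> y)) = mat_trace (\<rho> x) * mat_trace (\<rho> y)"
      using car[OF xy(1)] car[OF xy(2)] n by (simp add: mul xy mat_trace_def scalar_prod_def)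
  next
    show "mat_trace (\<rho> k) = 1" if "k \<in> K" for k using triv that n by (simp add: mat_trace_def)
    show "mat_trace (\<rho> z) \<noteq> 1"
    proof
      assume z1: "mat_trace (\<rho> z) = 1"
      have "mat_trace (\<rho> (k \<otimes> z)) = mat_trace (\<rho> k)" if k: "k \<in> K" for k
        using k z triv z1 n car[OF z(1)] by (simp add: mul mat_trace_def)
      then show False using ne' by simp
    qed
  qed
qed

section \<open>Vanishing of nonlinear characters and classes that are cosets\<close>

lemma character_class_function:
  fixes G (structure)
  assumes G: "group G" and hom: "\<rho> \<in> hom G (general_linear n)" and xg: "x \<in> carrier G" "g \<in> carrier G"
  shows "mat_trace (\<rho> (x \<otimes> g \<otimes> inv x)) = mat_trace (\<rho> g)"
proof -
  interpret G: group G by fact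
  note car = rep_carrier[OF G hom] and mul = rep_mult[OF G hom]
  have "\<rho> (x \<otimes> g \<otimes> inv x) = \<rho> x * \<rho> (g \<otimes> inv x)"
    using xg by (simp add: mul[symmetric] G.m_assoc)
  also have "mat_trace \<dots> = mat_trace (\<rho> (g \<otimes> inv x) * \<rho> x)"
    by (rule mat_trace_mult_commute[of _ n]) (use xg car in auto)
  also have "\<rho> (g \<otimes> inv x) * \<rho> x = \<rho> g"
    using xg by (simp add: mul[symmetric] G.m_assoc)
  finally show ?thesis .
qed

lemma nlE:
  assumes G: "group G" and "\<chi> \<in> nl G"
  obtains n \<rho> where "irreducible_rep G n \<rho>" "n \<noteq> 1" "\<chi> = character G \<rho>"
proof -
  interpret G: group G by fact
  obtain n \<rho> d where irr: "irreducible_rep G n \<rho>" and \<chi>: "\<chi> = character G \<rho>"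
    and d: "\<chi> \<one>\<^bsub>G\<^esub> = of_nat d" "1 < d"
    using assms(2) unfolding nl_def irreducible_characters_def by auto
  have "\<chi> \<one>\<^bsub>G\<^esub> = of_nat n"
    using rep_one[OF G irreducible_repD(2)[OF irr]] by (simp add: \<chi> character_def mat_trace_def)
  then have "n \<noteq> 1" using d by auto
  then show ?thesis using that irr \<chi> by blast
qed

lemma nlI:
  assumes G: "group G" and irr: "irreducible_rep G n \<rho>" and n: "n \<noteq> 1"
  shows "character G \<rho> \<in> nl G"
proof -
  interpret G: group G by fact
  have "character G \<rho> \<one>\<^bsub>G\<^esub> = of_nat n"
    using rep_one[OF G irreducible_repD(2)[OF irr]] by (simp add: character_def mat_trace_def)
  moreover have "1 < n" using n irreducible_repD(1)[OF irr] by simp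
  ultimately show ?thesis using irr unfolding nl_def irreducible_characters_def by blast
qed

text \<open>Every \<open>y \<otimes> g\<close> with \<open>y\<close> in the derived subgroup is
  conjugate to \<open>g\<close>. So \<open>\<chi> g\<close> is the mean of the traces of
  \<open>\<rho> y * \<rho> g\<close>, and the sum of these \<open>\<rho> y\<close> is zero. The
  lemma is applied to the subgroup \<open>C\<close>, to bound its vanishing-off subgroup.\<close>

lemma nl_vanishes_if_class_is_coset:
  fixes G (structure)
  assumes G: "group G" and fin: "finite (carrier G)" and g: "g \<in> carrier G"
    and cls: "\<And>y. y \<in> derived G (carrier G) \<Longrightarrow>
      \<exists>x\<in>carrier G. x \<otimes> g \<otimes> inv x \<otimes> inv g = y"
    and \<chi>: "\<chi> \<in> nl G"
  shows "\<chi> g = 0"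
proof -
  interpret G: group G by fact
  let ?D = "derived G (carrier G)"
  obtain n \<rho> where irr: "irreducible_rep G n \<rho>" and n: "n \<noteq> 1" and \<chi>: "\<chi> = character G \<rho>"
    using nlE[OF G \<chi>] by blast
  note hom = irreducible_repD(2)[OF irr]
  note car = rep_carrier[OF G hom] and mul = rep_mult[OF G hom]
  have D: "?D \<subseteq> carrier G" by (simp add: G.derived_in_carrier)
  have finD: "finite ?D" using D fin finite_subset by blast
  have "mat_trace (\<rho> y * \<rho> g) = mat_trace (\<rho> g)" if y: "y \<in> ?D" for y
  proof -
    obtain x where x: "x \<in> carrier G" "x \<otimes> g \<otimes> inv x \<otimes> inv g = y"
      using cls[OF y] by blast
    then have "y \<otimes> g = x \<otimes> g \<otimes> inv x" using g by (auto simp: G.m_assoc)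
    then show ?thesis
      using character_class_function[OF G hom x(1) g] y D g by (metis mul subsetD)
  qed
  then have "of_nat (card ?D) * mat_trace (\<rho> g) = (\<Sum>y\<in>?D. mat_trace (\<rho> y * \<rho> g))" by simp
  also have "\<dots> = mat_trace (mat_sum n (\<lambda>y. \<rho> y * \<rho> g) ?D)"
    by (rule mat_trace_mat_sum[symmetric]) (use D g in \<open>blast intro: mult_carrier_mat[OF car car]\<close>)
  also have "mat_sum n (\<lambda>y. \<rho> y * \<rho> g) ?D = mat_sum n \<rho> ?D * \<rho> g"
    by (rule mat_sum_mult[symmetric]) (use car g D in auto)
  also have "\<dots> = 0\<^sub>m n n"
    using nl_sum_derived_zero[OF G irr n] car[OF g] by simp
  finally have "of_nat (card ?D) * mat_trace (\<rho> g) = 0" by (simp add: mat_trace_def)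
  moreover have "?D \<noteq> {}" using generate.one unfolding derived_def by blast
  ultimately show ?thesis using finD g by (simp add: \<chi> character_def)
qed

text \<open>Suppose the set \<open>S\<close> of commutators with \<open>g\<close> misses
  \<open>y\<close>. The difference of the averages over \<open>S\<close> and over the derived
  subgroup is nonzero on the regular representation but zero on linear characters, so it is nonzero
  on an irreducible \<open>\<rho>\<close> of larger degree. There the class sum of \<open>g\<close>
  is a nonzero scalar, and therefore \<open>\<rho>\<close> has nonzero trace at
  \<open>g\<close>.\<close>

lemma class_is_coset_if_nl_vanishes:
  fixes G (structure)
  assumes G: "group G" and fin: "finite (carrier G)" and g: "g \<in> carrier G"
    and van: "\<And>\<chi>. \<chi> \<in> nl G \<Longrightarrow> \<chi> g = 0"
    and y: "y \<in> derived G (carrier G)"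
  shows "\<exists>x\<in>carrier G. x \<otimes> g \<otimes> inv x \<otimes> inv g = y"
proof (rule ccontr)
  interpret G: group G by fact
  let ?D = "derived G (carrier G)" and ?N = "card (carrier G)"
  define cl where "cl = (\<lambda>x. x \<otimes> g \<otimes> inv x) ` carrier G"
  define S where "S = (\<lambda>h. h \<otimes> inv g) ` cl"
  assume "\<not> ?thesis"
  then have yS: "y \<notin> S" unfolding S_def cl_def by auto
  have D: "?D \<subseteq> carrier G" by (simp add: G.derived_in_carrier)
  have clG: "cl \<subseteq> carrier G" using g by (auto simp: cl_def)
  have SD: "S \<subseteq> ?D"
    unfolding derived_def S_def cl_def using g by (auto intro!: generate.incl)
  have fins: "finite ?D" "finite S" "finite cl" using D SD clG fin finite_subset by metis+
  have one: "\<one> \<in> S" "\<one> \<in> ?D"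
  proof -
    have "g \<in> cl" unfolding cl_def using g by (intro image_eqI[of _ _ "\<one>"]) auto
    then show "\<one> \<in> S" unfolding S_def using g by (intro image_eqI[of _ _ g]) auto
    then show "\<one> \<in> ?D" using SD by blast
  qed
  have "S \<subset> ?D" using SD yS y by auto
  then have lt: "card S < card ?D" using fins psubset_card_mono by blast
  have S0: "card S \<noteq> 0" using one fins by auto
  define a :: "_ \<Rightarrow> complex" where
    "a x = (if x \<in> S then 1 / of_nat (card S) else 0) - 1 / of_nat (card ?D)" for x
  have sum: "(\<Sum>x\<in>?D. a x * f x) = (\<Sum>x\<in>S. f x) / of_nat (card S) - (\<Sum>x\<in>?D. f x) / of_nat (card ?D)" for f
  proof -
    have "(\<Sum>x\<in>?D. (if x \<in> S then 1 / of_nat (card S) else 0) * f x) = (\<Sum>x\<in>S. 1 / of_nat (card S) * f x)"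
      by (rule sum.mono_neutral_cong_right) (use fins SD in auto)
    then show ?thesis by (simp add: a_def left_diff_distrib sum_subtractf sum_divide_distrib)
  qed
  obtain R where R: "R \<in> hom G (general_linear ?N)"
    and trR: "\<And>x. x \<in> carrier G \<Longrightarrow> mat_trace (R x) = (if x = \<one> then of_nat ?N else 0)"
    using exists_regular_rep[OF G fin] by blast
  \<comment> \<open>On the regular representation only \<open>\<one>\<close> contributes. It lies in
    both sets, so the two averages are \<open>?N / card S\<close> and \<open>?N / card ?D\<close>,
    which differ.\<close>
  have sR: "(\<Sum>x\<in>T. mat_trace (R x)) = of_nat ?N" if "T \<subseteq> ?D" "\<one> \<in> T" for T
  proof -
    have "(\<Sum>x\<in>T. mat_trace (R x)) = (\<Sum>x\<in>T. if x = \<one> then of_nat ?N else 0)"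
      by (rule sum.cong) (use that D trR in auto)
    then show ?thesis using that fins finite_subset[of T ?D] by simp
  qed
  have "?N \<noteq> 0" using fin by auto
  then have "(\<Sum>x\<in>?D. a x * mat_trace (R x)) \<noteq> 0"
    unfolding sum using sR[OF SD one(1)] sR[OF subset_refl one(2)] lt S0
    by (simp add: divide_simps)
  then obtain n \<rho> where irr: "irreducible_rep G n \<rho>"
    and ne: "(\<Sum>x\<in>?D. a x * mat_trace (\<rho> x)) \<noteq> 0"
    using exists_irreducible_rep_sum_trace[OF G R _ D] by blast
  note hom = irreducible_repD(2)[OF irr]
  note car = rep_carrier[OF G hom] and mul = rep_mult[OF G hom]
  have n: "n \<noteq> 1"
  proof
    assume n1: "n = 1"
    have "\<rho> g * \<rho> h = \<rho> h * \<rho> g" if "g \<in> carrier G" "h \<in> carrier G" for g h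
      using car[OF that(1)] car[OF that(2)] n1 by (intro eq_matI) (auto simp: scalar_prod_def)
    then have "\<rho> x = 1\<^sub>m n" if "x \<in> ?D" for x using rep_trivial_on_derived[OF G hom _ that] by blast
    then have "mat_trace (\<rho> x) = 1" if "x \<in> ?D" for x using n1 that by (simp add: mat_trace_def)
    then have "(\<Sum>x\<in>T. mat_trace (\<rho> x)) = of_nat (card T)" if "T \<subseteq> ?D" for T
      using that by (simp add: subset_iff)
    from this[OF SD] this[OF subset_refl] show False using ne S0 lt unfolding sum by simp
  qed
  have "(\<Sum>x\<in>?D. mat_trace (\<rho> x)) = mat_trace (mat_sum n \<rho> ?D)"
    by (rule mat_trace_mat_sum[symmetric]) (use D car in auto)
  then have "(\<Sum>x\<in>S. mat_trace (\<rho> x)) \<noteq> 0"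
    using ne nl_sum_derived_zero[OF G irr n] unfolding sum by (simp add: mat_trace_def)
  then have neS: "(\<Sum>x\<in>S. mat_trace (\<rho> x)) \<noteq> 0" .
  have inj: "inj_on (\<lambda>h. h \<otimes> inv g) cl"
    using g clG by (intro inj_onI) (metis G.inv_closed G.r_cancel subsetD)
  have "(\<Sum>x\<in>S. mat_trace (\<rho> x)) = (\<Sum>h\<in>cl. mat_trace (\<rho> h * \<rho> (inv g)))"
    unfolding S_def sum.reindex[OF inj] o_def by (rule sum.cong) (use mul clG g in auto)
  also have "\<dots> = mat_trace (mat_sum n (\<lambda>h. \<rho> h * \<rho> (inv g)) cl)"
    by (rule mat_trace_mat_sum[symmetric]) (use clG g in \<open>blast intro: mult_carrier_mat[OF car car]\<close>)
  also have "mat_sum n (\<lambda>h. \<rho> h * \<rho> (inv g)) cl = mat_sum n \<rho> cl * \<rho> (inv g)"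
    by (rule mat_sum_mult[symmetric]) (use car g clG in auto)
  finally have ne2: "mat_trace (mat_sum n \<rho> cl * \<rho> (inv g)) \<noteq> 0" using neS by simp
  \<comment> \<open>Conjugation by \<open>x\<close> permutes the class, so the class sum commutes
    with the representation and Schur's lemma applies.\<close>
  have "mat_sum n \<rho> cl * \<rho> x = \<rho> x * mat_sum n \<rho> cl" if x: "x \<in> carrier G" for x
  proof -
    define c where "c h = inv x \<otimes> h \<otimes> x" for h
    have injc: "inj_on c cl"
    proof (rule inj_onI)
      fix h k assume hk: "h \<in> cl" "k \<in> cl" "c h = c k"
      then have "inv x \<otimes> (h \<otimes> x) = inv x \<otimes> (k \<otimes> x)"
        using x clG by (simp add: c_def G.m_assoc subset_iff)
      then show "h = k" using x hk(1,2) clG by (simp add: subset_iff)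
    qed
    have "c ` cl \<subseteq> cl"
    proof (clarsimp simp: cl_def)
      fix z assume z: "z \<in> carrier G"
      have "c (z \<otimes> g \<otimes> inv z) = (inv x \<otimes> z) \<otimes> g \<otimes> inv (inv x \<otimes> z)"
        using x z g by (simp add: c_def G.m_assoc G.inv_mult_group)
      then show "c (z \<otimes> g \<otimes> inv z) \<in> (\<lambda>x. x \<otimes> g \<otimes> inv x) ` carrier G"
        using x z by blast
    qed
    then have img: "c ` cl = cl" using endo_inj_surj[OF fins(3) _ injc] by blast
    have "\<rho> x * mat_sum n \<rho> cl = \<rho> x * mat_sum n \<rho> (c ` cl)" by (simp only: img)
    also have "\<dots> = \<rho> x * mat_sum n (\<lambda>h. \<rho> (c h)) cl" by (simp only: mat_sum_reindex[OF injc])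
    also have "\<dots> = mat_sum n (\<lambda>h. \<rho> x * \<rho> (c h)) cl"
      by (rule mult_mat_sum) (use car x clG in \<open>auto simp: c_def\<close>)
    also have "\<dots> = mat_sum n (\<lambda>h. \<rho> h * \<rho> x) cl"
    proof (rule mat_sum_cong)
      fix h assume "h \<in> cl"
      then have h: "h \<in> carrier G" using clG by blast
      have "x \<otimes> c h = h \<otimes> x" using x h by (simp add: c_def G.m_assoc[symmetric])
      then show "\<rho> x * \<rho> (c h) = \<rho> h * \<rho> x"
        using mul[of x "c h"] mul[of h x] x h by (simp add: c_def)
    qed
    also have "\<dots> = mat_sum n \<rho> cl * \<rho> x"
      by (rule mat_sum_mult[symmetric]) (use car x clG in auto)
    finally show ?thesis by simp
  qed
  then obtain c where c: "mat_sum n \<rho> cl = c \<cdot>\<^sub>m 1\<^sub>m n"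
    using schur_scalar[OF G irr mat_sum_carrier] by metis
  have "c \<noteq> 0"
  proof
    assume "c = 0"
    then have "mat_sum n \<rho> cl = 0\<^sub>m n n" using c by (auto intro!: eq_matI)
    then show False using ne2 car[of "inv g"] g by (simp add: mat_trace_def)
  qed
  then have "mat_trace (mat_sum n \<rho> cl) \<noteq> 0"
    using irreducible_repD(1)[OF irr] by (simp add: c mat_trace_scalar)
  moreover have "mat_trace (mat_sum n \<rho> cl) = (\<Sum>h\<in>cl. mat_trace (\<rho> h))"
    by (rule mat_trace_mat_sum) (use clG car in auto)
  moreover have "mat_trace (\<rho> h) = mat_trace (\<rho> g)" if "h \<in> cl" for h
    using that character_class_function[OF G hom _ g] by (auto simp: cl_def)
  ultimately have "mat_trace (\<rho> g) \<noteq> 0" by auto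
  then show False using van[OF nlI[OF G irr n]] g by (simp add: character_def)
qed

section \<open>Bicharacters\<close>

text \<open>A pairing of two groups, abelian or not, into the multiplicative group of the complex
  numbers. Nonvanishing excludes the zero function, which satisfies both product laws.\<close>

definition bicharacter :: "('a, 'm) monoid_scheme \<Rightarrow> ('b, 'n) monoid_scheme \<Rightarrow> ('a \<Rightarrow> 'b \<Rightarrow> complex) \<Rightarrow> bool" where
  "bicharacter A B f \<longleftrightarrow>
    (\<forall>x\<in>carrier A. \<forall>y\<in>carrier B. f x y \<noteq> 0) \<and>
    (\<forall>x\<in>carrier A. \<forall>x'\<in>carrier A. \<forall>y\<in>carrier B. f (x \<otimes>\<^bsub>A\<^esub> x') y = f x y * f x' y) \<and>
    (\<forall>x\<in>carrier A. \<forall>y\<in>carrier B. \<forall>y'\<in>carrier B. f x (y \<otimes>\<^bsub>B\<^esub> y') = f x y * f x y')"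

definition left_kernel where
  "left_kernel A B f = {x \<in> carrier A. \<forall>y\<in>carrier B. f x y = (1::complex)}"

definition right_kernel where
  "right_kernel A B f = {y \<in> carrier B. \<forall>x\<in>carrier A. f x y = (1::complex)}"

lemma bicharacter_flip: "bicharacter A B f \<Longrightarrow> bicharacter B A (\<lambda>y x. f x y)"
  unfolding bicharacter_def by blast

lemma left_kernel_flip: "left_kernel B A (\<lambda>y x. f x y) = right_kernel A B f"
  unfolding left_kernel_def right_kernel_def by blast

lemma bicharacter_one:
  assumes "bicharacter A B f" "group A" "y \<in> carrier B"
  shows "f \<one>\<^bsub>A\<^esub> y = 1"
proof -
  interpret A: group A by fact
  have "f (\<one>\<^bsub>A\<^esub> \<otimes>\<^bsub>A\<^esub> \<one>\<^bsub>A\<^esub>) y = f \<one>\<^bsub>A\<^esub> y * f \<one>\<^bsub>A\<^esub> y"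
    using assms unfolding bicharacter_def by blast
  moreover have "f \<one>\<^bsub>A\<^esub> y \<noteq> 0" using assms unfolding bicharacter_def by blast
  ultimately show ?thesis by simp
qed

lemma bicharacter_inv:
  assumes "bicharacter A B f" "group A" "x \<in> carrier A" "y \<in> carrier B"
  shows "f (inv\<^bsub>A\<^esub> x) y = inverse (f x y)"
proof -
  interpret A: group A by fact
  have "f (inv\<^bsub>A\<^esub> x \<otimes>\<^bsub>A\<^esub> x) y = f (inv\<^bsub>A\<^esub> x) y * f x y"
    using assms unfolding bicharacter_def by blast
  then have "f (inv\<^bsub>A\<^esub> x) y * f x y = 1" using bicharacter_one[OF assms(1,2,4)] assms(3) by simp
  then show ?thesis by (metis inverse_unique mult.commute)
qed

lemma left_kernel_subgroup:
  assumes "bicharacter A B f" "group A"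
  shows "subgroup (left_kernel A B f) A"
proof -
  interpret A: group A by fact
  show ?thesis
  proof (rule A.subgroupI)
    show "left_kernel A B f \<noteq> {}" using bicharacter_one[OF assms] unfolding left_kernel_def by blast
    show "inv\<^bsub>A\<^esub> x \<in> left_kernel A B f" if "x \<in> left_kernel A B f" for x
      using that bicharacter_inv[OF assms] unfolding left_kernel_def by auto
    show "x \<otimes>\<^bsub>A\<^esub> y \<in> left_kernel A B f" if "x \<in> left_kernel A B f" "y \<in> left_kernel A B f" for x y
      using that assms unfolding left_kernel_def bicharacter_def by auto
  qed (auto simp: left_kernel_def)
qed

text \<open>Translation by an element \<open>z\<close> with \<open>h z \<noteq> 1\<close> permutes
  the group and multiplies the sum by \<open>h z\<close>.\<close>

lemma sum_linear_character:
  fixes h :: "'a \<Rightarrow> complex"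
  assumes "group B" and h: "\<And>y y'. y \<in> carrier B \<Longrightarrow> y' \<in> carrier B \<Longrightarrow> h (y \<otimes>\<^bsub>B\<^esub> y') = h y * h y'"
  shows "(\<Sum>y\<in>carrier B. h y) = (if \<forall>y\<in>carrier B. h y = 1 then of_nat (card (carrier B)) else 0)"
proof (cases "\<forall>y\<in>carrier B. h y = 1")
  case False
  interpret B: group B by fact
  obtain z where z: "z \<in> carrier B" "h z \<noteq> 1" using False by blast
  have "bij_betw (\<lambda>y. z \<otimes>\<^bsub>B\<^esub> y) (carrier B) (carrier B)"
    by (rule bij_betw_byWitness[where f'="\<lambda>y. inv\<^bsub>B\<^esub> z \<otimes>\<^bsub>B\<^esub> y"]) (use z in \<open>auto simp: B.m_assoc[symmetric]\<close>)
  then have "(\<Sum>y\<in>carrier B. h y) = (\<Sum>y\<in>carrier B. h (z \<otimes>\<^bsub>B\<^esub> y))"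
    by (rule sum.reindex_bij_betw[symmetric])
  also have "\<dots> = h z * (\<Sum>y\<in>carrier B. h y)"
    unfolding sum_distrib_left by (rule sum.cong) (use h z in auto)
  finally have "(\<Sum>y\<in>carrier B. h y) = 0" using z by (simp add: algebra_simps)
  then show ?thesis using False by (simp only: if_False)
qed simp

text \<open>Both sides are the sum of all values of the pairing.\<close>

lemma card_left_kernel_right_kernel:
  assumes A: "group A" "finite (carrier A)" and B: "group B" "finite (carrier B)" and f: "bicharacter A B f"
  shows "card (left_kernel A B f) * card (carrier B) = card (right_kernel A B f) * card (carrier A)"
proof -
  have half: "(\<Sum>x\<in>carrier A. \<Sum>y\<in>carrier B. f x y) = of_nat (card (left_kernel A B f) * card (carrier B))"
    if A: "finite (carrier A)" and B: "group B" and f: "bicharacter A B f"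
    for A :: "('x, 'm) monoid_scheme" and B :: "('y, 'n) monoid_scheme" and f
  proof -
    have "(\<Sum>y\<in>carrier B. f x y) = (if x \<in> left_kernel A B f then of_nat (card (carrier B)) else 0)"
      if "x \<in> carrier A" for x
      using sum_linear_character[OF B, of "f x"] f that
      unfolding bicharacter_def left_kernel_def by auto
    then have "(\<Sum>x\<in>carrier A. \<Sum>y\<in>carrier B. f x y) =
        (\<Sum>x\<in>carrier A. if x \<in> left_kernel A B f then of_nat (card (carrier B)) else 0)"
      by (rule sum.cong[OF refl])
    also have "\<dots> = (\<Sum>x\<in>left_kernel A B f. of_nat (card (carrier B)))"
      using A by (intro sum.mono_neutral_cong_right) (auto simp: left_kernel_def)
    finally show ?thesis by simp
  qed
  have "of_nat (card (left_kernel A B f) * card (carrier B)) =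
      (\<Sum>y\<in>carrier B. \<Sum>x\<in>carrier A. f x y)"
    using half[OF A(2) B(1) f] sum.swap by metis
  also have "\<dots> = of_nat (card (right_kernel A B f) * card (carrier A))"
    using half[OF B(2) A(1) bicharacter_flip[OF f]] unfolding left_kernel_flip .
  finally show ?thesis by (metis of_nat_eq_iff)
qed

text \<open>A maximal isotropic subgroup equals its orthogonal complement.\<close>

lemma alternating_bicharacter_square:
  assumes G: "group G" "finite (carrier G)" and f: "bicharacter G G f"
    and alt: "\<And>x. x \<in> carrier G \<Longrightarrow> f x x = 1"
  shows "\<exists>m::nat. card (carrier G) = m\<^sup>2 * card (left_kernel G G f)"
proof -
  interpret G: group G by fact
  have fmul1: "f (x \<otimes>\<^bsub>G\<^esub> y) z = f x z * f y z" and fmul2: "f z (x \<otimes>\<^bsub>G\<^esub> y) = f z x * f z y"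
    if "x \<in> carrier G" "y \<in> carrier G" "z \<in> carrier G" for x y z
    using f that unfolding bicharacter_def by blast+
  have skew: "f x y * f y x = 1" if "x \<in> carrier G" "y \<in> carrier G" for x y
  proof -
    have "f (x \<otimes>\<^bsub>G\<^esub> y) (x \<otimes>\<^bsub>G\<^esub> y) = f x x * f x y * (f y x * f y y)"
      using that by (simp add: fmul1 fmul2)
    then show ?thesis using alt that by simp
  qed
  define R where "R = left_kernel G G f"
  \<comment> \<open>The condition \<open>R \<subseteq> M\<close> makes the left kernel of the
    pairing of \<open>M\<close> with \<open>G\<close> equal to \<open>R\<close>.\<close>
  define iso where "iso M \<longleftrightarrow> subgroup M G \<and> R \<subseteq> M \<and> (\<forall>x\<in>M. \<forall>y\<in>M. f x y = 1)" for M
  have R: "subgroup R G" unfolding R_def by (rule left_kernel_subgroup[OF f G(1)])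
  have isoR: "iso R" unfolding iso_def using R by (auto simp: R_def left_kernel_def)
  have "finite {M. iso M}"
    by (rule finite_subset[of _ "Pow (carrier G)"]) (use G in \<open>auto simp: iso_def dest: subgroup.subset\<close>)
  then obtain M where M: "iso M" and max: "\<And>N. iso N \<Longrightarrow> M \<subseteq> N \<Longrightarrow> N = M"
    using isoR finite_has_maximal[of "{M. iso M}"] by blast
  have Ms: "subgroup M G" and MG: "M \<subseteq> carrier G" using M subgroup.subset by (auto simp: iso_def)
  let ?H = "G\<lparr>carrier := M\<rparr>"
  have H: "group ?H" using Ms G.subgroup_imp_group by blast
  have fH: "bicharacter ?H G f" using f MG unfolding bicharacter_def by (simp add: subset_iff)
  have perp: "right_kernel ?H G f = M"
  proof
    show "M \<subseteq> right_kernel ?H G f" using M MG unfolding iso_def right_kernel_def by auto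
    show "right_kernel ?H G f \<subseteq> M"
    proof
      fix y assume "y \<in> right_kernel ?H G f"
      then have y: "y \<in> carrier G" and fy: "\<And>x. x \<in> M \<Longrightarrow> f x y = 1" by (auto simp: right_kernel_def)
      have fy': "f y x = 1" if "x \<in> M" for x using skew[of x y] fy[OF that] that MG y by auto
      \<comment> \<open>Adjoining \<open>y\<close> keeps the subgroup isotropic because
        \<open>f y y = 1\<close>. Isotropy is extended from the generators to \<open>N\<close> in
        one argument (\<open>s1\<close>) and then in the other (\<open>s2\<close>).\<close>
      define N where "N = generate G (insert y M)"
      have ins: "insert y M \<subseteq> carrier G" using y MG by auto
      have N: "subgroup N G" unfolding N_def using ins by (rule G.generate_is_subgroup)
      have NG: "N \<subseteq> carrier G" using N subgroup.subset by blast
      have ker: "subgroup {x \<in> carrier G. \<forall>z\<in>T. f x z = 1} G" if "T \<subseteq> carrier G" for T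
      proof (rule G.subgroupI)
        show "{x \<in> carrier G. \<forall>z\<in>T. f x z = 1} \<noteq> {}"
          using bicharacter_one[OF f G(1)] that by blast
      qed (use that bicharacter_inv[OF f G(1)] in \<open>auto simp: fmul1 subset_iff\<close>)
      have s1: "f x z = 1" if "x \<in> N" "z \<in> insert y M" for x z
      proof -
        have "insert y M \<subseteq> {x \<in> carrier G. \<forall>z\<in>insert y M. f x z = 1}"
          using ins fy fy' alt[OF y] M unfolding iso_def by auto
        then have "N \<subseteq> {x \<in> carrier G. \<forall>z\<in>insert y M. f x z = 1}"
          unfolding N_def using ker[OF ins] G.generate_subgroup_incl by blast
        then show ?thesis using that by blast
      qed
      have s2: "f x z = 1" if "x \<in> N" "z \<in> N" for x z
      proof -
        have "insert y M \<subseteq> {x \<in> carrier G. \<forall>z\<in>N. f x z = 1}"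
        proof
          fix x assume x: "x \<in> insert y M"
          have "f x z = 1" if "z \<in> N" for z
            using skew[of z x] s1[OF that x] x ins NG that by auto
          then show "x \<in> {x \<in> carrier G. \<forall>z\<in>N. f x z = 1}" using x ins by auto
        qed
        from G.generate_subgroup_incl[OF this ker[OF NG], folded N_def]
        have "N \<subseteq> {x \<in> carrier G. \<forall>z\<in>N. f x z = 1}" .
        then show ?thesis using that by blast
      qed
      have MN: "insert y M \<subseteq> N" unfolding N_def by (auto intro: generate.incl)
      have "R \<subseteq> N" using MN M unfolding iso_def by blast
      then have "iso N" unfolding iso_def using N s2 by blast
      then show "y \<in> M" using max MN by blast
    qed
  qed
  have "left_kernel ?H G f = R"
    using M MG unfolding R_def left_kernel_def iso_def by auto
  \<comment> \<open>As \<open>M\<close> is its own orthogonal complement, the kernel count reads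
    \<open>|R| |G| = |M|^2\<close>. Since \<open>|R|\<close> divides \<open>|M|\<close>, the
    quotient \<open>|G| / |R|\<close> is a square.\<close>
  then have "card R * card (carrier G) = card M * card M"
    using card_left_kernel_right_kernel[OF H _ G fH] perp MG G(2) finite_subset by auto
  moreover have "card R dvd card M"
  proof -
    have "subgroup R ?H" using G.subgroup_incl[OF R Ms] M unfolding iso_def by blast
    from group.lagrange[OF H this] have "card M = card (rcosets\<^bsub>?H\<^esub> R) * card R"
      by (simp add: Coset.order_def)
    then show ?thesis by (rule dvdI[OF trans[OF _ mult.commute]])
  qed
  then obtain m where m: "card M = card R * m" by auto
  moreover have "card R \<noteq> 0"
    using R G(2) by (metis card_0_eq finite_subset subgroup.one_closed subgroup.subset empty_iff)
  ultimately have "card (carrier G) = m\<^sup>2 * card R"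
    by (simp add: power2_eq_square mult.assoc mult.left_commute)
  then show ?thesis unfolding R_def by blast
qed

section \<open>Linear spaces of alternating forms over a prime field\<close>

text \<open>Summing \<open>(t + 1)^(e + 1) - t^(e + 1)\<close> over \<open>t < p\<close> telescopes
  to \<open>p^(e + 1)\<close>, and its expansion expresses \<open>e + 1\<close> times the power sum
  through lower ones; \<open>e + 1 < p\<close> is invertible modulo \<open>p\<close>. In the case
  \<open>e = 0\<close> the term \<open>0 ^ 0\<close> counts as 1, so the sum is
  \<open>p\<close>.\<close>

lemma sum_powers_cong_0:
  assumes p: "Factorial_Ring.prime (p::nat)" and e: "e < p - 1"
  shows "[(\<Sum>t<p. int t ^ e) = 0] (mod int p)"
  using e
proof (induction e rule: less_induct)
  case (less e)
  have "(\<Sum>t<p. int (Suc t) ^ Suc e - int t ^ Suc e) = int p ^ Suc e"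
    by (subst sum_lessThan_telescope) simp
  moreover have "int (Suc t) ^ Suc e - int t ^ Suc e = (\<Sum>k<e. int (Suc e choose k) * int t ^ k) + int (Suc e) * int t ^ e" for t
  proof -
    have "int (Suc t) ^ Suc e = (int t + 1) ^ Suc e" by (simp add: add.commute)
    also have "\<dots> = (\<Sum>k\<le>Suc e. int (Suc e choose k) * int t ^ k)"
      by (subst binomial_ring) simp
    also have "\<dots> = (\<Sum>k<e. int (Suc e choose k) * int t ^ k) + int (Suc e) * int t ^ e + int t ^ Suc e"
      by (simp add: lessThan_Suc_atMost[symmetric] del: binomial_Suc_Suc)
    finally show ?thesis by simp
  qed
  ultimately have "int p ^ Suc e = (\<Sum>t<p. (\<Sum>k<e. int (Suc e choose k) * int t ^ k) + int (Suc e) * int t ^ e)"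
    by simp
  also have "\<dots> = (\<Sum>t<p. \<Sum>k<e. int (Suc e choose k) * int t ^ k) + (\<Sum>t<p. int (Suc e) * int t ^ e)"
    by (rule sum.distrib)
  also have "(\<Sum>t<p. \<Sum>k<e. int (Suc e choose k) * int t ^ k) = (\<Sum>k<e. int (Suc e choose k) * (\<Sum>t<p. int t ^ k))"
    by (subst sum.swap) (simp add: sum_distrib_left)
  also have "(\<Sum>t<p. int (Suc e) * int t ^ e) = int (Suc e) * (\<Sum>t<p. int t ^ e)"
    by (simp only: sum_distrib_left)
  finally have eq: "int p ^ Suc e = (\<Sum>k<e. int (Suc e choose k) * (\<Sum>t<p. int t ^ k)) + int (Suc e) * (\<Sum>t<p. int t ^ e)" .
  have "int p dvd (\<Sum>k<e. int (Suc e choose k) * (\<Sum>t<p. int t ^ k))"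
    using less by (intro dvd_sum) (auto simp: cong_0_iff)
  moreover have "int p dvd int p ^ Suc e" by simp
  ultimately have "int p dvd int (Suc e) * (\<Sum>t<p. int t ^ e)"
    unfolding eq by (simp only: dvd_add_right_iff)
  moreover have "\<not> int p dvd int (Suc e)"
    using less.prems by (auto simp: int_dvd_int_iff dest: dvd_imp_le simp del: of_nat_Suc)
  moreover have "Factorial_Ring.prime (int p)" using p by simp
  ultimately show ?case by (simp add: prime_dvd_mult_iff cong_0_iff del: of_nat_Suc)
qed

text \<open>Integer polynomial functions in the first \<open>n\<close> variables of total degree at
  most \<open>d\<close>. Generation by monomials reduces every additive statement about them to
  monomials.\<close>

inductive poly_fun :: "nat \<Rightarrow> nat \<Rightarrow> ((nat \<Rightarrow> int) \<Rightarrow> int) \<Rightarrow> bool" for n d where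
  monomial: "(\<Sum>l<n. e l) \<le> d \<Longrightarrow> poly_fun n d (\<lambda>x. c * (\<Prod>l<n. x l ^ e l))"
| add: "poly_fun n d f \<Longrightarrow> poly_fun n d g \<Longrightarrow> poly_fun n d (\<lambda>x. f x + g x)"

lemma poly_fun_const: "poly_fun n d (\<lambda>x. c)"
  using poly_fun.monomial[where n=n and d=d and e="\<lambda>_. 0" and c=c] by simp

lemma poly_fun_linear:
  assumes "0 < d"
  shows "poly_fun n d (\<lambda>x. \<Sum>l<n. x l * c l)"
proof -
  have "poly_fun n d (\<lambda>x. \<Sum>l<m. x l * c l)" if "m \<le> n" for m
    using that
  proof (induction m)
    case (Suc m)
    have "(\<Prod>l<n. x l ^ (if l = m then 1 else 0)) = x m" for x :: "nat \<Rightarrow> int"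
    proof -
      have "(\<Prod>l<n. x l ^ (if l = m then 1 else 0)) = (\<Prod>l<n. if l = m then x l else 1)"
        by (rule prod.cong) auto
      then show ?thesis using Suc.prems by simp
    qed
    then have "poly_fun n d (\<lambda>x. c m * x m)"
      using poly_fun.monomial[where n=n and d=d and e="\<lambda>l. if l = m then 1 else 0" and c="c m"] Suc.prems assms by simp
    then show ?case using poly_fun.add Suc by (simp add: mult.commute)
  qed (simp add: poly_fun_const)
  then show ?thesis by blast
qed

lemma poly_fun_sum:
  assumes "\<And>i. i \<in> I \<Longrightarrow> poly_fun n d (f i)"
  shows "poly_fun n d (\<lambda>x. \<Sum>i\<in>I. f i x)"
  using assms by (induction I rule: infinite_finite_induct) (auto simp: poly_fun_const poly_fun.add)

lemma poly_fun_mult: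
  assumes "poly_fun n d f" "poly_fun n d' g"
  shows "poly_fun n (d + d') (\<lambda>x. f x * g x)"
  using assms(1)
proof (induction rule: poly_fun.induct)
  case (monomial e c)
  show ?case using assms(2)
  proof (induction rule: poly_fun.induct)
    case (monomial e' c')
    have "poly_fun n (d + d') (\<lambda>x. c * c' * (\<Prod>l<n. x l ^ (e l + e' l)))"
      using monomial \<open>(\<Sum>l<n. e l) \<le> d\<close> by (intro poly_fun.monomial) (simp add: sum.distrib)
    then show ?case by (simp add: power_add prod.distrib mult_ac)
  next
    case (add f g)
    then show ?case using poly_fun.add by (simp add: distrib_left)
  qed
next
  case (add f g)
  then show ?case using poly_fun.add by (simp add: distrib_right)
qed

lemma poly_fun_prod:
  assumes "finite I" "\<And>i. i \<in> I \<Longrightarrow> poly_fun n d (f i)"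
  shows "poly_fun n (card I * d) (\<lambda>x. \<Prod>i\<in>I. f i x)"
  using assms by (induction I rule: finite_induct) (auto simp: poly_fun_const poly_fun_mult)

lemma poly_fun_power:
  assumes "poly_fun n d f"
  shows "poly_fun n (k * d) (\<lambda>x. f x ^ k)"
  by (induction k) (auto simp: poly_fun_const poly_fun_mult assms)

text \<open>By the degree bound some variable of each monomial has exponent below
  \<open>p - 1\<close>. The sum over the box factors, and the factor of that variable is a power sum
  divisible by \<open>p\<close>. This is the core of the Chevalley-Warning argument.\<close>

lemma sum_poly_fun_cong_0:
  assumes p: "Factorial_Ring.prime (p::nat)" and "poly_fun n d f" "d < n * (p - 1)"
  shows "[(\<Sum>x\<in>PiE {..<n} (\<lambda>_. int ` {..<p}). f x) = 0] (mod int p)"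
  using assms(2)
proof (induction rule: poly_fun.induct)
  case (monomial e c)
  have "\<exists>l<n. e l < p - 1"
  proof (rule ccontr)
    assume "\<not> ?thesis"
    then have "(\<Sum>l<n. p - 1) \<le> (\<Sum>l<n. e l)" by (intro sum_mono) (meson lessThan_iff not_less)
    then show False using monomial assms(3) by simp
  qed
  then obtain l where l: "l < n" "e l < p - 1" by blast
  have "(\<Sum>x\<in>PiE {..<n} (\<lambda>_. int ` {..<p}). \<Prod>l<n. x l ^ e l) = (\<Prod>l<n. \<Sum>t\<in>int ` {..<p}. t ^ e l)"
    by (rule prod_sum_PiE[symmetric]) auto
  also have "\<dots> = (\<Prod>l<n. \<Sum>t<p. int t ^ e l)" by (simp add: sum.reindex)
  finally have "(\<Sum>x\<in>PiE {..<n} (\<lambda>_. int ` {..<p}). c * (\<Prod>l<n. x l ^ e l)) = c * (\<Prod>l<n. \<Sum>t<p. int t ^ e l)"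
    by (simp add: sum_distrib_left[symmetric])
  moreover have "int p dvd (\<Prod>l<n. \<Sum>t<p. int t ^ e l)"
    using sum_powers_cong_0[OF p l(2)] l(1) by (auto simp: cong_0_iff intro: dvd_trans[OF _ dvd_prodI])
  ultimately show ?case by (simp add: cong_0_iff)
next
  case (add f g)
  then show ?case by (simp add: sum.distrib cong_0_iff)
qed

section \<open>Determinants of alternating matrices and determinants modulo a prime\<close>

lemma det_swap_both:
  fixes A :: "'a :: comm_ring_1 mat"
  assumes A: "A \<in> carrier_mat n n" and kl: "k < n" "l < n" "k \<noteq> l"
  shows "det (swaprows k l (swapcols k l A)) = det A"
  using det_swaprows[OF kl, of "swapcols k l A"] det_swapcols[OF kl A] A by simp

text \<open>A nonzero entry is moved to position (0, 1), and the Schur complement of the leading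
  2-by-2 block is again alternating.\<close>

lemma det_alternating_square:
  fixes A :: "'a :: field mat"
  assumes "A \<in> carrier_mat n n" "\<And>i j. i < n \<Longrightarrow> j < n \<Longrightarrow> A $$ (j,i) = - A $$ (i,j)"
    "\<And>i. i < n \<Longrightarrow> A $$ (i,i) = 0"
  shows "\<exists>s. det A = s\<^sup>2"
  using assms
proof (induction n arbitrary: A rule: less_induct)
  case (less n)
  note A = less.prems(1) and skew = less.prems(2) and diag = less.prems(3)
  consider (zero) "n = 0" | (row) "n > 0" "\<And>j. j < n \<Longrightarrow> A $$ (0,j) = 0"
    | (entry) j where "n > 0" "j < n" "A $$ (0,j) \<noteq> 0"
    by blast
  then show ?case
  proof cases
    case zero
    then have "det A = 1\<^sup>2" using A det_dim_zero by simp
    then show ?thesis by blast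
  next
    case row
    have "det A = (\<Sum>j<n. A $$ (0,j) * cofactor A 0 j)"
      by (rule laplace_expansion_row[OF A row(1)])
    also have "\<dots> = 0\<^sup>2" using row by simp
    finally show ?thesis by blast
  next
    case (entry j0)
    have j0: "0 < j0" using entry diag[of 0] by (cases j0) auto
    then have n2: "2 \<le> n" using entry by simp
    \<comment> \<open>Exchanging both rows and columns \<open>1\<close> and \<open>j0\<close>
      preserves the determinant and the alternating property; \<open>t\<close> is the transposition
      of indices behind it.\<close>
    define B where "B = (if j0 = 1 then A else swaprows 1 j0 (swapcols 1 j0 A))"
    have B: "B \<in> carrier_mat n n" using A by (auto simp: B_def)
    have detB: "det B = det A" using det_swap_both[OF A, of 1 j0] n2 entry by (simp add: B_def)
    define t where "t i = (if i = 1 then j0 else if i = j0 then 1 else i)" for i :: nat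
    have t: "t i < n" if "i < n" for i using that n2 entry by (simp add: t_def)
    have Bt: "B $$ (i,j) = A $$ (t i, t j)" if "i < n" "j < n" for i j
      using that entry n2 A unfolding B_def t_def by auto
    have skewB: "B $$ (j,i) = - B $$ (i,j)" if "i < n" "j < n" for i j
      unfolding Bt[OF that] Bt[OF that(2,1)] using skew[OF t[OF that(1)] t[OF that(2)]] .
    have diagB: "B $$ (i,i) = 0" if "i < n" for i
      unfolding Bt[OF that that] using diag[OF t[OF that]] .
    define c where "c = B $$ (0,1)"
    have c: "c \<noteq> 0" using entry j0 n2 unfolding c_def by (subst Bt) (auto simp: t_def)
    define m where "m = n - 2"
    have nm: "n = m + 2" "n = 2 + m" using n2 by (auto simp: m_def)
    define J where "J = mat 2 2 (\<lambda>(i,j). B $$ (i,j))"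
    define U where "U = mat 2 m (\<lambda>(i,j). B $$ (i,j+2))"
    define L where "L = mat m 2 (\<lambda>(i,j). B $$ (i+2,j))"
    define D where "D = mat m m (\<lambda>(i,j). B $$ (i+2,j+2))"
    \<comment> \<open>\<open>K\<close> is \<open>- L * J^(-1)\<close>, where \<open>J\<close> has
      the rows \<open>(0, c)\<close> and \<open>(- c, 0)\<close>. Hence \<open>E\<close> clears the
      block \<open>L\<close>, and \<open>S = D + K * U\<close> is the Schur complement.\<close>
    define K where "K = mat m 2 (\<lambda>(i,j). if j = 0 then - B $$ (i+2,1) / c else B $$ (i+2,0) / c)"
    define S where "S = mat m m (\<lambda>(i,j). B $$ (i+2,j+2) + (- B $$ (i+2,1) * B $$ (0,j+2) + B $$ (i+2,0) * B $$ (1,j+2)) / c)"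
    have Bb: "B = four_block_mat J U L D"
      by (rule eq_matI) (use B nm in \<open>auto simp: J_def U_def L_def D_def Suc_diff_Suc numeral_2_eq_2\<close>)
    define E where "E = four_block_mat (1\<^sub>m 2) (0\<^sub>m 2 m) K (1\<^sub>m m)"
    have dims: "J \<in> carrier_mat 2 2" "U \<in> carrier_mat 2 m" "L \<in> carrier_mat m 2" "D \<in> carrier_mat m m"
      "K \<in> carrier_mat m 2" "S \<in> carrier_mat m m"
      by (auto simp: J_def U_def L_def D_def K_def S_def)
    have B10: "B $$ (1,0) = - c" using skewB[of 0 1] n2 by (simp add: c_def)
    have B00: "B $$ (0,0) = 0" "B $$ (1,1) = 0" using diagB[of 0] diagB[of 1] n2 by auto
    have two: "{0..<2} = {0,1::nat}" by auto
    have KJ: "K * J + 1\<^sub>m m * L = 0\<^sub>m m 2"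
    proof (rule eq_matI)
      fix i j assume "i < dim_row (0\<^sub>m m 2 :: 'a mat)" "j < dim_col (0\<^sub>m m 2 :: 'a mat)"
      then have ij: "i < m" "j < 2" by auto
      then have "j = 0 \<or> j = 1" by auto
      then show "(K * J + 1\<^sub>m m * L) $$ (i,j) = 0\<^sub>m m 2 $$ (i,j)"
        using ij c dims B10 B00 left_mult_one_mat[OF dims(3)]
        by (auto simp: K_def J_def L_def scalar_prod_def two c_def[unfolded One_nat_def, symmetric] B10[unfolded One_nat_def] B00[unfolded One_nat_def])
    qed (use dims in auto)
    have KU: "K * U + 1\<^sub>m m * D = S"
      by (rule eq_matI) (use dims c left_mult_one_mat[OF dims(4)] in
        \<open>auto simp: K_def U_def D_def S_def scalar_prod_def two divide_simps\<close>)
    have "E * B = four_block_mat J U (0\<^sub>m m 2) S"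
      unfolding E_def Bb using dims KJ KU
      by (subst mult_four_block_mat[of _ 2 2 _ m _ m]) auto
    moreover have "det (E * B) = det E * det B"
      by (rule det_mult[of _ n]) (use B dims nm in \<open>auto simp: E_def\<close>)
    moreover have "det E = 1"
      unfolding E_def using dims by (subst det_four_block_mat_upper_right_zero[of _ 2 _ m]) auto
    moreover have "det (four_block_mat J U (0\<^sub>m m 2) S) = det J * det S"
      by (rule det_four_block_mat_lower_left_zero) (use dims in auto)
    moreover have "det J = c\<^sup>2"
    proof -
      have "det J = (\<Sum>j<2. J $$ (0,j) * cofactor J 0 j)"
        by (rule laplace_expansion_row[OF dims(1)]) simp
      also have "\<dots> = J $$ (0,1) * cofactor J 0 1"
        using B00 by (simp add: J_def numeral_2_eq_2)
      also have "cofactor J 0 1 = - det (mat_delete J 0 1)" by (simp add: cofactor_def)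
      also have "det (mat_delete J 0 1) = J $$ (1,0)"
        using dims(1) by (subst det_single) (auto simp: mat_delete_def)
      finally show ?thesis using B10 by (simp add: J_def c_def power2_eq_square)
    qed
    ultimately have "det A = c\<^sup>2 * det S" using detB by simp
    moreover obtain s where "det S = s\<^sup>2"
    proof -
      have "\<exists>s. det S = s\<^sup>2"
      proof (rule less.IH)
        show "m < n" using nm by simp
        show "S \<in> carrier_mat m m" by (rule dims)
        have S: "S $$ (i,j) = B $$ (i+2,j+2) + (B $$ (1,i+2) * B $$ (0,j+2) - B $$ (0,i+2) * B $$ (1,j+2)) / c"
          if "i < m" "j < m" for i j
          using that skewB[of 1 "i+2"] skewB[of 0 "i+2"] nm by (simp add: S_def)
        show "S $$ (j,i) = - S $$ (i,j)" if ij: "i < m" "j < m" for i j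
          unfolding S[OF ij] S[OF ij(2,1)] using skewB[of "i+2" "j+2"] ij nm
          by (simp add: minus_divide_left mult.commute)
        show "S $$ (i,i) = 0" if i: "i < m" for i
          unfolding S[OF i i] using diagB[of "i+2"] i nm by (simp add: mult.commute)
      qed
      then show ?thesis using that by blast
    qed
    ultimately have "det A = (c * s)\<^sup>2" by (simp add: power_mult_distrib)
    then show ?thesis by blast
  qed
qed

lemma det_cong:
  assumes "A \<in> carrier_mat m m" "B \<in> carrier_mat m m"
    and "\<And>i j. i < m \<Longrightarrow> j < m \<Longrightarrow> [A $$ (i,j) = B $$ (i,j)] (mod q)"
  shows "[det A = det B] (mod (q::int))"
  unfolding det_def'[OF assms(1)] det_def'[OF assms(2)]
  by (intro cong_sum cong_mult cong_prod cong_refl assms(3)) (auto simp: permutes_in_image)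

text \<open>Reduction modulo \<open>p\<close> turns the linear map into an injective self-map of the
  finite box \<open>V\<close>, which is therefore surjective.\<close>

lemma injective_mod_prime_solvable:
  fixes M :: "nat \<Rightarrow> nat \<Rightarrow> int"
  assumes p: "0 < p"
    and inj: "\<And>x. \<exists>i<m. \<not> int p dvd x i \<Longrightarrow> \<exists>j<m. \<not> int p dvd (\<Sum>i<m. x i * M i j)"
  shows "\<exists>x. \<forall>j<m. [(\<Sum>i<m. x i * M i j) = b j] (mod int p)"
proof -
  define V where "V = PiE {..<m} (\<lambda>_::nat. {0..<int p})"
  define \<Phi> where "\<Phi> x = (\<lambda>j\<in>{..<m}. (\<Sum>i<m. x i * M i j) mod int p)" for x
  have fin: "finite V" unfolding V_def by (intro finite_PiE) auto
  have sub: "\<Phi> ` V \<subseteq> V" 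
  proof (rule image_subsetI)
    show "\<Phi> x \<in> V" for x
      unfolding V_def \<Phi>_def using p by (intro restrict_PiE_iff[THEN iffD2] ballI) simp
  qed
  have inj: "inj_on \<Phi> V"
  proof (rule inj_onI, rule ccontr)
    fix x y assume x: "x \<in> V" and y: "y \<in> V" and eq: "\<Phi> x = \<Phi> y" and ne: "x \<noteq> y"
    have "\<exists>i<m. x i \<noteq> y i"
    proof (rule ccontr)
      assume "\<not> ?thesis"
      then have "x = y" by (intro PiE_ext[OF x[unfolded V_def] y[unfolded V_def]]) auto
      then show False using ne by simp
    qed
    then obtain i where i: "i < m" "x i \<noteq> y i" by blast
    have r: "x i \<in> {0..<int p}" "y i \<in> {0..<int p}"
      using PiE_mem[of _ "{..<m}"] x y i(1) unfolding V_def by blast+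
    have "\<not> int p dvd x i - y i"
    proof
      assume "int p dvd x i - y i"
      then have "x i mod int p = y i mod int p" by (simp add: mod_eq_dvd_iff)
      moreover have "x i mod int p = x i" "y i mod int p = y i" using r by (simp_all add: mod_pos_pos_trivial)
      ultimately show False using i by metis
    qed
    then have "\<exists>i<m. \<not> int p dvd x i - y i" using i by blast
    from inj[OF this] obtain j where j: "j < m" "\<not> int p dvd (\<Sum>i<m. (x i - y i) * M i j)" by blast
    have "\<Phi> x j = \<Phi> y j" using eq by simp
    then have "int p dvd (\<Sum>i<m. x i * M i j) - (\<Sum>i<m. y i * M i j)"
      using j by (simp add: \<Phi>_def mod_eq_dvd_iff)
    then show False using j by (simp add: left_diff_distrib sum_subtractf)
  qed
  have "(\<lambda>j\<in>{..<m}. b j mod int p) \<in> V" using p by (auto simp: V_def)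
  then obtain x where x: "\<Phi> x = (\<lambda>j\<in>{..<m}. b j mod int p)"
    using endo_inj_surj[OF fin sub inj] by (metis imageE)
  have "[(\<Sum>i<m. x i * M i j) = b j] (mod int p)" if "j < m" for j
    using fun_cong[OF x, of j] that by (simp add: \<Phi>_def cong_def)
  then show ?thesis by blast
qed

text \<open>Solving for all unit vectors gives a left inverse \<open>N\<close> of the matrix modulo
  \<open>p\<close>, so the product of the two determinants is 1 modulo \<open>p\<close>.\<close>

lemma not_dvd_det:
  fixes M :: "nat \<Rightarrow> nat \<Rightarrow> int"
  assumes p: "1 < p"
    and inj: "\<And>x. \<exists>i<m. \<not> int p dvd x i \<Longrightarrow> \<exists>j<m. \<not> int p dvd (\<Sum>i<m. x i * M i j)"
  shows "\<not> int p dvd det (mat m m (\<lambda>(i,j). M i j))"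
proof
  let ?M = "mat m m (\<lambda>(i,j). M i j)"
  assume d: "int p dvd det ?M"
  have "\<forall>k. \<exists>x. \<forall>j<m. [(\<Sum>i<m. x i * M i j) = (if j = k then 1 else 0)] (mod int p)"
    using injective_mod_prime_solvable[OF _ inj] p by auto
  then obtain y where y: "\<And>k j. j < m \<Longrightarrow> [(\<Sum>i<m. y k i * M i j) = (if j = k then 1 else 0)] (mod int p)"
    by metis
  define N where "N = mat m m (\<lambda>(k,i). y k i)"
  have "[det (N * ?M) = det (1\<^sub>m m)] (mod int p)"
  proof (rule det_cong)
    fix i j assume ij: "i < m" "j < m"
    have "(N * ?M) $$ (i,j) = (\<Sum>k<m. y i k * M k j)"
      using ij by (simp add: N_def scalar_prod_def lessThan_atLeast0)
    then show "[(N * ?M) $$ (i,j) = 1\<^sub>m m $$ (i,j)] (mod int p)"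
      using y[of j i] ij by auto
  qed (auto simp: N_def)
  moreover have "det (N * ?M) = det N * det ?M" by (rule det_mult) (auto simp: N_def)
  ultimately have "[det N * det ?M = 1] (mod int p)" by simp
  then have "int p dvd 1" using d by (metis cong_dvd_iff dvd_mult)
  then show False using p by simp
qed

lemma fermat_int:
  assumes p: "Factorial_Ring.prime (p::nat)" and a: "\<not> int p dvd a"
  shows "[a ^ (p - 1) = 1] (mod int p)"
proof -
  define b where "b = nat (a mod int p)"
  have b: "int b = a mod int p" using p by (simp add: b_def prime_gt_0_nat)
  then have "\<not> p dvd b" using a by (metis dvd_mod_iff dvd_refl int_dvd_int_iff)
  then have "[b ^ (p - 1) = 1] (mod p)" using fermat_theorem p by blast
  then have "[int b ^ (p - 1) = 1] (mod int p)" by (metis cong_int_iff of_nat_1 of_nat_power)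
  moreover have "[int b ^ (p - 1) = a ^ (p - 1)] (mod int p)"
    unfolding b by (intro cong_pow) simp
  ultimately show ?thesis using cong_sym cong_trans by blast
qed

text \<open>The determinant is the square of a rational number, so its Legendre symbol is 1.\<close>

lemma alternating_det_legendre:
  assumes p: "Factorial_Ring.prime (p::nat)" "odd p" and A: "(A :: int mat) \<in> carrier_mat m m"
    and "\<And>i j. i < m \<Longrightarrow> j < m \<Longrightarrow> A $$ (j,i) = - A $$ (i,j)" "\<And>i. i < m \<Longrightarrow> A $$ (i,i) = 0"
    and d: "\<not> int p dvd det A"
  shows "[det A ^ ((p - 1) div 2) = 1] (mod int p)"
proof -
  let ?A = "map_mat (of_int :: int \<Rightarrow> rat) A"
  have "\<exists>s. det ?A = s\<^sup>2"
  proof (rule det_alternating_square[of _ m])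
    show "?A $$ (j,i) = - ?A $$ (i,j)" if "i < m" "j < m" for i j
      using assms(4)[OF that] that A by simp
    show "?A $$ (i,i) = 0" if "i < m" for i using assms(5)[OF that] that A by simp
  qed (use A in auto)
  then obtain s :: rat where s: "of_int (det A) = s\<^sup>2" by (auto simp: of_int_hom.hom_det)
  obtain u v where uv: "s = of_int u / of_int v" "v > 0" "coprime u v"
    by (metis Fract_of_int_quotient Rat_cases)
  have "of_int (det A * v\<^sup>2) = (of_int (u\<^sup>2) :: rat)"
    using s uv by (simp add: field_simps)
  then have eq: "det A * v\<^sup>2 = u\<^sup>2" by linarith
  have pi: "Factorial_Ring.prime (int p)" using p by simp
  \<comment> \<open>The fraction is in lowest terms, so \<open>p\<close> divides neither
    \<open>u\<close> nor \<open>v\<close>. Raising \<open>det A * v^2 = u^2\<close> to the power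
    \<open>(p - 1) / 2\<close> then leaves only Fermat's theorem.\<close>
  have v: "\<not> int p dvd v"
  proof
    assume dv: "int p dvd v"
    then have "int p dvd u\<^sup>2" using eq by (metis dvd_mult dvd_power pos2 dvd_trans)
    then have "int p dvd u" using pi prime_dvd_power by blast
    then have "int p dvd 1" using dv uv(3) by (meson coprime_common_divisor)
    then show False using pi by auto
  qed
  have u: "\<not> int p dvd u"
  proof
    assume "int p dvd u"
    then have "int p dvd det A * v\<^sup>2" using eq by (simp add: power2_eq_square)
    then have "int p dvd v\<^sup>2" using d pi prime_dvd_mult_iff by blast
    then show False using v pi prime_dvd_power by blast
  qed
  define k where "k = (p - 1) div 2"
  have k: "p - 1 = 2 * k" using p(2) by (simp add: k_def)
  have "det A ^ k * v ^ (p - 1) = u ^ (p - 1)"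
    using arg_cong[OF eq, of "\<lambda>z. z ^ k"] unfolding k power_mult by (simp add: power_mult_distrib)
  then have "[det A ^ k * v ^ (p - 1) = 1] (mod int p)" using fermat_int[OF p(1) u] by simp
  moreover have "[det A ^ k * v ^ (p - 1) = det A ^ k * 1] (mod int p)"
    by (intro cong_mult fermat_int[OF p(1) v]) simp
  ultimately show ?thesis unfolding k_def[symmetric] mult_1_right by (meson cong_sym cong_trans)
qed

text \<open>With \<open>k = (p - 1) div 2\<close>, the function \<open>det (M w) ^ k\<close> of
  \<open>w\<close> has degree at most \<open>k * m\<close>. If \<open>m < 2 * n\<close>, this is
  below \<open>n * (p - 1)\<close>, so the sum over all \<open>w\<close> is 0 modulo
  \<open>p\<close>. But each nonzero \<open>w\<close> contributes 1, and \<open>w = 0\<close>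
  contributes 0 because \<open>m > 0\<close>, so the sum is also \<open>p ^ n - 1\<close> modulo
  \<open>p\<close>.\<close>

lemma alternating_forms_bound_odd:
  fixes c :: "nat \<Rightarrow> nat \<Rightarrow> nat \<Rightarrow> int"
  assumes p: "Factorial_Ring.prime (p::nat)" "odd p" and m: "0 < m"
    and alt: "\<And>i l. c i i l = 0" "\<And>i j l. c j i l = - c i j l"
    and nondeg: "\<And>w x. \<exists>l<n. \<not> int p dvd w l \<Longrightarrow> \<exists>i<m. \<not> int p dvd x i \<Longrightarrow>
      \<exists>j<m. \<not> int p dvd (\<Sum>i<m. x i * (\<Sum>l<n. w l * c i j l))"
  shows "2 * n \<le> m"
proof (rule ccontr)
  assume neg: "\<not> ?thesis"
  then have n0: "n > 0" by simp
  define M where "M w = mat m m (\<lambda>(i,j). \<Sum>l<n. w l * c i j l)" for w :: "nat \<Rightarrow> int"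
  define k where "k = (p - 1) div 2"
  have p3: "p \<ge> 3" using p prime_ge_2_nat[of p] by (cases "p = 2") auto
  have k: "p - 1 = 2 * k" "k > 0" using p(2) p3 by (auto simp: k_def)
  \<comment> \<open>In the Leibniz formula each of the \<open>m\<close> entries of a product is
    linear in \<open>w\<close>.\<close>
  have "poly_fun n m (\<lambda>w. det (M w))"
  proof -
    have "poly_fun n (0 + card {0..<m} * 1) (\<lambda>w. signof \<pi> * (\<Prod>i = 0..<m. \<Sum>l<n. w l * c i (\<pi> i) l))" for \<pi>
      by (intro poly_fun_mult poly_fun_const poly_fun_prod poly_fun_linear) auto
    then have "poly_fun n m (\<lambda>w. \<Sum>\<pi> | \<pi> permutes {0..<m}. signof \<pi> * (\<Prod>i = 0..<m. \<Sum>l<n. w l * c i (\<pi> i) l))"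
      by (intro poly_fun_sum) simp
    moreover have "det (M w) = (\<Sum>\<pi> | \<pi> permutes {0..<m}. signof \<pi> * (\<Prod>i = 0..<m. \<Sum>l<n. w l * c i (\<pi> i) l))" for w
    proof -
      have "M w \<in> carrier_mat m m" by (simp add: M_def)
      from det_def'[OF this] show ?thesis
        by (simp add: M_def permutes_in_image cong: prod.cong) (auto intro!: sum.cong prod.cong simp: permutes_in_image)
    qed
    ultimately show ?thesis by simp
  qed
  then have pf: "poly_fun n (k * m) (\<lambda>w. det (M w) ^ k)" by (rule poly_fun_power)
  have "k * m < k * (2 * n)" using neg k by simp
  then have deg: "k * m < n * (p - 1)" unfolding k by (simp add: mult_ac)
  define \<Lambda> where "\<Lambda> = PiE {..<n} (\<lambda>_::nat. int ` {..<p})"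
  define z where "z = (\<lambda>l\<in>{..<n}. 0::int)"
  have z: "z \<in> \<Lambda>" using p3 by (auto simp: z_def \<Lambda>_def image_iff)
  have fin: "finite \<Lambda>" unfolding \<Lambda>_def by (intro finite_PiE) auto
  have card: "card \<Lambda> = p ^ n" unfolding \<Lambda>_def by (simp add: card_PiE card_image)
  have "[det (M w) ^ k = 1] (mod int p)" if w: "w \<in> \<Lambda> - {z}" for w
  proof -
    have "\<exists>l<n. \<not> int p dvd w l"
    proof (rule ccontr)
      assume "\<not> ?thesis"
      then have d: "int p dvd w l" if "l < n" for l using that by blast
      have "w l = 0" if "l < n" for l
      proof -
        have "w l \<in> int ` {..<p}" using w that by (auto simp: \<Lambda>_def)
        then obtain t where t: "w l = int t" "t < p" by auto
        then have "p dvd t" using d[OF that] by simp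
        then have "t = 0" using t(2) nat_dvd_not_less by blast
        then show ?thesis using t by simp
      qed
      then have "w = z" using w PiE_ext[of w "{..<n}" _ z] z unfolding \<Lambda>_def z_def by (metis DiffD1 lessThan_iff restrict_apply)
      then show False using w by simp
    qed
    then have "\<not> int p dvd det (M w)"
      unfolding M_def using nondeg p3 by (intro not_dvd_det) auto
    then have nd: "\<not> int p dvd det (M w)" .
    show ?thesis unfolding k_def
    proof (rule alternating_det_legendre[OF p, of _ m, OF _ _ _ nd])
      have neg: "(\<Sum>l<n. w l * c j i l) = - (\<Sum>l<n. w l * c i j l)" for i j
        unfolding sum_negf[symmetric] by (rule sum.cong) (simp_all add: alt(2)[of i j])
      show "M w $$ (j,i) = - M w $$ (i,j)" if "i < m" "j < m" for i j
        using that neg[where i=i and j=j] by (simp add: M_def)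
    qed (auto simp: M_def alt(1))
  qed
  then have c: "[(\<Sum>w\<in>\<Lambda>-{z}. det (M w) ^ k) = (\<Sum>w\<in>\<Lambda>-{z}. 1)] (mod int p)"
    by (intro cong_sum)
  have s: "(\<Sum>w\<in>\<Lambda>. det (M w) ^ k) = det (M z) ^ k + (\<Sum>w\<in>\<Lambda>-{z}. det (M w) ^ k)"
    using sum.remove[OF fin z] .
  have z0: "det (M z) ^ k = 0"
  proof -
    have "M z = 0\<^sub>m m m" by (rule eq_matI) (auto simp: M_def z_def)
    then have "det (M z) = 0" using m by simp
    then show ?thesis using k by simp
  qed
  have t: "[(\<Sum>w\<in>\<Lambda>. det (M w) ^ k) = 0] (mod int p)"
    unfolding \<Lambda>_def by (rule sum_poly_fun_cong_0[OF p(1) pf deg])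
  have "[(\<Sum>w\<in>\<Lambda>-{z}. det (M w) ^ k) = 0] (mod int p)" using t unfolding s z0 by simp
  then have "[0 = (\<Sum>w\<in>\<Lambda>-{z}. 1)] (mod int p)" using c by (rule cong_trans[OF cong_sym])
  moreover have "(\<Sum>w\<in>\<Lambda>-{z}. (1::int)) = int p ^ n - 1"
    using z fin card p3 by (simp add: card_Diff_singleton of_nat_diff)
  ultimately have "int p dvd int p ^ n - 1" using cong_sym cong_0_iff by metis
  moreover have "int p dvd int p ^ n" using n0 by simp
  ultimately have "int p dvd 1" using dvd_diff_right_iff by (metis dvd_add_right_iff diff_add_cancel)
  then show False using p3 by simp
qed

section \<open>Exponential sums of quadratic forms modulo 2\<close>

text \<open>The nontrivial character of the integers modulo 2. Integer values make it possible to
  speak of divisibility of its sums by powers of 2.\<close>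

definition parity_sign :: "int \<Rightarrow> int" where
  "parity_sign k = (if even k then 1 else -1)"

lemma parity_sign_add: "parity_sign (a + b) = parity_sign a * parity_sign b"
  unfolding parity_sign_def by auto

lemma parity_sign_0 [simp]: "parity_sign 0 = 1"
  unfolding parity_sign_def by simp

lemma parity_sign_sum: "parity_sign (\<Sum>i\<in>I. f i) = (\<Prod>i\<in>I. parity_sign (f i))"
  by (induction I rule: infinite_finite_induct) (auto simp: parity_sign_add)

lemma parity_sign_eqI: "even (a - b) \<Longrightarrow> parity_sign a = parity_sign b"
  unfolding parity_sign_def by auto

text \<open>The sum factors over the coordinates, and an odd coefficient gives the factor
  \<open>1 - 1\<close>.\<close>

lemma sum_parity_sign_linear:
  "(\<Sum>x\<in>PiE {..<n} (\<lambda>_. {0,1}). parity_sign (\<Sum>l<n. x l * b l)) = (if \<forall>l<n. even (b l) then 2 ^ n else 0)"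
proof -
  have "(\<Sum>x\<in>PiE {..<n} (\<lambda>_. {0,1}). parity_sign (\<Sum>l<n. x l * b l)) = (\<Prod>l<n. \<Sum>t\<in>{0,1}. parity_sign (t * b l))"
    unfolding parity_sign_sum by (rule prod_sum_PiE[symmetric]) auto
  also have "\<dots> = (\<Prod>l<n. 1 + parity_sign (b l))" by simp
  also have "\<dots> = (if \<forall>l<n. even (b l) then 2 ^ n else 0)"
  proof (cases "\<forall>l<n. even (b l)")
    case True
    then have "(\<Prod>l<n. 1 + parity_sign (b l)) = (\<Prod>l<n. 2)"
      by (intro prod.cong) (auto simp: parity_sign_def)
    then show ?thesis using True by simp
  next
    case False
    then obtain l where "l < n" "1 + parity_sign (b l) = 0" by (auto simp: parity_sign_def)
    then have "(\<Prod>l<n. 1 + parity_sign (b l)) = 0" by (intro prod_zero) auto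
    then show ?thesis unfolding if_not_P[OF False] .
  qed
  finally show ?thesis .
qed

text \<open>Substituting \<open>y = x + z\<close> in the square of the exponential sum of a quadratic form leaves, for
  each \<open>z\<close>, a linear exponential sum over \<open>x\<close>.\<close>

lemma quadratic_sum_square:
  fixes M :: "nat \<Rightarrow> nat \<Rightarrow> int"
  assumes alt: "\<And>i. M i i = 0" "\<And>i j. M j i = - M i j"
    and nondeg: "\<And>x. \<exists>i<m. odd (x i) \<Longrightarrow> \<exists>j<m. odd (\<Sum>i<m. x i * M i j)"
  shows "(\<Sum>x\<in>PiE {..<m} (\<lambda>_. {0,1}). parity_sign (\<Sum>j<m. \<Sum>i<j. x i * x j * M i j))\<^sup>2 = 2 ^ m"
proof -
  define V where "V = PiE {..<m} (\<lambda>_::nat. {0,1::int})"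
  define q where "q x = (\<Sum>j<m. \<Sum>i<j. x i * x j * M i j)" for x :: "nat \<Rightarrow> int"
  \<comment> \<open>\<open>b\<close> is the polarization of \<open>q\<close> modulo 2, where the
    sign in \<open>M j i = - M i j\<close> disappears.\<close>
  define b where "b x z = (\<Sum>i<m. x i * (\<Sum>j<m. z j * M j i))" for x z :: "nat \<Rightarrow> int"
  define add where "add x z = (\<lambda>i\<in>{..<m}. (x i + z i) mod 2)" for x z :: "nat \<Rightarrow> int"
  have fin: "finite V" unfolding V_def by (intro finite_PiE) auto
  have addV: "add x z \<in> V" for x z
    unfolding V_def add_def by (intro restrict_PiE_iff[THEN iffD2] ballI) auto
  have V01: "x i = 0 \<or> x i = 1" if "x \<in> V" "i < m" for x i
    using PiE_mem[of x "{..<m}" _ i] that unfolding V_def by auto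
  have add_add: "add x (add x z) = z" if "x \<in> V" "z \<in> V" for x z
  proof
    fix i
    show "add x (add x z) i = z i"
    proof (cases "i < m")
      case True
      then show ?thesis using V01[OF that(1) True] V01[OF that(2) True] by (auto simp: add_def)
    next
      case False
      then show ?thesis using PiE_arb[OF that(2)[unfolded V_def], of i] by (simp add: add_def)
    qed
  qed
  have q_add: "even (q (add x z) - (q x + q z + b x z))" for x z
  proof -
    have "even (add x z i - (x i + z i))" if "i < m" for i
      using that by (simp add: add_def mod_2_eq_odd)
    then have e: "[add x z i = x i + z i] (mod 2)" if "i < m" for i
      using that by (simp add: cong_iff_dvd_diff)
    have "[q (add x z) = (\<Sum>j<m. \<Sum>i<j. (x i + z i) * (x j + z j) * M i j)] (mod 2)"
      unfolding q_def by (intro cong_sum cong_mult cong_refl e) auto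
    also have "(\<Sum>j<m. \<Sum>i<j. (x i + z i) * (x j + z j) * M i j) =
        q x + q z + (\<Sum>j<m. \<Sum>i<j. (x i * z j + z i * x j) * M i j)"
      unfolding q_def sum.distrib[symmetric] by (intro sum.cong refl) (simp add: algebra_simps)
    also have "[\<dots> = q x + q z + b x z] (mod 2)"
    proof (intro cong_add cong_refl)
      have tri: "(\<Sum>i<k. \<Sum>j<k. f i j) = (\<Sum>j<k. \<Sum>i<j. f i j) + (\<Sum>j<k. \<Sum>i<j. f j i) + (\<Sum>i<k. f i i)"
        for f :: "nat \<Rightarrow> nat \<Rightarrow> int" and k
        by (induction k) (simp_all add: sum.distrib)
      have "b x z = (\<Sum>i<m. \<Sum>j<m. x i * z j * M j i)"
        unfolding b_def by (simp add: sum_distrib_left mult.assoc)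
      also have "\<dots> = (\<Sum>j<m. \<Sum>i<j. x i * z j * M j i) + (\<Sum>j<m. \<Sum>i<j. x j * z i * M i j)"
        by (subst tri) (simp add: alt(1))
      also have "\<dots> = (\<Sum>j<m. \<Sum>i<j. (x i * z j + z i * x j) * M i j) + 2 * (\<Sum>j<m. \<Sum>i<j. x i * z j * M j i)"
        unfolding sum_distrib_left sum.distrib[symmetric]
      proof (intro sum.cong refl)
        fix j i
        show "x i * z j * M j i + x j * z i * M i j = (x i * z j + z i * x j) * M i j + 2 * (x i * z j * M j i)"
          using alt(2)[of i j] by (simp add: algebra_simps)
      qed
      finally show "[(\<Sum>j<m. \<Sum>i<j. (x i * z j + z i * x j) * M i j) = b x z] (mod 2)"
        by (simp add: cong_iff_dvd_diff)
    qed
    finally show ?thesis by (simp add: cong_iff_dvd_diff)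
  qed
  have "(\<Sum>x\<in>V. parity_sign (q x))\<^sup>2 = (\<Sum>x\<in>V. \<Sum>y\<in>V. parity_sign (q x) * parity_sign (q y))"
    by (simp add: power2_eq_square sum_product)
  also have "\<dots> = (\<Sum>x\<in>V. \<Sum>z\<in>V. parity_sign (q x) * parity_sign (q (add x z)))"
  proof (rule sum.cong[OF refl])
    fix x assume x: "x \<in> V"
    have "bij_betw (add x) V V"
      by (rule bij_betw_byWitness[where f'="add x"]) (use add_add[OF x] addV in auto)
    from sum.reindex_bij_betw[OF this]
    show "(\<Sum>y\<in>V. parity_sign (q x) * parity_sign (q y)) = (\<Sum>z\<in>V. parity_sign (q x) * parity_sign (q (add x z)))"
      by (rule sym)
  qed
  \<comment> \<open>The sign of \<open>q x\<close> occurs twice and cancels; for fixed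
    \<open>z\<close> only a linear character of \<open>x\<close> remains.\<close>
  also have "\<dots> = (\<Sum>z\<in>V. \<Sum>x\<in>V. parity_sign (q z) * parity_sign (b x z))"
  proof (subst sum.swap, intro sum.cong refl)
    fix x z
    have "parity_sign (q (add x z)) = parity_sign (q x) * parity_sign (q z) * parity_sign (b x z)"
      using parity_sign_eqI[OF q_add] by (simp add: parity_sign_add)
    moreover have "parity_sign (q x) * parity_sign (q x) = 1" by (simp add: parity_sign_def)
    ultimately show "parity_sign (q x) * parity_sign (q (add x z)) = parity_sign (q z) * parity_sign (b x z)"
      by (metis mult.assoc mult_1)
  qed
  also have "\<dots> = (\<Sum>z\<in>V. parity_sign (q z) * (if \<forall>i<m. even (\<Sum>j<m. z j * M j i) then 2 ^ m else 0))"
    unfolding b_def V_def by (intro sum.cong refl) (simp only: sum_distrib_left[symmetric] sum_parity_sign_linear)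
  \<comment> \<open>By nondegeneracy the linear sum over \<open>x\<close> vanishes unless
    \<open>z\<close> is zero.\<close>
  also have "\<dots> = (\<Sum>z\<in>V. if z = (\<lambda>i\<in>{..<m}. 0) then 2 ^ m else 0)"
  proof (intro sum.cong refl)
    fix z assume z: "z \<in> V"
    show "parity_sign (q z) * (if \<forall>i<m. even (\<Sum>j<m. z j * M j i) then 2 ^ m else 0) =
        (if z = (\<lambda>i\<in>{..<m}. 0) then 2 ^ m else 0)"
    proof (cases "z = (\<lambda>i\<in>{..<m}. 0)")
      case True
      then show ?thesis by (simp add: q_def)
    next
      case False
      have "\<exists>i<m. z i \<noteq> 0"
      proof (rule ccontr)
        assume n: "\<not> ?thesis"
        have "z = (\<lambda>i\<in>{..<m}. 0)"
        proof
          show "z i = (\<lambda>i\<in>{..<m}. 0) i" for i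
            using n PiE_arb[OF z[unfolded V_def], of i] by (cases "i < m") simp_all
        qed
        then show False using False by simp
      qed
      then have "\<exists>i<m. odd (z i)" using V01[OF z] by force
      then show ?thesis using nondeg[of z] False by auto
    qed
  qed
  also have "\<dots> = 2 ^ m" using fin by (simp add: V_def)
  finally show ?thesis unfolding V_def q_def .
qed

text \<open>The exponential sum \<open>S w\<close> is \<open>2 ^ m\<close> for \<open>w = 0\<close>
  and has square \<open>2 ^ m\<close> otherwise, so \<open>m = 2 * a\<close> and \<open>S w\<close>
  is plus or minus \<open>2 ^ a\<close>. For fixed \<open>x\<close> the exponent is linear in
  \<open>w\<close>, so the total over all \<open>w\<close> is divisible by \<open>2 ^ n\<close>. If
  \<open>n > a\<close>, comparison modulo \<open>2 ^ (a + 1)\<close> would make the odd number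
  \<open>2 ^ n - 1\<close> even.\<close>

lemma alternating_forms_bound_even:
  fixes c :: "nat \<Rightarrow> nat \<Rightarrow> nat \<Rightarrow> int"
  assumes m: "0 < m" and alt: "\<And>i l. c i i l = 0" "\<And>i j l. c j i l = - c i j l"
    and nondeg: "\<And>w x. \<exists>l<n. odd (w l) \<Longrightarrow> \<exists>i<m. odd (x i) \<Longrightarrow>
      \<exists>j<m. odd (\<Sum>i<m. x i * (\<Sum>l<n. w l * c i j l))"
  shows "2 * n \<le> m"
proof (cases "n = 0")
  case False
  define V where "V k = PiE {..<k} (\<lambda>_::nat. {0,1::int})" for k
  define S where "S w = (\<Sum>x\<in>V m. parity_sign (\<Sum>j<m. \<Sum>i<j. x i * x j * (\<Sum>l<n. w l * c i j l)))" for w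
  define z where "z = (\<lambda>i\<in>{..<n}. 0::int)"
  have z: "z \<in> V n" by (auto simp: V_def z_def)
  have fin: "finite (V k)" and card: "card (V k) = 2 ^ k" for k
    unfolding V_def by (auto simp: card_PiE numeral_2_eq_2 intro!: finite_PiE)
  have sq: "(S w)\<^sup>2 = 2 ^ m" if w: "w \<in> V n" "w \<noteq> z" for w
  proof -
    have "\<exists>l<n. odd (w l)"
    proof (rule ccontr)
      assume n: "\<not> ?thesis"
      have "w = z"
      proof
        show "w l = z l" for l
        proof (cases "l < n")
          case True
          then have "w l \<in> {0,1}" using PiE_mem[of w "{..<n}" _ l] w unfolding V_def by auto
          then show ?thesis using n True by (auto simp: z_def)
        next
          case False
          then show ?thesis using PiE_arb[OF w(1)[unfolded V_def], of l] by (simp add: z_def)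
        qed
      qed
      then show False using w by simp
    qed
    note ex = this
    show ?thesis unfolding S_def V_def
    proof (rule quadratic_sum_square)
      show "(\<Sum>l<n. w l * c j i l) = - (\<Sum>l<n. w l * c i j l)" for i j
        unfolding sum_negf[symmetric] by (rule sum.cong) (simp_all add: alt(2)[of i j])
      show "\<exists>j<m. odd (\<Sum>i<m. x i * (\<Sum>l<n. w l * c i j l))" if "\<exists>i<m. odd (x i)" for x
        using nondeg[OF ex that] .
    qed (simp add: alt(1))
  qed
  have Sz: "S z = 2 ^ m"
  proof -
    have "S z = (\<Sum>x\<in>V m. 1)"
      unfolding S_def by (intro sum.cong refl) (simp add: z_def)
    then show ?thesis using card by simp
  qed
  have tot: "2 ^ n dvd (\<Sum>w\<in>V n. S w)"
  proof -
    have "(\<Sum>w\<in>V n. S w) = (\<Sum>x\<in>V m. \<Sum>w\<in>V n. parity_sign (\<Sum>l<n. w l * (\<Sum>j<m. \<Sum>i<j. x i * x j * c i j l)))"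
    proof -
      have "(\<Sum>j<m. \<Sum>i<j. x i * x j * (\<Sum>l<n. w l * c i j l)) = (\<Sum>l<n. w l * (\<Sum>j<m. \<Sum>i<j. x i * x j * c i j l))"
        for x w :: "nat \<Rightarrow> int"
      proof -
        have "(\<Sum>j<m. \<Sum>i<j. x i * x j * (\<Sum>l<n. w l * c i j l)) = (\<Sum>j<m. \<Sum>i<j. \<Sum>l<n. w l * (x i * x j * c i j l))"
          by (simp add: sum_distrib_left mult_ac)
        also have "\<dots> = (\<Sum>j<m. \<Sum>l<n. \<Sum>i<j. w l * (x i * x j * c i j l))"
          by (rule sum.cong[OF refl]) (rule sum.swap)
        also have "\<dots> = (\<Sum>l<n. \<Sum>j<m. \<Sum>i<j. w l * (x i * x j * c i j l))" by (rule sum.swap)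
        finally show ?thesis by (simp add: sum_distrib_left)
      qed
      then show ?thesis unfolding S_def by (subst sum.swap) simp
    qed
    moreover have "2 ^ n dvd (\<Sum>x\<in>V m. \<Sum>w\<in>V n. parity_sign (\<Sum>l<n. w l * (\<Sum>j<m. \<Sum>i<j. x i * x j * c i j l)))"
      unfolding V_def by (rule dvd_sum) (simp only: sum_parity_sign_linear, simp)
    ultimately show ?thesis by simp
  qed
  have "card (V n - {z}) = 2 ^ n - 1" using z fin card by (simp add: card_Diff_singleton)
  moreover have "(2::nat) ^ n > 1" using False by (simp add: one_less_power del: One_nat_def)
  ultimately have "V n - {z} \<noteq> {}" by force
  then obtain w0 where w0: "w0 \<in> V n" "w0 \<noteq> z" by blast
  \<comment> \<open>A divisor of a power of 2 is itself a power of 2 up to sign, which shows that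
    \<open>m\<close> is even.\<close>
  have "S w0 dvd 2 ^ m" using sq[OF w0] by (metis dvd_triv_left power2_eq_square)
  then obtain a where a: "\<bar>S w0\<bar> = 2 ^ a"
    using divides_primepow[of "2::int" "S w0" m] by (auto simp: abs_if split: if_splits)
  have "(2::int) ^ m = 2 ^ (2 * a)" using sq[OF w0] a by (metis power2_abs power_even_eq power_mult)
  then have ma: "m = 2 * a" by simp
  have a0: "a > 0" using m ma by simp
  \<comment> \<open>The unknown sign of \<open>S w\<close> disappears here, since
    \<open>2 ^ a\<close> and \<open>- (2 ^ a)\<close> agree modulo
    \<open>2 ^ (a + 1)\<close>.\<close>
  have S: "2 ^ (a + 1) dvd S w - 2 ^ a" if "w \<in> V n" "w \<noteq> z" for w
  proof -
    have "(S w)\<^sup>2 = (2 ^ a)\<^sup>2" using sq[OF that] ma by (simp add: power_mult power2_eq_square flip: power_add mult_2)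
    then have "S w = 2 ^ a \<or> S w = - (2 ^ a)" by (simp add: power2_eq_iff)
    then show ?thesis by auto
  qed
  have "n \<le> a"
  proof (rule ccontr)
    assume "\<not> n \<le> a"
    then have an: "a + 1 \<le> n" by simp
    have "2 ^ (a + 1) dvd (\<Sum>w\<in>V n. S w)" using tot an le_imp_power_dvd dvd_trans by blast
    moreover have "(\<Sum>w\<in>V n. S w) = 2 ^ m + (\<Sum>w\<in>V n - {z}. S w)"
      using sum.remove[OF fin z] Sz by metis
    moreover have "(2::int) ^ (a + 1) dvd 2 ^ m" by (rule le_imp_power_dvd) (use ma a0 in simp)
    ultimately have d1: "2 ^ (a + 1) dvd (\<Sum>w\<in>V n - {z}. S w)" by (simp add: dvd_add_right_iff)
    have "2 ^ (a + 1) dvd (\<Sum>w\<in>V n - {z}. S w - 2 ^ a)" by (rule dvd_sum) (use S in auto)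
    then have "2 ^ (a + 1) dvd (\<Sum>w\<in>V n - {z}. S w) - (2 ^ n - 1) * 2 ^ a"
      using z fin card by (simp add: sum_subtractf card_Diff_singleton of_nat_diff)
    then have "2 ^ (a + 1) dvd ((2::int) ^ n - 1) * 2 ^ a" using d1 by (metis dvd_diff_right_iff)
    then have "2 dvd (2::int) ^ n - 1" by simp
    then show False using False by simp
  qed
  then show ?thesis using ma by simp
qed simp

text \<open>The numbers \<open>c i j l\<close> are coordinates of an alternating map with values in
  an \<open>n\<close>-dimensional space over the field with \<open>p\<close> elements, and
  \<open>w\<close> runs over its functionals. Skew symmetry holds over the integers and not just
  modulo \<open>p\<close>, so that the determinants are squares of rational numbers.\<close>

lemma alternating_forms_bound:
  fixes c :: "nat \<Rightarrow> nat \<Rightarrow> nat \<Rightarrow> int"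
  assumes p: "Factorial_Ring.prime (p::nat)" and m: "0 < m"
    and alt: "\<And>i l. c i i l = 0" "\<And>i j l. c j i l = - c i j l"
    and nondeg: "\<And>w x. \<exists>l<n. \<not> int p dvd w l \<Longrightarrow> \<exists>i<m. \<not> int p dvd x i \<Longrightarrow>
      \<exists>j<m. \<not> int p dvd (\<Sum>i<m. x i * (\<Sum>l<n. w l * c i j l))"
  shows "2 * n \<le> m"
proof (cases "odd p")
  case True
  then show ?thesis using alternating_forms_bound_odd[where c=c, OF p _ m alt nondeg] by blast
next
  case False
  then have "p = 2" using p primes_dvd_imp_eq two_is_prime_nat by blast
  then show ?thesis using alternating_forms_bound_even[where c=c, OF m alt] nondeg by simp
qed

section \<open>Alternating pairings of finite abelian groups\<close>

text \<open>The element with coordinate vector \<open>c\<close> relative to \<open>e\<close>.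
  Integer exponents allow coordinates, which matter only modulo \<open>p\<close>, to be added and
  negated without reduction.\<close>

definition pow_prod :: "('a, 'b) monoid_scheme \<Rightarrow> (nat \<Rightarrow> 'a) \<Rightarrow> nat \<Rightarrow> (nat \<Rightarrow> int) \<Rightarrow> 'a" where
  "pow_prod G e n c = finprod G (\<lambda>i. e i [^]\<^bsub>G\<^esub> c i) {..<n}"

context comm_group
begin

lemma pow_prod_closed [simp]: "e \<in> {..<n} \<rightarrow> carrier G \<Longrightarrow> pow_prod G e n c \<in> carrier G"
  unfolding pow_prod_def by (rule finprod_closed) auto

lemma pow_prod_0 [simp]: "pow_prod G e 0 c = \<one>"
  unfolding pow_prod_def by simp

lemma pow_prod_Suc:
  "e \<in> {..<Suc n} \<rightarrow> carrier G \<Longrightarrow> pow_prod G e (Suc n) c = pow_prod G e n c \<otimes> e n [^] c n"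
  unfolding pow_prod_def lessThan_Suc
  by (subst finprod_insert) (auto simp: m_comm Pi_iff finprod_closed)

lemma pow_prod_add:
  assumes "e \<in> {..<n} \<rightarrow> carrier G"
  shows "pow_prod G e n (\<lambda>i. c i + d i) = pow_prod G e n c \<otimes> pow_prod G e n d"
  using assms
proof (induction n)
  case (Suc n)
  then have e: "e \<in> {..<n} \<rightarrow> carrier G" "e n \<in> carrier G" by auto
  show ?case
    unfolding pow_prod_Suc[OF Suc.prems] Suc.IH[OF e(1)] int_pow_mult[OF e(2)]
    using e by (simp add: m_ac)
qed simp

lemma pow_prod_zero: "e \<in> {..<n} \<rightarrow> carrier G \<Longrightarrow> pow_prod G e n (\<lambda>i. 0) = \<one>"
  unfolding pow_prod_def by simp

lemma pow_prod_scale: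
  assumes "e \<in> {..<n} \<rightarrow> carrier G"
  shows "pow_prod G e n (\<lambda>i. k * c i) = pow_prod G e n c [^] (k::int)"
  using assms
proof (induction n)
  case (Suc n)
  then have e: "e \<in> {..<n} \<rightarrow> carrier G" "e n \<in> carrier G" by auto
  have "e n [^] (k * c n) = (e n [^] c n) [^] k"
    using int_pow_pow[OF e(2), of "c n" k] by (simp add: mult.commute)
  then show ?case
    unfolding pow_prod_Suc[OF Suc.prems] Suc.IH[OF e(1)]
    using e by (simp add: int_pow_distrib)
qed simp

lemma finprod_pow_prod:
  fixes f :: "nat \<Rightarrow> nat \<Rightarrow> int"
  assumes e: "e \<in> {..<n} \<rightarrow> carrier G"
  shows "finprod G (\<lambda>j. pow_prod G e n (f j)) {..<(k::nat)} = pow_prod G e n (\<lambda>l. \<Sum>j<k. f j l)"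
proof (induction k)
  case 0
  then show ?case by (simp add: pow_prod_zero[OF e])
next
  case (Suc k)
  have "finprod G (\<lambda>j. pow_prod G e n (f j)) {..<Suc k} =
      pow_prod G e n (f k) \<otimes> finprod G (\<lambda>j. pow_prod G e n (f j)) {..<k}"
    unfolding lessThan_Suc by (subst finprod_insert) (auto simp: e)
  then show ?case using Suc e by (simp add: pow_prod_add m_comm)
qed

lemma hom_pow_prod:
  assumes H: "comm_group H" and h: "h \<in> hom G H" and e: "e \<in> {..<n} \<rightarrow> carrier G"
  shows "h (pow_prod G e n c) = finprod H (\<lambda>i. h (e i) [^]\<^bsub>H\<^esub> c i) {..<n}"
  using e
proof (induction n)
  interpret H: comm_group H by fact
  interpret h: group_hom G H h
    using h by (simp add: group_hom_def group_hom_axioms_def is_group H.is_group)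
  case 0
  then show ?case by simp
next
  interpret H: comm_group H by fact
  interpret h: group_hom G H h
    using h by (simp add: group_hom_def group_hom_axioms_def is_group H.is_group)
  case (Suc n)
  then have e: "e \<in> {..<n} \<rightarrow> carrier G" "e n \<in> carrier G" by auto
  have "finprod H (\<lambda>i. h (e i) [^]\<^bsub>H\<^esub> c i) {..<Suc n} =
      h (e n) [^]\<^bsub>H\<^esub> c n \<otimes>\<^bsub>H\<^esub> finprod H (\<lambda>i. h (e i) [^]\<^bsub>H\<^esub> c i) {..<n}"
    unfolding lessThan_Suc using e by (subst H.finprod_insert) (auto simp: Pi_iff)
  also have "\<dots> = finprod H (\<lambda>i. h (e i) [^]\<^bsub>H\<^esub> c i) {..<n} \<otimes>\<^bsub>H\<^esub> h (e n) [^]\<^bsub>H\<^esub> c n"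
    using e by (intro H.m_comm H.finprod_closed) (auto simp: Pi_iff)
  finally show ?case
    using e Suc.IH[OF e(1)] by (simp add: pow_prod_Suc[OF Suc.prems] h.hom_mult hom_int_pow[OF h _ is_group H.is_group])
qed

text \<open>An independent family of length \<open>n\<close> yields \<open>p ^ n\<close> distinct
  elements, so lengths are bounded and a longest family exists. It spans: adjoining \<open>x\<close>
  creates a relation in which the exponent of \<open>x\<close> is prime to \<open>p\<close>, and
  this relation can be solved for \<open>x\<close>.\<close>

lemma elementary_abelian_basis:
  assumes fin: "finite (carrier G)" and p: "Factorial_Ring.prime p"
    and exp: "\<And>x. x \<in> carrier G \<Longrightarrow> x [^] (p::nat) = \<one>"
  shows "\<exists>n e. e \<in> {..<n} \<rightarrow> carrier G \<and> (\<forall>x\<in>carrier G. \<exists>c. x = pow_prod G e n c) \<and>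
    (\<forall>c. pow_prod G e n c = \<one> \<longrightarrow> (\<forall>i<n. int p dvd c i)) \<and> card (carrier G) = p ^ n"
proof -
  have p0: "p > 1" using p prime_gt_1_nat by blast
  have expd: "x [^] k = \<one>" if x: "x \<in> carrier G" and k: "int p dvd k" for x k
  proof -
    obtain t where "k = int p * t" using k by auto
    then have "x [^] k = (x [^] int p) [^] t" using x by (simp add: int_pow_pow)
    also have "x [^] int p = \<one>" using exp[OF x] by (simp add: int_pow_int)
    finally show ?thesis by simp
  qed
  have expc: "x [^] k = x [^] l" if x: "x \<in> carrier G" and k: "int p dvd k - l" for x k l
  proof -
    have "x [^] k = x [^] (l + (k - l))" by simp
    also have "\<dots> = x [^] l \<otimes> x [^] (k - l)" by (rule int_pow_mult[OF x])
    finally show ?thesis using expd[OF x k] x by simp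
  qed
  define ind where "ind n e \<longleftrightarrow> e \<in> {..<n} \<rightarrow> carrier G \<and> (\<forall>c. pow_prod G e n c = \<one> \<longrightarrow> (\<forall>i<n. int p dvd c i))" for n e
  define V where "V n = PiE {..<n} (\<lambda>_::nat. {0..<int p})" for n
  have finV: "finite (V n)" and cardV: "card (V n) = p ^ n" for n
    unfolding V_def by (auto intro!: finite_PiE simp: card_PiE)
  have inj: "inj_on (pow_prod G e n) (V n)" if "ind n e" for n e
  proof (rule inj_onI)
    fix c d assume c: "c \<in> V n" and d: "d \<in> V n" and eq: "pow_prod G e n c = pow_prod G e n d"
    have e: "e \<in> {..<n} \<rightarrow> carrier G" using that by (simp add: ind_def)
    have "pow_prod G e n c = pow_prod G e n (\<lambda>i. (c i - d i) + d i)" by simp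
    also have "\<dots> = pow_prod G e n (\<lambda>i. c i - d i) \<otimes> pow_prod G e n d" by (rule pow_prod_add[OF e])
    finally have "pow_prod G e n (\<lambda>i. c i - d i) = \<one>" using eq e by (metis pow_prod_closed r_cancel_one')
    then have dv: "int p dvd c i - d i" if "i < n" for i
      using \<open>ind n e\<close> that unfolding ind_def by blast
    show "c = d"
    proof (rule PiE_ext[OF c[unfolded V_def] d[unfolded V_def]])
      fix i assume i: "i \<in> {..<n}"
      have "c i \<in> {0..<int p}" "d i \<in> {0..<int p}"
        using PiE_mem[OF c[unfolded V_def] i] PiE_mem[OF d[unfolded V_def] i] by auto
      moreover have "c i mod int p = d i mod int p" using dv i by (simp add: mod_eq_dvd_iff)
      ultimately show "c i = d i" by simp
    qed
  qed
  have le: "p ^ n \<le> card (carrier G)" if "ind n e" for n e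
  proof -
    have "pow_prod G e n ` V n \<subseteq> carrier G" using that by (auto simp: ind_def)
    then have "card (V n) \<le> card (carrier G)" by (rule card_inj_on_le[OF inj[OF that] _ fin])
    then show ?thesis using cardV by simp
  qed
  define Pr where "Pr n \<longleftrightarrow> (\<exists>e. ind n e)" for n
  have "Pr 0" unfolding Pr_def ind_def by auto
  moreover have "\<And>n. Pr n \<Longrightarrow> n \<le> card (carrier G)"
    unfolding Pr_def using le power_gt_expt[OF p0[unfolded One_nat_def]] by (meson le_trans less_imp_le)
  ultimately have ex: "Pr (Greatest Pr)" and gr: "\<And>n. Pr n \<Longrightarrow> n \<le> Greatest Pr"
    by (metis GreatestI_nat, metis Greatest_le_nat)
  obtain n e where n: "n = Greatest Pr" and ind: "ind n e" using ex unfolding Pr_def by blast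
  have e: "e \<in> {..<n} \<rightarrow> carrier G" using ind by (simp add: ind_def)
  have span: "\<exists>c. x = pow_prod G e n c" if x: "x \<in> carrier G" for x
  proof -
    define e' where "e' = e(n := x)"
    have e': "e' \<in> {..<Suc n} \<rightarrow> carrier G" using e x by (auto simp: e'_def Pi_iff)
    have "\<not> ind (Suc n) e'" using gr[of "Suc n"] n unfolding Pr_def by auto
    then obtain c i where c: "pow_prod G e' (Suc n) c = \<one>" and i: "i < Suc n" "\<not> int p dvd c i"
      using e' unfolding ind_def by blast
    have "pow_prod G e' n c = pow_prod G e n c"
      unfolding pow_prod_def using e by (intro finprod_cong') (auto simp: e'_def Pi_iff)
    then have c1: "pow_prod G e n c \<otimes> x [^] c n = \<one>"
      using c unfolding pow_prod_Suc[OF e'] by (simp add: e'_def)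
    have "\<not> int p dvd c n"
    proof
      assume d: "int p dvd c n"
      then have "pow_prod G e n c = \<one>" using c1 expd[OF x d] e by simp
      then show False using ind i d unfolding ind_def by (metis less_antisym)
    qed
    then have "coprime (c n) (int p)" using p by (metis coprime_commute prime_imp_coprime prime_nat_int_transfer)
    then obtain t where t: "[c n * t = 1] (mod int p)" using cong_solve_coprime_int by blast
    have "x [^] (c n) = pow_prod G e n (\<lambda>i. - 1 * c i)"
    proof -
      have "x [^] (c n) = inv (pow_prod G e n c)"
        using c1 e x by (metis int_pow_closed inv_char m_comm pow_prod_closed inv_inv)
      then show ?thesis unfolding pow_prod_scale[OF e] using e by (simp add: int_pow_neg)
    qed
    then have "(x [^] c n) [^] t = pow_prod G e n (\<lambda>i. t * (- 1 * c i))"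
      by (simp only: pow_prod_scale[OF e, of t])
    moreover have "(x [^] c n) [^] t = x [^] (1::int)"
      unfolding int_pow_pow[OF x] by (rule expc[OF x]) (use t in \<open>simp add: cong_iff_dvd_diff\<close>)
    ultimately show ?thesis using x by auto
  qed
  have "carrier G \<subseteq> pow_prod G e n ` V n"
  proof
    fix x assume "x \<in> carrier G"
    then obtain c where c: "x = pow_prod G e n c" using span by blast
    define d where "d = (\<lambda>i\<in>{..<n}. c i mod int p)"
    have "pow_prod G e n c = pow_prod G e n d"
      unfolding pow_prod_def
    proof (rule finprod_cong')
      fix i assume i: "i \<in> {..<n}"
      then have "int p dvd c i - d i" by (simp add: d_def minus_mod_eq_mult_div)
      then show "e i [^] c i = e i [^] d i" using expc e i by auto
    qed (use e in auto)
    moreover have "d \<in> V n"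
      unfolding V_def d_def using p0 by (intro restrict_PiE_iff[THEN iffD2] ballI) simp
    ultimately show "x \<in> pow_prod G e n ` V n" using c by blast
  qed
  then have "card (carrier G) \<le> p ^ n" using surj_card_le[OF finV] cardV by metis
  then have "card (carrier G) = p ^ n" using le[OF ind] by simp
  then show ?thesis using ind span unfolding ind_def by (intro exI[of _ n] exI[of _ e]) blast
qed

end

text \<open>Surjectivity forces all elements of both groups to satisfy \<open>x^p = 1\<close> for
  one prime \<open>p\<close>, so both are vector spaces over a prime field. It also makes the form
  of each nonzero functional on \<open>B\<close> nondegenerate, as
  \<open>alternating_forms_bound\<close> requires. For trivial \<open>A\<close> surjectivity would
  say nothing, hence \<open>nontriv\<close>.\<close>

lemma alternating_pairing_card:
  assumes A: "comm_group A" "finite (carrier A)" and B: "comm_group B" "finite (carrier B)"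
    and cl: "\<And>x y. x \<in> carrier A \<Longrightarrow> y \<in> carrier A \<Longrightarrow> \<beta> x y \<in> carrier B"
    and mult1: "\<And>x x' y. x \<in> carrier A \<Longrightarrow> x' \<in> carrier A \<Longrightarrow> y \<in> carrier A \<Longrightarrow>
      \<beta> (x \<otimes>\<^bsub>A\<^esub> x') y = \<beta> x y \<otimes>\<^bsub>B\<^esub> \<beta> x' y"
    and mult2: "\<And>x y y'. x \<in> carrier A \<Longrightarrow> y \<in> carrier A \<Longrightarrow> y' \<in> carrier A \<Longrightarrow>
      \<beta> x (y \<otimes>\<^bsub>A\<^esub> y') = \<beta> x y \<otimes>\<^bsub>B\<^esub> \<beta> x y'"
    and alt: "\<And>x. x \<in> carrier A \<Longrightarrow> \<beta> x x = \<one>\<^bsub>B\<^esub>"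
    and surj: "\<And>x b. x \<in> carrier A \<Longrightarrow> x \<noteq> \<one>\<^bsub>A\<^esub> \<Longrightarrow> b \<in> carrier B \<Longrightarrow> \<exists>y\<in>carrier A. \<beta> x y = b"
    and nontriv: "carrier A \<noteq> {\<one>\<^bsub>A\<^esub>}"
  shows "(card (carrier B))\<^sup>2 \<le> card (carrier A)"
proof (cases "carrier B = {\<one>\<^bsub>B\<^esub>}")
  case True
  interpret A: comm_group A by fact
  have "card (carrier A) \<noteq> 0" using A by auto
  then show ?thesis using True by simp
next
  case False
  interpret A: comm_group A by fact
  interpret B: comm_group B by fact
  have h1: "(\<lambda>x. \<beta> x y) \<in> hom A B" and h2: "\<beta> y \<in> hom A B" if "y \<in> carrier A" for y
    using that cl mult1 mult2 by (auto simp: hom_def)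
  note gh = A.is_group B.is_group
  have pow1: "\<beta> (x [^]\<^bsub>A\<^esub> k) y = \<beta> x y [^]\<^bsub>B\<^esub> (k::nat)" if "x \<in> carrier A" "y \<in> carrier A" for x y k
    using group_hom.hom_nat_pow[of A B "\<lambda>x. \<beta> x y"] h1[OF that(2)] gh that(1)
    by (simp add: group_hom_def group_hom_axioms_def)
  have one1: "\<beta> \<one>\<^bsub>A\<^esub> y = \<one>\<^bsub>B\<^esub>" if "y \<in> carrier A" for y
    using hom_one[OF h1[OF that] gh] .
  obtain a0 where a0: "a0 \<in> carrier A" "a0 \<noteq> \<one>\<^bsub>A\<^esub>" using nontriv by auto
  have ord: "A.ord a0 \<noteq> 0" "A.ord a0 \<noteq> 1"
    using A.ord_ge_1[OF A(2) a0(1)] A.ord_eq_1[OF a0(1)] a0(2) by auto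
  obtain p where p: "Factorial_Ring.prime p" "p dvd A.ord a0"
    using ord prime_factor_nat by blast
  obtain k where k: "A.ord a0 = p * k" using p by auto
  define a where "a = a0 [^]\<^bsub>A\<^esub> k"
  have a: "a \<in> carrier A" using a0 by (simp add: a_def)
  have ap: "a [^]\<^bsub>A\<^esub> p = \<one>\<^bsub>A\<^esub>"
  proof -
    have "a0 [^]\<^bsub>A\<^esub> (k * p) = \<one>\<^bsub>A\<^esub>"
      using A.pow_ord_eq_1[OF a0(1)] unfolding k by (simp only: mult.commute)
    then show ?thesis using a0 by (simp add: a_def A.nat_pow_pow)
  qed
  have a1: "a \<noteq> \<one>\<^bsub>A\<^esub>"
  proof
    assume "a = \<one>\<^bsub>A\<^esub>"
    then have "p * k dvd k" using A.pow_eq_id[OF a0(1)] k by (simp add: a_def)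
    moreover have "k > 0" using ord k by (cases k) auto
    moreover have "p > 1" using p prime_gt_1_nat by blast
    ultimately show False using dvd_imp_le by fastforce
  qed
  \<comment> \<open>Each element of \<open>B\<close> is a value \<open>\<beta> a y\<close>, and
    \<open>a\<close> has order \<open>p\<close>.\<close>
  have expB: "b [^]\<^bsub>B\<^esub> p = \<one>\<^bsub>B\<^esub>" if b: "b \<in> carrier B" for b
  proof -
    obtain y where y: "y \<in> carrier A" "\<beta> a y = b" using surj[OF a a1 b] by blast
    then show ?thesis using pow1[OF a y(1), of p] one1[OF y(1)] ap by simp
  qed
  \<comment> \<open>Otherwise pairing with the \<open>p\<close>-th power of \<open>x\<close> would
    be onto \<open>B\<close> and, by \<open>expB\<close>, trivial, although \<open>B\<close> is
    not.\<close>
  have expA: "x [^]\<^bsub>A\<^esub> p = \<one>\<^bsub>A\<^esub>" if x: "x \<in> carrier A" for x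
  proof (rule ccontr)
    assume ne: "x [^]\<^bsub>A\<^esub> p \<noteq> \<one>\<^bsub>A\<^esub>"
    have "b = \<one>\<^bsub>B\<^esub>" if b: "b \<in> carrier B" for b
    proof -
      obtain y where y: "y \<in> carrier A" "\<beta> (x [^]\<^bsub>A\<^esub> p) y = b" using surj[OF _ ne b] x by auto
      then show ?thesis using pow1[OF x y(1), of p] expB[OF cl[OF x y(1)]] by simp
    qed
    then show False using False B.one_closed by blast
  qed
  obtain m e where e: "e \<in> {..<m} \<rightarrow> carrier A"
    and spanA: "\<forall>x\<in>carrier A. \<exists>c. x = pow_prod A e m c"
    and indA: "\<forall>c. pow_prod A e m c = \<one>\<^bsub>A\<^esub> \<longrightarrow> (\<forall>i<m. int p dvd c i)"
    and cardA: "card (carrier A) = p ^ m"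
    using A.elementary_abelian_basis[OF A(2) p(1) expA] by blast
  obtain n f where f: "f \<in> {..<n} \<rightarrow> carrier B"
    and spanB: "\<forall>x\<in>carrier B. \<exists>c. x = pow_prod B f n c"
    and indB: "\<forall>c. pow_prod B f n c = \<one>\<^bsub>B\<^esub> \<longrightarrow> (\<forall>i<n. int p dvd c i)"
    and cardB: "card (carrier B) = p ^ n"
    using B.elementary_abelian_basis[OF B(2) p(1) expB] by blast
  have m: "0 < m"
  proof (rule ccontr)
    assume "\<not> 0 < m"
    then show False using spanA a a1 by simp
  qed
  have ec: "e i \<in> carrier A" if "i < m" for i using e that by auto
  define d where "d i j = (SOME c. \<beta> (e i) (e j) = pow_prod B f n c)" for i j
  have d: "\<beta> (e i) (e j) = pow_prod B f n (d i j)" if ij: "i < m" "j < m" for i j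
    unfolding d_def by (rule someI_ex[OF bspec[OF spanB cl[OF ec[OF ij(1)] ec[OF ij(2)]]]])
  \<comment> \<open>Only coordinates with \<open>i < j\<close> are taken from \<open>d\<close>, and
    the rest are filled in by sign. This makes \<open>c\<close> skew over the integers, whereas
    \<open>d\<close> is determined only modulo \<open>p\<close>.\<close>
  define c where "c i j l = (if i < j then d i j l else if j < i then - d j i l else 0)" for i j l
  have skew: "\<beta> y x = inv\<^bsub>B\<^esub> \<beta> x y" if xy: "x \<in> carrier A" "y \<in> carrier A" for x y
  proof -
    have "\<one>\<^bsub>B\<^esub> = \<beta> (x \<otimes>\<^bsub>A\<^esub> y) (x \<otimes>\<^bsub>A\<^esub> y)" using alt xy by simp
    also have "\<dots> = (\<beta> x x \<otimes>\<^bsub>B\<^esub> \<beta> x y) \<otimes>\<^bsub>B\<^esub> (\<beta> y x \<otimes>\<^bsub>B\<^esub> \<beta> y y)"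
      using xy cl by (simp add: mult1 mult2 B.m_ac)
    also have "\<dots> = \<beta> x y \<otimes>\<^bsub>B\<^esub> \<beta> y x" using xy cl alt by simp
    finally show ?thesis using cl xy by (metis B.inv_char B.m_comm)
  qed
  have bc: "\<beta> (e i) (e j) = pow_prod B f n (c i j)" if ij: "i < m" "j < m" for i j
  proof -
    consider "i < j" | "j < i" | "i = j" by linarith
    then show ?thesis
    proof cases
      case 1
      then have "c i j = d i j" by (auto simp: c_def)
      then show ?thesis using d ij by simp
    next
      case 2
      then have "c i j = (\<lambda>l. - 1 * d j i l)" by (auto simp: c_def)
      then have "pow_prod B f n (c i j) = inv\<^bsub>B\<^esub> \<beta> (e j) (e i)"
        using B.pow_prod_scale[OF f, of "-1" "d j i"] d[OF ij(2,1)] f by (simp add: B.int_pow_neg)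
      then show ?thesis using skew[OF ec[OF ij(2)] ec[OF ij(1)]] by simp
    next
      case 3
      then have "c i j = (\<lambda>l. 0)" by (auto simp: c_def)
      then show ?thesis using 3 alt[OF ec[OF ij(1)]] B.pow_prod_zero[OF f] by simp
    qed
  qed
  have eval: "\<beta> (pow_prod A e m x) (pow_prod A e m y) =
      pow_prod B f n (\<lambda>l. \<Sum>i<m. x i * (\<Sum>j<m. y j * c i j l))" for x y
  proof -
    let ?y = "pow_prod A e m y"
    have y: "?y \<in> carrier A" using e by simp
    have "\<beta> (e i) ?y = pow_prod B f n (\<lambda>l. \<Sum>j<m. y j * c i j l)" if i: "i < m" for i
    proof -
      have "\<beta> (e i) ?y = finprod B (\<lambda>j. \<beta> (e i) (e j) [^]\<^bsub>B\<^esub> y j) {..<m}"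
        by (rule A.hom_pow_prod[OF B(1) h2[OF ec[OF i]] e])
      also have "\<dots> = finprod B (\<lambda>j. pow_prod B f n (\<lambda>l. y j * c i j l)) {..<m}"
        by (rule B.finprod_cong') (use i f bc in \<open>auto simp: B.pow_prod_scale[OF f]\<close>)
      finally show ?thesis unfolding B.finprod_pow_prod[OF f] .
    qed
    moreover have "\<beta> (pow_prod A e m x) ?y = finprod B (\<lambda>i. \<beta> (e i) ?y [^]\<^bsub>B\<^esub> x i) {..<m}"
      by (rule A.hom_pow_prod[OF B(1) h1[OF y] e])
    ultimately have "\<beta> (pow_prod A e m x) ?y =
        finprod B (\<lambda>i. pow_prod B f n (\<lambda>l. x i * (\<Sum>j<m. y j * c i j l))) {..<m}"
      by (simp only:) (rule B.finprod_cong', use f in \<open>auto simp: B.pow_prod_scale[OF f]\<close>)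
    then show ?thesis unfolding B.finprod_pow_prod[OF f] .
  qed
  have "2 * n \<le> m"
  proof (rule alternating_forms_bound[OF p(1) m, where c=c])
    fix w x :: "nat \<Rightarrow> int"
    assume "\<exists>l<n. \<not> int p dvd w l" and "\<exists>i<m. \<not> int p dvd x i"
    then obtain l0 i0 where l0: "l0 < n" "\<not> int p dvd w l0" and i0: "i0 < m" "\<not> int p dvd x i0" by blast
    let ?x = "pow_prod A e m x"
    have x: "?x \<in> carrier A" "?x \<noteq> \<one>\<^bsub>A\<^esub>" using e indA i0 by auto
    \<comment> \<open>\<open>u\<close> is the coordinate vector of a basis element of
      \<open>B\<close> on which \<open>w\<close> does not vanish. A \<open>y'\<close> with
      \<open>\<beta> ?x y'\<close> equal to that element shows that the form of \<open>w\<close> is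
      nonzero at \<open>?x\<close>.\<close>
    define u where "u l = (if l = l0 then 1 else 0 :: int)" for l
    obtain y' where y': "y' \<in> carrier A" "\<beta> ?x y' = pow_prod B f n u"
      using surj[OF x] B.pow_prod_closed[OF f] by blast
    obtain y where y: "y' = pow_prod A e m y" using spanA y'(1) by blast
    define s where "s l = (\<Sum>i<m. x i * (\<Sum>j<m. y j * c i j l))" for l
    have s: "pow_prod B f n s = pow_prod B f n u"
      using y'(2) unfolding y eval s_def .
    have "pow_prod B f n (\<lambda>l. (s l - u l) + u l) = pow_prod B f n (\<lambda>l. s l - u l) \<otimes>\<^bsub>B\<^esub> pow_prod B f n u"
      by (rule B.pow_prod_add[OF f])
    then have "pow_prod B f n (\<lambda>l. s l - u l) = \<one>\<^bsub>B\<^esub>"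
      using s f by (simp add: B.r_cancel_one')
    then have su: "int p dvd s l - u l" if "l < n" for l using indB that by blast
    show "\<exists>j<m. \<not> int p dvd (\<Sum>i<m. x i * (\<Sum>l<n. w l * c i j l))"
    proof (rule ccontr)
      assume "\<not> ?thesis"
      then have "int p dvd (\<Sum>j<m. y j * (\<Sum>i<m. x i * (\<Sum>l<n. w l * c i j l)))"
        by (intro dvd_sum) (rule dvd_mult, auto)
      also have "(\<Sum>j<m. y j * (\<Sum>i<m. x i * (\<Sum>l<n. w l * c i j l))) = (\<Sum>l<n. w l * s l)"
      proof -
        have "(\<Sum>j<m. y j * (\<Sum>i<m. x i * (\<Sum>l<n. w l * c i j l))) =
            (\<Sum>j<m. \<Sum>i<m. \<Sum>l<n. w l * (x i * (y j * c i j l)))"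
          by (simp add: sum_distrib_left mult_ac)
        also have "\<dots> = (\<Sum>i<m. \<Sum>j<m. \<Sum>l<n. w l * (x i * (y j * c i j l)))" by (rule sum.swap)
        also have "\<dots> = (\<Sum>i<m. \<Sum>l<n. \<Sum>j<m. w l * (x i * (y j * c i j l)))"
          by (rule sum.cong[OF refl]) (rule sum.swap)
        also have "\<dots> = (\<Sum>l<n. \<Sum>i<m. \<Sum>j<m. w l * (x i * (y j * c i j l)))" by (rule sum.swap)
        finally show ?thesis by (simp add: s_def sum_distrib_left)
      qed
      finally have d1: "int p dvd (\<Sum>l<n. w l * s l)" .
      have "int p dvd (\<Sum>l<n. w l * (s l - u l))"
        using su by (intro dvd_sum dvd_mult) auto
      then have "int p dvd (\<Sum>l<n. w l * s l) - (\<Sum>l<n. w l * u l)"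
        by (simp add: right_diff_distrib sum_subtractf)
      then have "int p dvd (\<Sum>l<n. w l * u l)" using d1 by (metis dvd_diff_right_iff)
      also have "(\<Sum>l<n. w l * u l) = (\<Sum>l<n. if l = l0 then w l else 0)"
        by (rule sum.cong) (auto simp: u_def)
      also have "\<dots> = w l0" using l0 by simp
      finally show False using l0 by simp
    qed
  qed (auto simp: c_def)
  moreover have "p \<ge> 1" using p prime_gt_1_nat[of p] by simp
  ultimately have "p ^ (2 * n) \<le> p ^ m" by (rule power_increasing)
  then show ?thesis unfolding cardA cardB by (simp add: power_mult power_mult_distrib mult.commute power_even_eq)
qed

section \<open>Commutators and the vanishing-off subgroup\<close>

context group
begin

definition commutator :: "'a \<Rightarrow> 'a \<Rightarrow> 'a" where
  "commutator x y = x \<otimes> y \<otimes> inv x \<otimes> inv y"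

lemma inv_mult_cancel:
  assumes "x \<in> carrier G" "y \<in> carrier G"
  shows "inv x \<otimes> (x \<otimes> y) = y" "x \<otimes> (inv x \<otimes> y) = y"
  using assms by (simp_all add: m_assoc[symmetric])

text \<open>Words are brought into right-associated form with adjacent inverse letters cancelled.
  This suffices for the commutator identities below, including the Hall-Witt identity.\<close>

lemmas group_word_simps = m_assoc inv_mult_group inv_mult_cancel

lemma commutator_closed [simp]:
  "x \<in> carrier G \<Longrightarrow> y \<in> carrier G \<Longrightarrow> commutator x y \<in> carrier G"
  unfolding commutator_def by simp

lemma inv_group_commutator:
  "x \<in> carrier G \<Longrightarrow> y \<in> carrier G \<Longrightarrow> inv (commutator x y) = commutator y x"
  unfolding commutator_def by (simp add: group_word_simps)

lemma commutator_self: "x \<in> carrier G \<Longrightarrow> commutator x x = \<one>"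
  unfolding commutator_def by (simp add: group_word_simps)

lemma conj_eq_commutator_mult:
  "x \<in> carrier G \<Longrightarrow> y \<in> carrier G \<Longrightarrow> x \<otimes> y \<otimes> inv x = commutator x y \<otimes> y"
  unfolding commutator_def by (simp add: group_word_simps)

lemma commutator_mult_left:
  assumes "x \<in> carrier G" "y \<in> carrier G" "z \<in> carrier G"
  shows "commutator (x \<otimes> y) z = x \<otimes> commutator y z \<otimes> inv x \<otimes> commutator x z"
  using assms unfolding commutator_def by (simp add: group_word_simps)

lemma commutator_mult_right:
  assumes "x \<in> carrier G" "y \<in> carrier G" "z \<in> carrier G"
  shows "commutator x (y \<otimes> z) = commutator x y \<otimes> (y \<otimes> commutator x z \<otimes> inv y)"
  using assms unfolding commutator_def by (simp add: group_word_simps)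

text \<open>The deviation from multiplicativity is isolated as one commutator of higher weight,
  which a normal subgroup can absorb or a character can send to 1.\<close>

lemma commutator_mult_left':
  assumes "x \<in> carrier G" "y \<in> carrier G" "z \<in> carrier G"
  shows "commutator (x \<otimes> y) z =
    commutator x (commutator y z) \<otimes> (commutator y z \<otimes> commutator x z)"
  using assms by (simp add: commutator_mult_left conj_eq_commutator_mult[symmetric] m_assoc[symmetric])

lemma commutator_mult_right':
  assumes "x \<in> carrier G" "y \<in> carrier G" "z \<in> carrier G"
  shows "commutator x (y \<otimes> z) =
    commutator x y \<otimes> (commutator y (commutator x z) \<otimes> commutator x z)"
  using assms by (simp add: commutator_mult_right conj_eq_commutator_mult)

lemma mult_eq_commutator_mult:
  "x \<in> carrier G \<Longrightarrow> y \<in> carrier G \<Longrightarrow> x \<otimes> y = commutator x y \<otimes> (y \<otimes> x)"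
  unfolding commutator_def by (simp add: group_word_simps)

lemma conj_group_commutator:
  assumes "g \<in> carrier G" "x \<in> carrier G" "y \<in> carrier G"
  shows "g \<otimes> commutator x y \<otimes> inv g = commutator (g \<otimes> x \<otimes> inv g) (g \<otimes> y \<otimes> inv g)"
  using assms unfolding commutator_def by (simp add: group_word_simps)

text \<open>The conjugations in the outer entries disappear under \<open>\<mu>\<close>; what remains
  is the Jacobi identity \<open>triple_jacobi\<close>.\<close>

lemma hall_witt:
  assumes "x \<in> carrier G" "y \<in> carrier G" "z \<in> carrier G"
  shows "commutator (commutator x y) (y \<otimes> z \<otimes> inv y) \<otimes>
    commutator (commutator y z) (z \<otimes> x \<otimes> inv z) \<otimes>
    commutator (commutator z x) (x \<otimes> y \<otimes> inv x) = \<one>"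
  using assms unfolding commutator_def by (simp add: group_word_simps)

lemma commutator_subgroup_eq:
  "commutator_subgroup G H K = generate G {commutator h k | h k. h \<in> H \<and> k \<in> K}"
  unfolding commutator_subgroup_def commutator_def
  by (rule arg_cong[of _ _ "generate G"]) blast

lemma derived_eq_commutator_subgroup: "derived G H = commutator_subgroup G H H"
  unfolding derived_def commutator_subgroup_def by (rule arg_cong[of _ _ "generate G"]) blast

lemma commutator_in_commutator_subgroup:
  "h \<in> H \<Longrightarrow> k \<in> K \<Longrightarrow> commutator h k \<in> commutator_subgroup G H K"
  unfolding commutator_subgroup_eq by (rule generate.incl) blast

lemma commutator_subgroup_is_subgroup:
  assumes "H \<subseteq> carrier G" "K \<subseteq> carrier G"
  shows "subgroup (commutator_subgroup G H K) G"
  unfolding commutator_subgroup_eq by (rule generate_is_subgroup) (use assms in \<open>blast intro: commutator_closed\<close>)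

lemma commutator_subgroup_subsetI:
  assumes "subgroup N G" "\<And>h k. h \<in> H \<Longrightarrow> k \<in> K \<Longrightarrow> commutator h k \<in> N"
  shows "commutator_subgroup G H K \<subseteq> N"
  unfolding commutator_subgroup_eq by (rule generate_subgroup_incl[OF _ assms(1)]) (use assms(2) in auto)

lemma commutator_subgroup_mono:
  assumes "H \<subseteq> H'" "K \<subseteq> K'"
  shows "commutator_subgroup G H K \<subseteq> commutator_subgroup G H' K'"
  unfolding commutator_subgroup_eq by (rule mono_generate) (use assms in blast)

lemma normalD:
  assumes "N \<lhd> G"
  shows "subgroup N G" "N \<subseteq> carrier G" "\<And>x h. x \<in> carrier G \<Longrightarrow> h \<in> N \<Longrightarrow> x \<otimes> h \<otimes> inv x \<in> N"
  using assms normal_inv_iff subgroup.subset by blast+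

lemma coset_absorb:
  assumes N: "N \<lhd> G" and t: "t \<in> N" and c: "a \<in> carrier G" "b \<in> carrier G"
  shows "N #> (t \<otimes> b) = N #> b" "N #> (a \<otimes> (t \<otimes> b)) = N #> (a \<otimes> b)" "N #> (b \<otimes> t) = N #> b"
proof -
  note N' = normalD[OF N]
  have left: "N #> (t \<otimes> b) = N #> b" if "t \<in> N" "b \<in> carrier G" for t b
    using that N' coset_mult_assoc[of N t b] coset_join2[of t N] by auto
  have tc: "t \<in> carrier G" using N' t by blast
  show "N #> (t \<otimes> b) = N #> b" using left t c by blast
  have "a \<otimes> (t \<otimes> b) = (a \<otimes> t \<otimes> inv a) \<otimes> (a \<otimes> b)" using c tc by (simp add: group_word_simps)
  then show "N #> (a \<otimes> (t \<otimes> b)) = N #> (a \<otimes> b)" using left[OF N'(3)[OF c(1) t]] c by simp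
  have "b \<otimes> t = (b \<otimes> t \<otimes> inv b) \<otimes> b" using c tc by (simp add: m_assoc)
  then show "N #> (b \<otimes> t) = N #> b" using left[OF N'(3)[OF c(2) t] c(2)] by simp
qed

lemma factor_comm_group:
  assumes N: "N \<lhd> G" and "derived G (carrier G) \<subseteq> N"
  shows "comm_group (G Mod N)"
proof (rule group.group_comm_groupI[OF normal.factorgroup_is_group[OF N]])
  fix x y assume "x \<in> carrier (G Mod N)" "y \<in> carrier (G Mod N)"
  then obtain a b where ab: "a \<in> carrier G" "b \<in> carrier G" "x = N #> a" "y = N #> b"
    by (auto simp: FactGroup_def RCOSETS_def)
  have "commutator a b \<in> N"
    using ab assms(2) commutator_in_commutator_subgroup[of a "carrier G" b "carrier G"]
    unfolding derived_eq_commutator_subgroup by blast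
  then have "N #> (a \<otimes> b) = N #> (b \<otimes> a)"
    using coset_absorb(1)[OF N _ ab(1), of "commutator a b" "b \<otimes> a"] ab mult_eq_commutator_mult[OF ab(1,2)]
    by simp
  then show "x \<otimes>\<^bsub>G Mod N\<^esub> y = y \<otimes>\<^bsub>G Mod N\<^esub> x"
    using ab by (simp add: FactGroup_def normal.rcos_sum[OF N])
qed

lemma commutator_subgroup_normal:
  assumes "H \<lhd> G" "K \<lhd> G"
  shows "commutator_subgroup G H K \<lhd> G"
  unfolding commutator_subgroup_eq
proof (rule normal_generateI)
  note H = normalD[OF assms(1)] and K = normalD[OF assms(2)]
  show "{commutator h k | h k. h \<in> H \<and> k \<in> K} \<subseteq> carrier G"
    using H(2) K(2) by (blast intro: commutator_closed)
  fix c g assume "c \<in> {commutator h k | h k. h \<in> H \<and> k \<in> K}" and g: "g \<in> carrier G"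
  then obtain h k where hk: "h \<in> H" "k \<in> K" "c = commutator h k" by blast
  then have "g \<otimes> c \<otimes> inv g = commutator (g \<otimes> h \<otimes> inv g) (g \<otimes> k \<otimes> inv g)"
    using g H(2) K(2) by (simp add: conj_group_commutator subset_iff)
  then show "g \<otimes> c \<otimes> inv g \<in> {commutator h k | h k. h \<in> H \<and> k \<in> K}"
    using H(3)[OF g hk(1)] K(3)[OF g hk(2)] by blast
qed

lemma carrier_normal: "carrier G \<lhd> G"
  unfolding normal_inv_iff using subgroup_self by simp

lemma group_index_mult_card:
  assumes "subgroup K G" "subgroup H G" "K \<subseteq> H"
  shows "group_index G H K * card K = card H"
proof -
  have "subgroup K (G\<lparr>carrier := H\<rparr>)" using assms subgroup_incl by blast
  from group.lagrange[OF subgroup_imp_group[OF assms(2)] this]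
  show ?thesis unfolding group_index_def by (simp add: Coset.order_def)
qed

end

text \<open>All that the argument needs to know about the vanishing-off subgroup \<open>V\<close>.\<close>

locale vanishing_section = group G for G (structure) +
  fixes V :: "'a set"
  assumes finite_G: "finite (carrier G)"
    and V_normal: "V \<lhd> G"
    and commutator_onto: "\<And>g y. g \<in> carrier G \<Longrightarrow> g \<notin> V \<Longrightarrow> y \<in> derived G (carrier G) \<Longrightarrow>
      \<exists>x\<in>carrier G. commutator x g = y"
    and V3_ne_G3: "commutator_subgroup G (commutator_subgroup G V (carrier G)) (carrier G) \<noteq>
      commutator_subgroup G (derived G (carrier G)) (carrier G)"
begin

section \<open>Consequences of surjective commutator maps\<close>

abbreviation D where "D \<equiv> derived G (carrier G)"
abbreviation V2 where "V2 \<equiv> commutator_subgroup G V (carrier G)"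
abbreviation V3 where "V3 \<equiv> commutator_subgroup G V2 (carrier G)"
abbreviation G3 where "G3 \<equiv> commutator_subgroup G D (carrier G)"

lemma normals: "D \<lhd> G" "V2 \<lhd> G" "V3 \<lhd> G" "G3 \<lhd> G"
proof -
  show "D \<lhd> G" by (rule derived_self_is_normal)
  show "V2 \<lhd> G" by (rule commutator_subgroup_normal[OF V_normal carrier_normal])
  then show "V3 \<lhd> G" by (rule commutator_subgroup_normal[OF _ carrier_normal])
  show "G3 \<lhd> G" by (rule commutator_subgroup_normal[OF \<open>D \<lhd> G\<close> carrier_normal])
qed

lemmas V_props = normalD[OF V_normal]
lemmas D_props = normalD[OF normals(1)]
lemmas V2_props = normalD[OF normals(2)]
lemmas V3_props = normalD[OF normals(3)]
lemmas G3_props = normalD[OF normals(4)]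

lemma commutator_onto':
  assumes "g \<in> carrier G" "g \<notin> V" "y \<in> D"
  shows "\<exists>x\<in>carrier G. commutator g x = y"
proof -
  have "inv y \<in> D" by (rule subgroup.m_inv_closed[OF D_props(1) assms(3)])
  then obtain x where x: "x \<in> carrier G" "commutator x g = inv y" using commutator_onto assms by blast
  then have "commutator g x = y"
    using inv_group_commutator[OF x(1) assms(1)] assms(3) D_props(2) by (metis inv_inv subsetD)
  then show ?thesis using x by blast
qed

lemma commutator_in_D: "x \<in> carrier G \<Longrightarrow> y \<in> carrier G \<Longrightarrow> commutator x y \<in> D"
  unfolding derived_eq_commutator_subgroup by (rule commutator_in_commutator_subgroup)

text \<open>For \<open>g\<close> in \<open>D\<close> outside \<open>V\<close> the commutators with
  \<open>g\<close> would include \<open>inv g\<close>. Then a conjugate of \<open>g\<close> is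
  trivial, hence so is \<open>g\<close>, which contradicts \<open>\<one> \<in> V\<close>.\<close>

lemma D_le_V: "D \<subseteq> V"
proof
  fix g assume g: "g \<in> D"
  show "g \<in> V"
  proof (rule ccontr)
    assume gV: "g \<notin> V"
    have gc: "g \<in> carrier G" using g D_props by blast
    have "inv g \<in> D" by (rule subgroup.m_inv_closed[OF D_props(1) g])
    then obtain x where x: "x \<in> carrier G" "commutator x g = inv g" using commutator_onto gc gV by blast
    then have e: "x \<otimes> g \<otimes> inv x = \<one>" using conj_eq_commutator_mult[OF x(1) gc] gc by simp
    have "inv x \<otimes> (x \<otimes> g \<otimes> inv x) \<otimes> x = g"
      using x(1) gc by (simp add: group_word_simps)
    then have "\<one> = g" unfolding e using x(1) by simp
    then show False using gV V_props(1) subgroup.one_closed by blast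
  qed
qed

lemma V2_le_D: "V2 \<subseteq> D"
  unfolding derived_eq_commutator_subgroup[of "carrier G"]
  by (rule commutator_subgroup_mono[OF V_props(2) subset_refl])

lemma G3_le_V2: "G3 \<subseteq> V2"
  by (rule commutator_subgroup_mono[OF D_le_V subset_refl])

lemma V3_le_G3: "V3 \<subseteq> G3"
  by (rule commutator_subgroup_mono[OF V2_le_D subset_refl])

lemma derived_D_le_V2: "derived G D \<subseteq> V2"
  unfolding derived_eq_commutator_subgroup[of D]
  using commutator_subgroup_mono[OF subset_refl D_props(2)] G3_le_V2 by (rule subset_trans)

lemma V2_le_V: "V2 \<subseteq> V"
  using V2_le_D D_le_V by blast

text \<open>\<open>V = G\<close> would give \<open>V2 = D\<close> and so \<open>V3 = G3\<close>. The
  lemma supplies the nontriviality of \<open>G/V\<close> that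
  \<open>alternating_pairing_card\<close> asks for.\<close>

lemma V_ne_carrier: "V \<noteq> carrier G"
proof
  assume "V = carrier G"
  then have "V2 = D" unfolding derived_eq_commutator_subgroup[of "carrier G"] by (simp only:)
  then have "V3 = G3" by (rule arg_cong[where f="\<lambda>H. commutator_subgroup G H (carrier G)"])
  then show False using V3_ne_G3 by blast
qed

lemma commutator_V2:
  assumes "t \<in> V2" "x \<in> carrier G"
  shows "commutator t x \<in> V3" "commutator x t \<in> V3"
proof -
  show c: "commutator t x \<in> V3" using assms by (rule commutator_in_commutator_subgroup)
  show "commutator x t \<in> V3"
    using subgroup.m_inv_closed[OF V3_props(1) c] assms V2_props(2) by (simp add: inv_group_commutator subset_iff)
qed

lemma commutator_V:
  assumes "v \<in> V" "x \<in> carrier G"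
  shows "commutator v x \<in> V2" "commutator x v \<in> V2"
proof -
  show c: "commutator v x \<in> V2" using assms by (rule commutator_in_commutator_subgroup)
  show "commutator x v \<in> V2"
    using subgroup.m_inv_closed[OF V2_props(1) c] assms V_props(2) by (simp add: inv_group_commutator subset_iff)
qed

lemma commutator_D:
  assumes "y \<in> D" "x \<in> carrier G"
  shows "commutator y x \<in> G3" "commutator x y \<in> G3"
proof -
  show c: "commutator y x \<in> G3" using assms by (rule commutator_in_commutator_subgroup)
  show "commutator x y \<in> G3"
    using subgroup.m_inv_closed[OF G3_props(1) c] assms D_props(2) by (simp add: inv_group_commutator subset_iff)
qed

text \<open>\<open>alternating_pairing_card\<close> is applied to the commutator as a pairing of
  \<open>G/V\<close> with values in \<open>D/V2\<close>. It is well defined because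
  \<open>[V, G] = V2\<close>, multiplicative because \<open>[D, G] = G3\<close> lies in
  \<open>V2\<close>, and onto by \<open>commutator_onto'\<close>.\<close>

lemma V2_card_inequality:
  "(group_index G D V2)\<^sup>2 \<le> group_index G (carrier G) V"
proof -
  let ?A = "G Mod V" and ?B = "G\<lparr>carrier := D\<rparr> Mod V2"
  have V2D: "V2 \<lhd> G\<lparr>carrier := D\<rparr>"
    by (rule normal_restrict_supergroup[OF D_props(1) normals(2) V2_le_D])
  interpret GD: group "G\<lparr>carrier := D\<rparr>" using D_props(1) subgroup_imp_group by blast
  \<comment> \<open>Representatives are picked by \<open>SOME\<close>; the next fact shows that the
    value does not depend on them.\<close>
  define \<beta> where "\<beta> a b = V2 #> commutator (SOME x. x \<in> a) (SOME y. y \<in> b)" for a b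
  have \<beta>: "\<beta> (V #> x) (V #> y) = V2 #> commutator x y" if xy: "x \<in> carrier G" "y \<in> carrier G" for x y
  proof -
    define x' y' where "x' = (SOME z. z \<in> V #> x)" and "y' = (SOME z. z \<in> V #> y)"
    have "x' \<in> V #> x" "y' \<in> V #> y"
      unfolding x'_def y'_def using rcos_self[OF xy(1) V_props(1)] rcos_self[OF xy(2) V_props(1)] by (metis someI)+
    then obtain v w where vw: "v \<in> V" "w \<in> V" "x' = v \<otimes> x" "y' = w \<otimes> y" by (auto simp: r_coset_def)
    note c = vw(1,2)[THEN subsetD[OF V_props(2)]] xy
    have "V2 #> commutator x' y' = V2 #> (commutator x y' \<otimes> commutator v y')"
      unfolding vw(3) using vw c commutator_V(1)[OF vw(1)]
      by (simp add: commutator_mult_left' coset_absorb(1)[OF normals(2)])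
    also have "\<dots> = V2 #> commutator x y'"
      using vw c commutator_V(1)[OF vw(1)] by (simp add: coset_absorb(3)[OF normals(2)])
    also have "\<dots> = V2 #> (commutator x w \<otimes> commutator x y)"
      unfolding vw(4) using vw c commutator_V(1)[OF vw(2)]
      by (simp add: commutator_mult_right' coset_absorb(2)[OF normals(2)])
    also have "\<dots> = V2 #> commutator x y"
      using vw c commutator_V(2)[OF vw(2)] by (simp add: coset_absorb(1)[OF normals(2)])
    finally show ?thesis unfolding \<beta>_def x'_def y'_def .
  qed
  have cA: "carrier ?A = (\<lambda>x. V #> x) ` carrier G" by (auto simp: FactGroup_def RCOSETS_def)
  have cB: "carrier ?B = (\<lambda>x. V2 #> x) ` D" by (auto simp: FactGroup_def RCOSETS_def r_coset_def)
  have mA: "(V #> x) \<otimes>\<^bsub>?A\<^esub> (V #> y) = V #> (x \<otimes> y)" if "x \<in> carrier G" "y \<in> carrier G" for x y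
    using that normal.rcos_sum[OF V_normal] by (simp add: FactGroup_def)
  have mB: "(V2 #> x) \<otimes>\<^bsub>?B\<^esub> (V2 #> y) = V2 #> (x \<otimes> y)" if "x \<in> D" "y \<in> D" for x y
  proof -
    have "(V2 #> x) \<otimes>\<^bsub>?B\<^esub> (V2 #> y) = (V2 #> x) <#> (V2 #> y)"
      by (simp add: FactGroup_def set_mult_def)
    then show ?thesis using normal.rcos_sum[OF normals(2)] that D_props(2) by (simp add: subset_iff)
  qed
  have oA: "\<one>\<^bsub>?A\<^esub> = V" and oB: "\<one>\<^bsub>?B\<^esub> = V2" by (auto simp: FactGroup_def)
  have "(card (carrier ?B))\<^sup>2 \<le> card (carrier ?A)"
  proof (rule alternating_pairing_card[where \<beta>=\<beta>])
    show "comm_group ?A"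
      by (rule factor_comm_group[OF V_normal D_le_V])
    show "comm_group ?B"
      using GD.factor_comm_group[OF V2D] derived_consistent[OF subset_refl D_props(1)] derived_D_le_V2 by simp
    show "finite (carrier ?A)" "finite (carrier ?B)"
      unfolding cA cB using finite_G finite_subset[OF D_props(2)] by auto
    show "carrier ?A \<noteq> {\<one>\<^bsub>?A\<^esub>}"
    proof
      assume e: "carrier ?A = {\<one>\<^bsub>?A\<^esub>}"
      have "x \<in> V" if x: "x \<in> carrier G" for x
        using rcos_self[OF x V_props(1)] e x unfolding cA oA by blast
      then show False using V_ne_carrier V_props(2) by blast
    qed
  next
    fix a b assume "a \<in> carrier ?A" "b \<in> carrier ?A"
    then obtain x y where "x \<in> carrier G" "y \<in> carrier G" "a = V #> x" "b = V #> y" unfolding cA by blast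
    then show "\<beta> a b \<in> carrier ?B" unfolding cB using commutator_in_D by (simp add: \<beta>)
  next
    fix a a' b assume "a \<in> carrier ?A" "a' \<in> carrier ?A" "b \<in> carrier ?A"
    then obtain x x' y where c: "x \<in> carrier G" "x' \<in> carrier G" "y \<in> carrier G"
      and e: "a = V #> x" "a' = V #> x'" "b = V #> y" unfolding cA by blast
    have D: "commutator x y \<in> D" "commutator x' y \<in> D" using c commutator_in_D by auto
    have "V2 #> commutator (x \<otimes> x') y = V2 #> (commutator x' y \<otimes> commutator x y)"
      using c commutator_D(2)[OF D(2) c(1)] G3_le_V2
      by (simp add: commutator_mult_left' coset_absorb(1)[OF normals(2)] subset_iff)
    also have "\<dots> = V2 #> (commutator x y \<otimes> commutator x' y)"
      using c commutator_D(1)[OF D(2), of "commutator x y"] G3_le_V2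
      by (subst mult_eq_commutator_mult) (simp_all add: coset_absorb(1)[OF normals(2)] subset_iff)
    finally have q: "V2 #> commutator (x \<otimes> x') y = V2 #> (commutator x y \<otimes> commutator x' y)" .
    show "\<beta> (a \<otimes>\<^bsub>?A\<^esub> a') b = \<beta> a b \<otimes>\<^bsub>?B\<^esub> \<beta> a' b"
      using c D q by (simp add: e mA \<beta> mB del: mult_FactGroup)
  next
    fix a b b' assume "a \<in> carrier ?A" "b \<in> carrier ?A" "b' \<in> carrier ?A"
    then obtain x y y' where c: "x \<in> carrier G" "y \<in> carrier G" "y' \<in> carrier G"
      and e: "a = V #> x" "b = V #> y" "b' = V #> y'" unfolding cA by blast
    have D: "commutator x y \<in> D" "commutator x y' \<in> D" using c commutator_in_D by auto
    have q: "V2 #> commutator x (y \<otimes> y') = V2 #> (commutator x y \<otimes> commutator x y')"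
      using c commutator_D(2)[OF D(2) c(2)] G3_le_V2
      by (simp add: commutator_mult_right' coset_absorb(2)[OF normals(2)] subset_iff)
    show "\<beta> a (b \<otimes>\<^bsub>?A\<^esub> b') = \<beta> a b \<otimes>\<^bsub>?B\<^esub> \<beta> a b'"
      using c D q by (simp add: e mA \<beta> mB del: mult_FactGroup)
  next
    fix a assume "a \<in> carrier ?A"
    then obtain x where x: "x \<in> carrier G" "a = V #> x" unfolding cA by blast
    then show "\<beta> a a = \<one>\<^bsub>?B\<^esub>"
      using V2_props(2) by (simp add: \<beta> commutator_self oB)
  next
    fix a b assume "a \<in> carrier ?A" and ne: "a \<noteq> \<one>\<^bsub>?A\<^esub>" and "b \<in> carrier ?B"
    then obtain x d where x: "x \<in> carrier G" "a = V #> x" and d: "d \<in> D" "b = V2 #> d" unfolding cA cB by blast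
    have "x \<notin> V" using ne x coset_join2[OF x(1) V_props(1)] unfolding oA by blast
    then obtain y where y: "y \<in> carrier G" "commutator x y = d" using commutator_onto' x d by blast
    then have "\<beta> a (V #> y) = b" using x d by (simp add: \<beta>)
    moreover have "V #> y \<in> carrier ?A" unfolding cA using y by blast
    ultimately show "\<exists>y\<in>carrier ?A. \<beta> a y = b" by blast
  qed
  then show ?thesis unfolding group_index_def by (simp add: FactGroup_def)
qed

end

section \<open>The forms attached to a linear character of \<open>G3/V3\<close>\<close>

locale vanishing_section_character = vanishing_section +
  fixes \<mu> :: "'a \<Rightarrow> complex"
  assumes mu_mult: "\<And>s t. s \<in> G3 \<Longrightarrow> t \<in> G3 \<Longrightarrow> \<mu> (s \<otimes> t) = \<mu> s * \<mu> t"
    and mu_V3: "\<And>t. t \<in> V3 \<Longrightarrow> \<mu> t = 1"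
    and mu_nontrivial: "\<exists>t\<in>G3. \<mu> t \<noteq> 1"
begin

definition pairing where "pairing y x = \<mu> (commutator y x)"

abbreviation L where "L \<equiv> left_kernel (G\<lparr>carrier := D\<rparr>) G pairing"
abbreviation C\<mu> where "C\<mu> \<equiv> right_kernel (G\<lparr>carrier := D\<rparr>) G pairing"

lemma mu_V3_mult: "t \<in> V3 \<Longrightarrow> s \<in> G3 \<Longrightarrow> \<mu> (t \<otimes> s) = \<mu> s"
  using mu_mult mu_V3 V3_le_G3 by (simp add: subset_iff)

lemma mu_nonzero:
  assumes "t \<in> G3"
  shows "\<mu> t \<noteq> 0"
proof
  assume z: "\<mu> t = 0"
  have "inv t \<in> G3" by (rule subgroup.m_inv_closed[OF G3_props(1) assms])
  then have "\<mu> (t \<otimes> inv t) = 0" using assms z mu_mult by simp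
  then show False using mu_V3[OF subgroup.one_closed[OF V3_props(1)]] assms G3_props(2) by (simp add: subset_iff)
qed

text \<open>\<open>G3\<close> lies in \<open>V2\<close>, so \<open>[G3, G]\<close> lies in
  \<open>V3\<close>, where \<open>\<mu>\<close> is 1.\<close>

lemma mu_conj:
  assumes "t \<in> G3" "x \<in> carrier G"
  shows "\<mu> (x \<otimes> t \<otimes> inv x) = \<mu> t"
proof -
  have "t \<in> carrier G" "t \<in> V2" using assms G3_props(2) G3_le_V2 by auto
  then show ?thesis
    using assms mu_V3_mult[OF commutator_V2(2)] by (simp add: conj_eq_commutator_mult)
qed

text \<open>By \<open>mu_conj\<close> the conjugations in the product formulas for commutators are
  invisible to \<open>\<mu>\<close>.\<close>

lemma pairing_bicharacter: "bicharacter (G\<lparr>carrier := D\<rparr>) G pairing"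
proof -
  have "pairing (y \<otimes> y') x = pairing y x * pairing y' x"
    if "y \<in> D" "y' \<in> D" "x \<in> carrier G" for y y' x
  proof -
    have c: "y \<in> carrier G" "y' \<in> carrier G" using that D_props(2) by auto
    note k = commutator_D(1)[OF that(1,3)] commutator_D(1)[OF that(2,3)]
    have "pairing (y \<otimes> y') x = \<mu> (y \<otimes> commutator y' x \<otimes> inv y) * pairing y x"
      using c that(3) mu_mult[OF G3_props(3)[OF c(1) k(2)] k(1)]
      by (simp add: pairing_def commutator_mult_left)
    then show ?thesis using mu_conj[OF k(2) c(1)] by (simp add: pairing_def)
  qed
  moreover have "pairing y (x \<otimes> x') = pairing y x * pairing y x'"
    if "y \<in> D" "x \<in> carrier G" "x' \<in> carrier G" for y x x'
  proof -
    have c: "y \<in> carrier G" using that D_props(2) by auto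
    note k = commutator_D(1)[OF that(1,2)] commutator_D(1)[OF that(1,3)]
    have "pairing y (x \<otimes> x') = pairing y x * \<mu> (x \<otimes> commutator y x' \<otimes> inv x)"
      using c that mu_mult[OF k(1) G3_props(3)[OF that(2) k(2)]]
      by (simp add: pairing_def commutator_mult_right)
    then show ?thesis using mu_conj[OF k(2) that(2)] by (simp add: pairing_def)
  qed
  ultimately show ?thesis
    unfolding bicharacter_def using mu_nonzero commutator_D(1) by (simp add: pairing_def)
qed

lemma pairing_mult:
  "y \<in> D \<Longrightarrow> y' \<in> D \<Longrightarrow> x \<in> carrier G \<Longrightarrow> pairing (y \<otimes> y') x = pairing y x * pairing y' x"
  "y \<in> D \<Longrightarrow> x \<in> carrier G \<Longrightarrow> x' \<in> carrier G \<Longrightarrow> pairing y (x \<otimes> x') = pairing y x * pairing y x'"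
  using pairing_bicharacter unfolding bicharacter_def by auto

lemma pairing_nonzero: "y \<in> D \<Longrightarrow> x \<in> carrier G \<Longrightarrow> pairing y x \<noteq> 0"
  using pairing_bicharacter unfolding bicharacter_def by auto

lemma pairing_V2: "t \<in> V2 \<Longrightarrow> x \<in> carrier G \<Longrightarrow> pairing t x = 1"
  unfolding pairing_def using mu_V3 commutator_V2(1) by blast

lemma pairing_inv:
  assumes "y \<in> D" "x \<in> carrier G"
  shows "pairing y (inv x) = inverse (pairing y x)"
  using bicharacter_inv[OF bicharacter_flip[OF pairing_bicharacter] is_group assms(2)] assms(1) by simp

lemma pairing_conj_right:
  assumes "y \<in> D" "x \<in> carrier G" "g \<in> carrier G"
  shows "pairing y (g \<otimes> x \<otimes> inv g) = pairing y x"
  using assms pairing_nonzero by (simp add: pairing_mult pairing_inv)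

text \<open>Conjugation changes \<open>y\<close> by a factor in \<open>G3\<close>, which lies in
  \<open>V2\<close> and pairs trivially with everything.\<close>

lemma pairing_conj_left:
  assumes "y \<in> D" "x \<in> carrier G" "g \<in> carrier G"
  shows "pairing (g \<otimes> y \<otimes> inv g) x = pairing y x"
proof -
  have y: "y \<in> carrier G" using assms D_props(2) by blast
  have k: "commutator g y \<in> V2" using commutator_D(2)[OF assms(1,3)] G3_le_V2 by blast
  then have "commutator g y \<in> D" using V2_le_D by blast
  then show ?thesis
    using pairing_V2[OF k assms(2)] assms y by (simp add: conj_eq_commutator_mult pairing_mult)
qed

definition triple where "triple a b c = pairing (commutator a b) c"

lemma triple_mult:
  assumes "a \<in> carrier G" "b \<in> carrier G" "c \<in> carrier G" "a' \<in> carrier G"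
  shows "triple (a \<otimes> a') b c = triple a b c * triple a' b c"
    "triple b (a \<otimes> a') c = triple b a c * triple b a' c"
proof -
  have conj: "g \<otimes> y \<otimes> inv g \<in> D" if "y \<in> D" "g \<in> carrier G" for y g
    using D_props(3) that by blast
  show "triple (a \<otimes> a') b c = triple a b c * triple a' b c"
    unfolding triple_def commutator_mult_left[OF assms(1,4,2)]
    using assms by (simp add: pairing_mult(1) conj commutator_in_D pairing_conj_left)
  show "triple b (a \<otimes> a') c = triple b a c * triple b a' c"
    unfolding triple_def commutator_mult_right[OF assms(2,1,4)]
    using assms by (simp add: pairing_mult(1) conj commutator_in_D pairing_conj_left)
qed

lemma triple_nonzero: "a \<in> carrier G \<Longrightarrow> b \<in> carrier G \<Longrightarrow> c \<in> carrier G \<Longrightarrow> triple a b c \<noteq> 0"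
  unfolding triple_def by (rule pairing_nonzero[OF commutator_in_D])

lemma triple_self: 
  assumes "a \<in> carrier G" "c \<in> carrier G"
  shows "triple a a c = 1"
proof -
  have "\<one> \<in> V2" by (rule subgroup.one_closed[OF V2_props(1)])
  then show ?thesis unfolding triple_def using assms pairing_V2 by (simp add: commutator_self)
qed

lemma triple_skew:
  assumes "a \<in> carrier G" "b \<in> carrier G" "c \<in> carrier G"
  shows "triple a b c * triple b a c = 1"
proof -
  have "1 = triple (a \<otimes> b) (a \<otimes> b) c" using assms by (simp add: triple_self)
  also have "\<dots> = (triple a a c * triple a b c) * (triple b a c * triple b b c)"
    using assms by (simp add: triple_mult)
  also have "\<dots> = triple a b c * triple b a c"
    using assms by (simp add: triple_self)
  finally show ?thesis by (rule sym)
qed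

lemma triple_jacobi:
  assumes "x \<in> carrier G" "y \<in> carrier G" "z \<in> carrier G"
  shows "triple x y z * triple y z x * triple z x y = 1"
proof -
  have t: "\<mu> (commutator (commutator a b) (b \<otimes> c \<otimes> inv b)) = triple a b c"
    and m: "commutator (commutator a b) (b \<otimes> c \<otimes> inv b) \<in> G3"
    if "a \<in> carrier G" "b \<in> carrier G" "c \<in> carrier G" for a b c
    using pairing_conj_right[OF commutator_in_D[OF that(1,2)] that(3,2)] that commutator_D(1)[OF commutator_in_D[OF that(1,2)]]
    unfolding triple_def pairing_def by auto
  note m1 = m[OF assms] and m2 = m[OF assms(2,3,1)] and m3 = m[OF assms(3,1,2)]
  have "triple x y z * triple y z x * triple z x y = \<mu> \<one>"
    unfolding hall_witt[OF assms, symmetric]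
      mu_mult[OF subgroup.m_closed[OF G3_props(1) m1 m2] m3] mu_mult[OF m1 m2]
      t[OF assms] t[OF assms(2,3,1)] t[OF assms(3,1,2)] ..
  also have "\<dots> = 1" by (rule mu_V3[OF subgroup.one_closed[OF V3_props(1)]])
  finally show ?thesis .
qed

lemma L_subgroup: "subgroup L G" and L_le_D: "L \<subseteq> D" and V2_le_L: "V2 \<subseteq> L"
proof -
  show LD: "L \<subseteq> D" by (auto simp: left_kernel_def)
  show "subgroup L G"
    using left_kernel_subgroup[OF pairing_bicharacter subgroup_imp_group[OF D_props(1)]] D_props(1)
    using incl_subgroup by blast
  show "V2 \<subseteq> L" using V2_le_D pairing_V2 by (auto simp: left_kernel_def)
qed

lemma Cmu_subgroup: "subgroup C\<mu> G"
  using left_kernel_subgroup[OF bicharacter_flip[OF pairing_bicharacter] is_group]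
  unfolding left_kernel_flip .

lemma Cmu_iff: "x \<in> C\<mu> \<longleftrightarrow> x \<in> carrier G \<and> (\<forall>y\<in>D. pairing y x = 1)"
  by (auto simp: right_kernel_def)

lemma triple_Cmu: "a \<in> carrier G \<Longrightarrow> b \<in> carrier G \<Longrightarrow> x \<in> C\<mu> \<Longrightarrow> triple a b x = 1"
  unfolding triple_def Cmu_iff using commutator_in_D by blast

text \<open>The elements of \<open>D\<close> that pair trivially with \<open>x\<close> form a
  subgroup, and \<open>D\<close> is generated by commutators.\<close>

lemma pairing_trivial_if_triple:
  assumes x: "x \<in> carrier G" and t: "\<And>a b. a \<in> carrier G \<Longrightarrow> b \<in> carrier G \<Longrightarrow> triple a b x = 1"
  shows "x \<in> C\<mu>"
proof -
  let ?K = "{y \<in> D. pairing y x = 1}"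
  have "subgroup ?K G"
  proof (rule subgroupI)
    show "?K \<subseteq> carrier G" using D_props(2) by blast
    show "?K \<noteq> {}"
      using subgroup.one_closed[OF V2_props(1)] V2_le_D pairing_V2[OF _ x] by blast
    show "inv y \<in> ?K" if "y \<in> ?K" for y
    proof -
      have y: "y \<in> D" "inv y \<in> D" "pairing y x = 1" using that subgroup.m_inv_closed[OF D_props(1)] by auto
      have "pairing (inv y \<otimes> y) x = pairing (inv y) x * pairing y x" using y x by (intro pairing_mult)
      moreover have "inv y \<otimes> y \<in> V2"
        using subgroup.one_closed[OF V2_props(1)] y(1) D_props(2) by (simp add: subset_iff)
      ultimately show ?thesis using y pairing_V2[OF _ x] by simp
    qed
    show "y \<otimes> y' \<in> ?K" if "y \<in> ?K" "y' \<in> ?K" for y y'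
      using that x subgroup.m_closed[OF D_props(1)] by (simp add: pairing_mult)
  qed
  then have "D \<subseteq> ?K"
    unfolding derived_eq_commutator_subgroup[of "carrier G"]
  proof (rule commutator_subgroup_subsetI)
    fix a b assume ab: "a \<in> carrier G" "b \<in> carrier G"
    then show "commutator a b \<in> {y \<in> commutator_subgroup G (carrier G) (carrier G). pairing y x = 1}"
      using t[OF ab] commutator_in_commutator_subgroup[OF ab] by (simp add: triple_def)
  qed
  then show ?thesis using x unfolding Cmu_iff by blast
qed

text \<open>In the Jacobi identity two factors contain \<open>v\<close> in the inner commutator,
  which then lies in \<open>V2\<close>. They are 1, and so is the third.\<close>

lemma V_le_Cmu: "V \<subseteq> C\<mu>"
proof
  fix v assume v: "v \<in> V"
  then have vc: "v \<in> carrier G" using V_props(2) by blast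
  show "v \<in> C\<mu>"
  proof (rule pairing_trivial_if_triple[OF vc])
    fix a b assume ab: "a \<in> carrier G" "b \<in> carrier G"
    have "triple b v a = 1" "triple v a b = 1"
      unfolding triple_def using pairing_V2 commutator_V[OF v] ab by auto
    then show "triple a b v = 1" using triple_jacobi[OF ab vc] by simp
  qed
qed

text \<open>Otherwise \<open>\<mu>\<close> would be 1 on the commutators that generate
  \<open>G3\<close>.\<close>

lemma Cmu_ne_carrier: "C\<mu> \<noteq> carrier G"
proof
  assume e: "C\<mu> = carrier G"
  have one: "\<mu> (commutator y x) = 1" if "y \<in> D" "x \<in> carrier G" for y x
  proof -
    have "x \<in> C\<mu>" using that(2) unfolding e .
    then show ?thesis using that(1) unfolding Cmu_iff pairing_def by blast
  qed
  let ?K = "{t \<in> G3. \<mu> t = 1}"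
  have "subgroup ?K G"
  proof (rule subgroupI)
    show "?K \<subseteq> carrier G" using G3_props(2) by blast
    show "?K \<noteq> {}" using subgroup.one_closed[OF V3_props(1)] V3_le_G3 mu_V3 by blast
    show "inv t \<in> ?K" if "t \<in> ?K" for t
    proof -
      have t: "t \<in> G3" "inv t \<in> G3" "\<mu> t = 1" using that subgroup.m_inv_closed[OF G3_props(1)] by auto
      have "inv t \<otimes> t = \<one>" using t G3_props(2) by (simp add: subset_iff)
      then have "\<mu> (inv t) * \<mu> t = 1"
        using mu_mult[OF t(2,1)] mu_V3[OF subgroup.one_closed[OF V3_props(1)]] by simp
      then show ?thesis using t by simp
    qed
    show "s \<otimes> t \<in> ?K" if "s \<in> ?K" "t \<in> ?K" for s t
      using that subgroup.m_closed[OF G3_props(1)] by (simp add: mu_mult)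
  qed
  then have "G3 \<subseteq> ?K"
    by (rule commutator_subgroup_subsetI) (use one commutator_D(1) in simp)
  then show False using mu_nontrivial by blast
qed

lemma card_L_card_Cmu: "card L * card (carrier G) = card C\<mu> * card D"
  using card_left_kernel_right_kernel[OF subgroup_imp_group[OF D_props(1)] _ is_group finite_G pairing_bicharacter]
    finite_subset[OF D_props(2) finite_G] by simp

text \<open>The form \<open>triple u v x0\<close> has radical \<open>V\<close>, and by the Jacobi identity \<open>C\<mu>\<close> is isotropic.\<close>

lemma card_Cmu_bound: "(card C\<mu>)\<^sup>2 \<le> card V * card (carrier G)"
proof -
  obtain x0 where x0: "x0 \<in> carrier G" "x0 \<notin> C\<mu>"
    using Cmu_ne_carrier subgroup.subset[OF Cmu_subgroup] by blast
  then obtain y0 where y0: "y0 \<in> D" "pairing y0 x0 \<noteq> 1" unfolding Cmu_iff by blast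
  define f where "f u v = triple u v x0" for u v
  let ?H = "G\<lparr>carrier := C\<mu>\<rparr>"
  have CG: "C\<mu> \<subseteq> carrier G" by (rule subgroup.subset[OF Cmu_subgroup])
  have f: "bicharacter ?H G f"
    unfolding bicharacter_def f_def using CG x0 by (auto simp: triple_mult triple_nonzero subset_iff)
  have lk: "left_kernel ?H G f = V"
  proof
    show "V \<subseteq> left_kernel ?H G f"
      using V_le_Cmu pairing_V2[OF commutator_V(1) x0(1)] by (auto simp: left_kernel_def f_def triple_def)
    show "left_kernel ?H G f \<subseteq> V"
    proof
      fix u assume u: "u \<in> left_kernel ?H G f"
      then have uc: "u \<in> carrier G" and fu: "\<And>v. v \<in> carrier G \<Longrightarrow> f u v = 1"
        using CG by (auto simp: left_kernel_def)
      show "u \<in> V"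
      proof (rule ccontr)
        assume "u \<notin> V"
        then obtain v where "v \<in> carrier G" "commutator u v = y0" using commutator_onto'[OF uc _ y0(1)] by blast
        then show False using fu y0 by (auto simp: f_def triple_def)
      qed
    qed
  qed
  have "C\<mu> \<subseteq> right_kernel ?H G f"
  proof
    fix v assume v: "v \<in> C\<mu>"
    have "f u v = 1" if u: "u \<in> C\<mu>" for u
    proof -
      have c: "u \<in> carrier G" "v \<in> carrier G" using u v CG by auto
      \<comment> \<open>The other two factors of the Jacobi identity have \<open>u\<close> or
        \<open>v\<close> as last entry, hence an element of \<open>C\<mu>\<close>.\<close>
      show ?thesis
        using triple_jacobi[OF c x0(1)] triple_Cmu[OF c(2) x0(1) u] triple_Cmu[OF x0(1) c(1) v]
        by (simp add: f_def)
    qed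
    then show "v \<in> right_kernel ?H G f" using v CG by (auto simp: right_kernel_def)
  qed
  moreover have "right_kernel ?H G f \<subseteq> carrier G" by (auto simp: right_kernel_def)
  ultimately have "card C\<mu> \<le> card (right_kernel ?H G f)"
    using finite_G finite_subset card_mono by metis
  then have "card C\<mu> * card C\<mu> \<le> card (right_kernel ?H G f) * card C\<mu>" by (rule mult_le_mono1)
  also have "\<dots> = card V * card (carrier G)"
    using card_left_kernel_right_kernel[OF subgroup_imp_group[OF Cmu_subgroup] _ is_group finite_G f]
      finite_subset[OF CG finite_G] unfolding lk by simp
  finally show ?thesis by (simp add: power2_eq_square)
qed

text \<open>The kernel count turns \<open>card_Cmu_bound\<close> into an upper bound for
  \<open>|L|^2 |G|\<close>, and \<open>V2_card_inequality\<close> bounds this by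
  \<open>|V2|^2 |G|\<close>. Since \<open>L\<close> contains \<open>V2\<close>, every inequality is
  an equality; the three claims are the equality cases.\<close>

lemma L_eq: "L = V2"
  and index_V: "group_index G (carrier G) V = (group_index G D V2)\<^sup>2"
  and card_Cmu: "card C\<mu> * group_index G D V2 = card (carrier G)"
proof -
  let ?v = "card V" and ?d = "card D" and ?g = "card (carrier G)" and ?l = "card L"
    and ?c = "card C\<mu>" and ?w = "card V2" and ?i = "group_index G D V2" and ?j = "group_index G (carrier G) V"
  have pos: "card S > 0" if "subgroup S G" for S
    using that finite_subset[OF subgroup.subset[OF that] finite_G] subgroup.one_closed[OF that] card_gt_0_iff by blast
  have d: "?i * ?w = ?d" by (rule group_index_mult_card[OF V2_props(1) D_props(1) V2_le_D])
  have g: "?j * ?v = ?g" by (rule group_index_mult_card[OF V_props(1) subgroup_self V_props(2)])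
  have finL: "finite L" by (rule finite_subset[OF subgroup.subset[OF L_subgroup] finite_G])
  have wl: "?w \<le> ?l" by (rule card_mono[OF finL V2_le_L])
  have g0: "?g > 0" by (rule pos[OF subgroup_self])
  have v0: "?v > 0" by (rule pos[OF V_props(1)])
  have w0: "?w > 0" by (rule pos[OF V2_props(1)])
  have "?l\<^sup>2 * ?g * ?g = (?l * ?g)\<^sup>2" by (simp add: power2_eq_square mult_ac)
  also have "\<dots> = ?c\<^sup>2 * ?d\<^sup>2" unfolding card_L_card_Cmu by (simp add: power_mult_distrib)
  also have "\<dots> \<le> (?v * ?g) * ?d\<^sup>2" by (rule mult_le_mono1[OF card_Cmu_bound])
  finally have "?l\<^sup>2 * ?g \<le> ?v * ?d\<^sup>2" using g0 by (simp add: mult_ac)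
  also have "\<dots> = ?v * ?i\<^sup>2 * ?w\<^sup>2" unfolding d[symmetric] by (simp add: power_mult_distrib)
  finally have a: "?l\<^sup>2 * ?g \<le> ?v * ?i\<^sup>2 * ?w\<^sup>2" .
  have b: "?v * ?i\<^sup>2 \<le> ?g"
    unfolding g[symmetric] using V2_card_inequality by (simp add: mult.commute)
  have "?v * ?i\<^sup>2 * ?w\<^sup>2 \<le> ?g * ?w\<^sup>2" by (rule mult_le_mono1[OF b])
  from order_trans[OF a this] have "?l\<^sup>2 * ?g \<le> ?w\<^sup>2 * ?g" by (simp only: mult.commute)
  then have "?l\<^sup>2 \<le> ?w\<^sup>2" using g0 by simp
  then have "?l \<le> ?w" by (simp add: power2_nat_le_eq_le)
  then have lw: "?l = ?w" using wl by simp
  then show L: "L = V2" using card_subset_eq[OF finL V2_le_L] by simp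
  have "?g \<le> ?v * ?i\<^sup>2" using a w0 unfolding lw by (simp add: mult.commute)
  then have "?j * ?v = ?i\<^sup>2 * ?v" using b g by (simp add: mult.commute)
  then show "?j = ?i\<^sup>2" using v0 by simp
  have "?w * ?g = ?w * (?c * ?i)" using card_L_card_Cmu unfolding lw d[symmetric] by (simp add: mult_ac)
  then show "?c * ?i = ?g" using w0 by simp
qed

text \<open>For \<open>g\<close> in \<open>C\<mu>\<close> one factor of the Jacobi identity is 1, so
  \<open>triple g\<close> is symmetric in its last two arguments. As \<open>[g, -]\<close> maps onto
  \<open>D\<close>, membership of \<open>x\<close> in \<open>C\<mu>\<close> means
  \<open>triple g w x = 1\<close> for all \<open>w\<close>. By symmetry this places
  \<open>commutator g x\<close> in \<open>L\<close>, which equals \<open>V2\<close>.\<close>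

lemma Cmu_eq_commutator_preimage:
  assumes g: "g \<in> C\<mu>" "g \<notin> V" and x: "x \<in> carrier G"
  shows "x \<in> C\<mu> \<longleftrightarrow> commutator g x \<in> V2"
proof -
  have gc: "g \<in> carrier G" using g subgroup.subset[OF Cmu_subgroup] by blast
  have sym: "triple g w x = triple g x w" if w: "w \<in> carrier G" for w
  proof -
    have "triple g w x * triple x g w = 1"
      using triple_jacobi[OF gc w x] triple_Cmu[OF w x g(1)] by simp
    moreover have "triple g x w * triple x g w = 1" by (rule triple_skew[OF gc x w])
    ultimately show ?thesis by (metis mult_cancel_right mult_zero_right zero_neq_one)
  qed
  have "x \<in> C\<mu> \<longleftrightarrow> (\<forall>w\<in>carrier G. triple g w x = 1)"
  proof
    show "\<forall>w\<in>carrier G. triple g w x = 1" if "x \<in> C\<mu>" using triple_Cmu[OF gc _ that] by blast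
    assume t: "\<forall>w\<in>carrier G. triple g w x = 1"
    have "pairing y x = 1" if "y \<in> D" for y
      using commutator_onto'[OF gc g(2) that] t unfolding triple_def by blast
    then show "x \<in> C\<mu>" using x unfolding Cmu_iff by blast
  qed
  also have "\<dots> \<longleftrightarrow> (\<forall>w\<in>carrier G. pairing (commutator g x) w = 1)"
    using sym by (simp add: triple_def)
  also have "\<dots> \<longleftrightarrow> commutator g x \<in> L"
    using commutator_in_D[OF gc x] by (simp add: left_kernel_def)
  finally show ?thesis unfolding L_eq .
qed

end

section \<open>Separating characters and the subgroups \<open>C\<close> and \<open>Z\<close>\<close>

context vanishing_section
begin

text \<open>Elementwise forms of preimages from \<open>G/V3\<close>;
  \<open>preimage_centralizer\<close> and \<open>preimage_center\<close> identify them with the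
  subgroups of the theorem.\<close>

definition C where "C = {x \<in> carrier G. \<forall>s\<in>D. commutator x s \<in> V3}"
definition Z where "Z = {z \<in> carrier G. \<forall>x\<in>carrier G. commutator z x \<in> V3}"

text \<open>\<open>[G3, G3]\<close> lies in \<open>[V2, G] = V3\<close>, so \<open>G3/V3\<close> is
  abelian and its linear characters separate points.\<close>

lemma exists_section_character:
  assumes "z \<in> G3" "z \<notin> V3"
  shows "\<exists>\<mu>. vanishing_section_character G V \<mu> \<and> \<mu> z \<noteq> 1"
proof -
  let ?H = "G\<lparr>carrier := G3\<rparr>"
  have V3: "V3 \<lhd> ?H" by (rule normal_restrict_supergroup[OF G3_props(1) normals(3) V3_le_G3])
  have "derived G G3 \<subseteq> V3"
    unfolding derived_eq_commutator_subgroup[of G3]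
    by (rule commutator_subgroup_mono[OF G3_le_V2 G3_props(2)])
  then have der: "derived ?H (carrier ?H) \<subseteq> V3"
    using derived_consistent[OF subset_refl G3_props(1)] by simp
  have "finite (carrier ?H)" using finite_subset[OF G3_props(2) finite_G] by simp
  from exists_linear_character[OF V3 this der, of z]
  obtain \<mu> :: "'a \<Rightarrow> complex" where "\<And>x y. x \<in> G3 \<Longrightarrow> y \<in> G3 \<Longrightarrow> \<mu> (x \<otimes> y) = \<mu> x * \<mu> y"
    "\<And>k. k \<in> V3 \<Longrightarrow> \<mu> k = 1" "\<mu> z \<noteq> 1"
    using assms by auto
  then have "vanishing_section_character G V \<mu> \<and> \<mu> z \<noteq> 1"
    using assms(1) by (auto intro!: vanishing_section_character.intro vanishing_section_axioms
        vanishing_section_character_axioms.intro)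
  then show ?thesis by blast
qed

lemma C_le_Cmu:
  assumes "vanishing_section_character G V \<mu>"
  shows "C \<subseteq> vanishing_section_character.C\<mu> G \<mu>"
proof
  interpret vanishing_section_character G V \<mu> by fact
  fix x assume x: "x \<in> C"
  have "\<mu> (commutator s x) = 1" if s: "s \<in> D" for s
  proof -
    have "x \<in> carrier G" "s \<in> carrier G" "commutator x s \<in> V3" using x s D_props(2) by (auto simp: C_def)
    then have "commutator s x \<in> V3"
      using subgroup.m_inv_closed[OF V3_props(1), of "commutator x s"] by (simp add: inv_group_commutator)
    then show ?thesis by (rule mu_V3)
  qed
  then show "x \<in> C\<mu>" using x unfolding Cmu_iff pairing_def by (auto simp: C_def)
qed

text \<open>Since linear characters of \<open>G3/V3\<close> separate points, a commutator outside
  \<open>V3\<close> is detected by some \<open>\<mu>\<close>. Together with \<open>C_le_Cmu\<close>,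
  \<open>C\<close> is the intersection of all \<open>C\<mu>\<close>.\<close>

lemma in_C_if_in_all_Cmu:
  assumes x: "x \<in> carrier G"
    and all: "\<And>\<mu>. vanishing_section_character G V \<mu> \<Longrightarrow> x \<in> vanishing_section_character.C\<mu> G \<mu>"
  shows "x \<in> C"
proof (rule ccontr)
  assume "x \<notin> C"
  then obtain s where s: "s \<in> D" "commutator x s \<notin> V3" using x by (auto simp: C_def)
  have sc: "s \<in> carrier G" using s D_props(2) by blast
  have "commutator s x \<notin> V3"
    using s(2) subgroup.m_inv_closed[OF V3_props(1), of "commutator s x"] x sc
    by (auto simp: inv_group_commutator)
  then obtain \<mu> where \<mu>: "vanishing_section_character G V \<mu>" "\<mu> (commutator s x) \<noteq> 1"
    using exists_section_character[OF commutator_D(1)[OF s(1) x]] by blast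
  interpret vanishing_section_character G V \<mu> by (rule \<mu>(1))
  show False using all[OF \<mu>(1)] \<mu>(2) s(1) unfolding Cmu_iff pairing_def by blast
qed

lemma V_le_C: "V \<subseteq> C"
proof
  fix v assume v: "v \<in> V"
  show "v \<in> C"
    by (rule in_C_if_in_all_Cmu) (use v V_props(2) vanishing_section_character.V_le_Cmu in blast)+
qed

lemma obtain_section_character:
  obtains \<mu> where "vanishing_section_character G V \<mu>"
proof -
  obtain z where "z \<in> G3" "z \<notin> V3" using V3_ne_G3 V3_le_G3 by blast
  then show ?thesis using exists_section_character that by blast
qed

lemma index_V_eq: "group_index G (carrier G) V = (group_index G D V2)\<^sup>2"
  using obtain_section_character vanishing_section_character.index_V by blast

text \<open>An element of \<open>Z \<inter> D\<close> pairs trivially with all of \<open>G\<close>,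
  so it lies in the left kernel \<open>L\<close> of any one character, and
  \<open>L = V2\<close>.\<close>

lemma V2_eq: "V2 = Z \<inter> D"
proof
  show "V2 \<subseteq> Z \<inter> D"
    using V2_le_D commutator_V2(1) V2_props(2) by (auto simp: Z_def)
  obtain \<mu> where "vanishing_section_character G V \<mu>" by (rule obtain_section_character)
  then interpret vanishing_section_character G V \<mu> .
  show "Z \<inter> D \<subseteq> V2"
  proof
    fix y assume y: "y \<in> Z \<inter> D"
    then have "y \<in> L" using mu_V3 by (auto simp: left_kernel_def pairing_def Z_def)
    then show "y \<in> V2" unfolding L_eq .
  qed
qed

text \<open>A single character shows that the preimage of \<open>V2\<close> contains
  \<open>C\<close>. Conversely the preimage lies in \<open>C\<mu>\<close> for every character,
  because \<open>V2\<close> does not depend on \<open>\<mu>\<close>.\<close>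

lemma C_eq_preimage:
  assumes g: "g \<in> C" "g \<notin> V"
  shows "C = {x \<in> carrier G. commutator g x \<in> V2}"
proof
  obtain \<mu> where \<mu>: "vanishing_section_character G V \<mu>" by (rule obtain_section_character)
  show "C \<subseteq> {x \<in> carrier G. commutator g x \<in> V2}"
  proof
    fix x assume x: "x \<in> C"
    then have xc: "x \<in> carrier G" by (simp add: C_def)
    show "x \<in> {x \<in> carrier G. commutator g x \<in> V2}"
      using vanishing_section_character.Cmu_eq_commutator_preimage[OF \<mu> _ g(2) xc] C_le_Cmu[OF \<mu>] x g(1) xc by blast
  qed
  show "{x \<in> carrier G. commutator g x \<in> V2} \<subseteq> C"
  proof
    fix x assume "x \<in> {x \<in> carrier G. commutator g x \<in> V2}"
    then have x: "x \<in> carrier G" "commutator g x \<in> V2" by auto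
    show "x \<in> C"
    proof (rule in_C_if_in_all_Cmu[OF x(1)])
      fix \<mu> assume \<mu>: "vanishing_section_character G V \<mu>"
      show "x \<in> vanishing_section_character.C\<mu> G \<mu>"
        using vanishing_section_character.Cmu_eq_commutator_preimage[OF \<mu> _ g(2) x(1)] C_le_Cmu[OF \<mu>] x(2) g(1) by blast
    qed
  qed
qed

text \<open>One element of \<open>C\<close> outside \<open>V\<close> already forces
  \<open>C = C\<mu>\<close>, whose order is given by \<open>card_Cmu\<close>.\<close>

lemma index_C:
  assumes "C \<noteq> V"
  shows "group_index G (carrier G) C = group_index G D V2" "subgroup C G"
proof -
  obtain g where g: "g \<in> C" "g \<notin> V" using assms V_le_C by blast
  obtain \<mu> where "vanishing_section_character G V \<mu>" by (rule obtain_section_character)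
  then interpret vanishing_section_character G V \<mu> .
  have gC: "g \<in> C\<mu>" using g C_le_Cmu[OF vanishing_section_character_axioms] by blast
  have "C\<mu> = C"
    using Cmu_eq_commutator_preimage[OF gC g(2)] subgroup.subset[OF Cmu_subgroup]
    unfolding C_eq_preimage[OF g] by blast
  then show C: "subgroup C G" using Cmu_subgroup by simp
  have "card C * group_index G D V2 = card (carrier G)" using card_Cmu \<open>C\<mu> = C\<close> by simp
  moreover have "group_index G (carrier G) C * card C = card (carrier G)"
    by (rule group_index_mult_card[OF C subgroup_self subgroup.subset[OF C]])
  moreover have "card C \<noteq> 0"
    using finite_subset[OF subgroup.subset[OF C] finite_G] subgroup.one_closed[OF C] by auto
  ultimately show "group_index G (carrier G) C = group_index G D V2"
    by (metis mult.commute mult_cancel_left)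
qed

text \<open>\<open>commutator g\<close> maps \<open>G\<close> onto \<open>D\<close>, and
  \<open>C\<close> is the full preimage of \<open>V2\<close>. So inside \<open>C\<close> the pair
  \<open>V\<close>, \<open>V2\<close> plays the role that \<open>V\<close>, \<open>D\<close> plays
  inside \<open>G\<close>.\<close>

lemma commutator_C_onto:
  assumes g: "g \<in> C" "g \<notin> V" and t: "t \<in> V2"
  shows "\<exists>x\<in>C. commutator g x = t"
proof -
  have "g \<in> carrier G" "t \<in> D" using g t V2_le_D by (auto simp: C_def)
  then obtain x where "x \<in> carrier G" "commutator g x = t" using commutator_onto' g(2) by blast
  then show ?thesis using t C_eq_preimage[OF g] by blast
qed

lemma derived_C:
  assumes "C \<noteq> V"
  shows "derived G C = V2"
proof
  obtain g where g: "g \<in> C" "g \<notin> V" using assms V_le_C by blast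
  show "derived G C \<subseteq> V2"
    unfolding derived_eq_commutator_subgroup[of C]
  proof (rule commutator_subgroup_subsetI[OF V2_props(1)])
    fix h k assume hk: "h \<in> C" "k \<in> C"
    show "commutator h k \<in> V2"
    proof (cases "h \<in> V")
      case True
      then show ?thesis using hk commutator_V(1) by (simp add: C_def)
    next
      case False
      then show ?thesis using C_eq_preimage[OF hk(1)] hk(2) by blast
    qed
  qed
  show "V2 \<subseteq> derived G C"
  proof
    fix t assume "t \<in> V2"
    then obtain x where "x \<in> C" "commutator g x = t" using commutator_C_onto[OF g] by blast
    then show "t \<in> derived G C"
      using commutator_in_commutator_subgroup[OF g(1), of x C]
      unfolding derived_eq_commutator_subgroup[of C] by simp
  qed
qed

text \<open>For \<open>g\<close> in \<open>C\<close> outside \<open>V\<close> the class of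
  \<open>g\<close> in \<open>C\<close> is a full coset of \<open>V2\<close>, the derived subgroup of
  \<open>C\<close>. So every nonlinear character of \<open>C\<close> vanishes at
  \<open>g\<close>.\<close>

lemma vanishing_off_C_le_V:
  assumes C: "subgroup C G"
  shows "vanishing_off (G\<lparr>carrier := C\<rparr>) \<subseteq> V"
proof -
  let ?H = "G\<lparr>carrier := C\<rparr>"
  have CG: "C \<subseteq> carrier G" by (rule subgroup.subset[OF C])
  have H: "group ?H" by (rule subgroup_imp_group[OF C])
  let ?S = "{g \<in> carrier ?H. \<exists>\<chi>\<in>nl ?H. \<chi> g \<noteq> 0}"
  have "?S \<subseteq> V"
  proof (rule subsetI, rule ccontr)
    fix g assume gS: "g \<in> ?S" and gV: "g \<notin> V"
    then have g: "g \<in> C" by simp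
    then have ne: "C \<noteq> V" using gV by blast
    have gc: "g \<in> carrier G" using g CG by blast
    obtain \<chi> where \<chi>: "\<chi> \<in> nl ?H" "\<chi> g \<noteq> 0" using gS by blast
    have "\<chi> g = 0"
    proof (rule nl_vanishes_if_class_is_coset[OF H _ _ _ \<chi>(1)])
      show "finite (carrier ?H)" using finite_subset[OF CG finite_G] by simp
      show "g \<in> carrier ?H" using g by simp
      fix y assume "y \<in> derived ?H (carrier ?H)"
      then have y: "y \<in> V2" using derived_consistent[OF subset_refl C] derived_C[OF ne] by simp
      \<comment> \<open>The class criterion has \<open>g\<close> as second entry of the commutator,
        so \<open>commutator g x\<close> is prescribed to be \<open>inv y\<close>.\<close>
      have "inv y \<in> V2" by (rule subgroup.m_inv_closed[OF V2_props(1) y])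
      then obtain x where x: "x \<in> C" "commutator g x = inv y" using commutator_C_onto[OF g gV] by blast
      have xc: "x \<in> carrier G" and yc: "y \<in> carrier G" using x CG y V2_props(2) by auto
      have "commutator x g = y"
        using inv_group_commutator[OF gc xc] x(2) yc by simp
      then have "x \<otimes>\<^bsub>?H\<^esub> g \<otimes>\<^bsub>?H\<^esub> inv\<^bsub>?H\<^esub> x \<otimes>\<^bsub>?H\<^esub> inv\<^bsub>?H\<^esub> g = y"
        using m_inv_consistent[OF C x(1)] m_inv_consistent[OF C g] by (simp add: commutator_def)
      then show "\<exists>x\<in>carrier ?H. x \<otimes>\<^bsub>?H\<^esub> g \<otimes>\<^bsub>?H\<^esub> inv\<^bsub>?H\<^esub> x \<otimes>\<^bsub>?H\<^esub> inv\<^bsub>?H\<^esub> g = y"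
        using x(1) by auto
    qed
    then show False using \<chi>(2) by simp
  qed
  moreover have "?S \<subseteq> C" by auto
  ultimately show ?thesis
    unfolding vanishing_off_def using generate_consistent[OF _ C, of ?S] generate_subgroup_incl[OF _ V_props(1), of ?S]
    by simp
qed

text \<open>Modulo \<open>[V, C]\<close> the commutator is an alternating form on \<open>C\<close> with radical \<open>V\<close>.\<close>

lemma index_C_square:
  assumes C: "subgroup C G" "C \<noteq> V" and F: "commutator_subgroup G V C \<noteq> V2"
  shows "\<exists>m::nat. group_index G (carrier G) C = m\<^sup>2"
proof -
  let ?F = "commutator_subgroup G V C"
  have CG: "C \<subseteq> carrier G" by (rule subgroup.subset[OF C(1)])
  have FV2: "?F \<subseteq> V2" by (rule commutator_subgroup_mono[OF subset_refl CG])
  have Fs: "subgroup ?F G" by (rule commutator_subgroup_is_subgroup[OF V_props(2) CG])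
  have VF: "commutator v c \<in> ?F" "commutator c v \<in> ?F" if "v \<in> V" "c \<in> C" for v c
  proof -
    show f: "commutator v c \<in> ?F" by (rule commutator_in_commutator_subgroup[OF that])
    show "commutator c v \<in> ?F"
      using subgroup.m_inv_closed[OF Fs f] that V_props(2) CG by (simp add: inv_group_commutator subset_iff)
  qed
  let ?H = "G\<lparr>carrier := V2\<rparr>"
  have H: "group ?H" by (rule subgroup_imp_group[OF V2_props(1)])
  have V2C: "V2 \<subseteq> C" using V2_le_V V_le_C by blast
  \<comment> \<open>\<open>V2\<close> lies in \<open>V\<close> and \<open>?F\<close> lies in
    \<open>C\<close>, so \<open>[V2, ?F]\<close> is contained in \<open>[V, C] = ?F\<close>.\<close>
  have conjF: "x \<otimes> h \<otimes> inv x \<in> ?F" if "x \<in> V2" "h \<in> ?F" for x h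
  proof -
    have c: "x \<in> carrier G" "h \<in> carrier G" "x \<in> V" "h \<in> C"
      using that V2_props(2) FV2 V2_le_V V2C by auto
    show ?thesis
      unfolding conj_eq_commutator_mult[OF c(1,2)]
      by (rule subgroup.m_closed[OF Fs VF(1)[OF c(3,4)] that(2)])
  qed
  have "?F \<lhd> ?H"
    unfolding group.normal_inv_iff[OF H]
    using subgroup_incl[OF Fs V2_props(1) FV2] conjF m_inv_consistent[OF V2_props(1)] by simp
  moreover have "derived ?H (carrier ?H) \<subseteq> ?F"
    using derived_consistent[OF subset_refl V2_props(1)] commutator_subgroup_mono[OF V2_le_V V2C]
    unfolding derived_eq_commutator_subgroup[of V2] by simp
  moreover obtain z where z: "z \<in> V2" "z \<notin> ?F" using F FV2 by blast
  moreover have "finite (carrier ?H)" using finite_subset[OF V2_props(2) finite_G] by simp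
  \<comment> \<open>\<open>\<nu>\<close> is a linear character of \<open>V2/[V, C]\<close> that
    detects \<open>z\<close>. It turns the commutator on \<open>C\<close> into a complex-valued
    form, and \<open>z\<close> later shows that the radical is not larger than
    \<open>V\<close>.\<close>
  ultimately have "\<exists>\<nu>::'a \<Rightarrow> complex. (\<forall>x\<in>V2. \<forall>y\<in>V2. \<nu> (x \<otimes> y) = \<nu> x * \<nu> y) \<and>
      (\<forall>k\<in>?F. \<nu> k = 1) \<and> \<nu> z \<noteq> 1"
    using exists_linear_character[of ?F ?H z] by simp
  then obtain \<nu> :: "'a \<Rightarrow> complex"
    where nmul: "\<And>x y. x \<in> V2 \<Longrightarrow> y \<in> V2 \<Longrightarrow> \<nu> (x \<otimes> y) = \<nu> x * \<nu> y"
      and nF: "\<And>k. k \<in> ?F \<Longrightarrow> \<nu> k = 1" and nz: "\<nu> z \<noteq> 1"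
    by blast
  have n0: "\<nu> x \<noteq> 0" if x: "x \<in> V2" for x
  proof
    assume "\<nu> x = 0"
    then have "\<nu> (x \<otimes> inv x) = 0" using nmul[OF x subgroup.m_inv_closed[OF V2_props(1) x]] by simp
    then show False using nF[OF subgroup.one_closed[OF Fs]] x V2_props(2) by (simp add: subset_iff)
  qed
  have CV2: "commutator x y \<in> V2" if "x \<in> C" "y \<in> C" for x y
    using derived_C[OF C(2)] commutator_in_commutator_subgroup[OF that]
    unfolding derived_eq_commutator_subgroup[of C] by simp
  define f where "f x y = \<nu> (commutator x y)" for x y
  let ?K = "G\<lparr>carrier := C\<rparr>"
  have K: "group ?K" by (rule subgroup_imp_group[OF C(1)])
  have f: "bicharacter ?K ?K f"
  proof -
    have "f (x \<otimes> x') y = f x y * f x' y" "f y (x \<otimes> x') = f y x * f y x'"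
      if "x \<in> C" "x' \<in> C" "y \<in> C" for x x' y
    proof -
      have c: "x \<in> carrier G" "x' \<in> carrier G" "y \<in> carrier G" using that CG by auto
      have e: "commutator x (commutator x' y) \<in> ?F" "commutator x (commutator y x') \<in> ?F"
        "commutator x' (commutator y x) \<in> ?F"
        using VF(2) CV2 that V2_le_V by blast+
      have m: "s \<otimes> t \<in> V2" if "s \<in> V2" "t \<in> V2" for s t using that subgroup.m_closed[OF V2_props(1)] by blast
      note eV = e[THEN subsetD[OF FV2]] e[THEN nF]
      show "f (x \<otimes> x') y = f x y * f x' y"
        unfolding f_def commutator_mult_left'[OF c] using eV CV2 that by (simp add: nmul m)
      show "f y (x \<otimes> x') = f y x * f y x'"
        unfolding f_def commutator_mult_right'[OF c(3,1,2)] using eV CV2 that by (simp add: nmul m)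
    qed
    then show ?thesis unfolding bicharacter_def using n0 CV2 by (auto simp: f_def)
  qed
  have alt: "f x x = 1" if "x \<in> C" for x
    using that CG nF[OF subgroup.one_closed[OF Fs]] by (simp add: f_def commutator_self subset_iff)
  have lk: "left_kernel ?K ?K f = V"
  proof
    show "V \<subseteq> left_kernel ?K ?K f" using V_le_C nF VF(1) by (auto simp: left_kernel_def f_def)
    show "left_kernel ?K ?K f \<subseteq> V"
    proof
      fix u assume "u \<in> left_kernel ?K ?K f"
      then have u: "u \<in> C" "\<And>v. v \<in> C \<Longrightarrow> f u v = 1" by (auto simp: left_kernel_def)
      show "u \<in> V"
      proof (rule ccontr)
        assume "u \<notin> V"
        then obtain x where "x \<in> C" "commutator u x = z" using commutator_C_onto[OF u(1) _ z(1)] by blast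
        then show False using u(2) nz by (auto simp: f_def)
      qed
    qed
  qed
  have "finite (carrier ?K)" using finite_subset[OF CG finite_G] by simp
  from alternating_bicharacter_square[OF K this f] alt
  obtain m :: nat where "card C = m\<^sup>2 * card V" unfolding lk by auto
  moreover have "group_index G C V * card V = card C"
    by (rule group_index_mult_card[OF V_props(1) C(1) V_le_C])
  have iC: "group_index G (carrier G) C * card C = card (carrier G)"
    by (rule group_index_mult_card[OF C(1) subgroup_self CG])
  moreover have iV: "group_index G (carrier G) V * card V = card (carrier G)"
    by (rule group_index_mult_card[OF V_props(1) subgroup_self V_props(2)])
  moreover have "card V \<noteq> 0"
    using finite_subset[OF V_props(2) finite_G] subgroup.one_closed[OF V_props(1)] by auto
  \<comment> \<open>\<open>|G:V|\<close> equals \<open>|G:C| m^2\<close> and, by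
    \<open>index_V_eq\<close> and \<open>index_C\<close>, also \<open>|G:C|^2\<close>. Cancelling
    gives \<open>|G:C| = m^2\<close>.\<close>
  ultimately have "group_index G (carrier G) C * m\<^sup>2 = group_index G (carrier G) V"
    by (metis mult.assoc mult_cancel_right)
  also have "\<dots> = (group_index G (carrier G) C)\<^sup>2"
    using index_V_eq index_C(1)[OF C(2)] by simp
  finally have e: "group_index G (carrier G) C * m\<^sup>2 = group_index G (carrier G) C * group_index G (carrier G) C"
    by (simp add: power2_eq_square)
  have "group_index G (carrier G) C \<noteq> 0" using iC finite_G by (metis card_0_eq empty_iff mult_0 one_closed)
  then have "group_index G (carrier G) C = m\<^sup>2" using e by simp
  then show ?thesis by blast
qed

end

section \<open>From centers and centralizers in quotients to commutator conditions\<close>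

context group
begin

lemma coset_commute_iff:
  assumes N: "N \<lhd> G" and ab: "a \<in> carrier G" "b \<in> carrier G"
  shows "(N #> a) \<otimes>\<^bsub>G Mod N\<^esub> (N #> b) = (N #> b) \<otimes>\<^bsub>G Mod N\<^esub> (N #> a) \<longleftrightarrow> commutator a b \<in> N"
proof -
  have "(N #> a) \<otimes>\<^bsub>G Mod N\<^esub> (N #> b) = N #> (a \<otimes> b)" "(N #> b) \<otimes>\<^bsub>G Mod N\<^esub> (N #> a) = N #> (b \<otimes> a)"
    using ab by (simp_all add: normal.rcos_sum[OF N])
  moreover have "N #> (a \<otimes> b) = N #> (b \<otimes> a) \<longleftrightarrow> commutator a b \<in> N"
  proof
    assume "commutator a b \<in> N"
    then show "N #> (a \<otimes> b) = N #> (b \<otimes> a)"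
      using coset_absorb(1)[OF N _ ab(1), of "commutator a b" "b \<otimes> a"] ab mult_eq_commutator_mult[OF ab]
      by simp
  next
    assume "N #> (a \<otimes> b) = N #> (b \<otimes> a)"
    then have "a \<otimes> b \<in> N #> (b \<otimes> a)" using rcos_self[OF _ normalD(1)[OF N], of "a \<otimes> b"] ab by simp
    then obtain n where n: "n \<in> N" "a \<otimes> b = n \<otimes> (b \<otimes> a)" by (auto simp: r_coset_def)
    then have "commutator a b \<otimes> (b \<otimes> a) = n \<otimes> (b \<otimes> a)" using mult_eq_commutator_mult[OF ab] by simp
    then have "commutator a b = n" using ab n(1) normalD(2)[OF N] by (simp add: subset_iff)
    then show "commutator a b \<in> N" using n by simp
  qed
  ultimately show ?thesis by simp
qed

lemma carrier_subgroup_factor: "carrier (G\<lparr>carrier := H\<rparr> Mod N) = (\<lambda>h. N #> h) ` H"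
  by (auto simp: FactGroup_def RCOSETS_def r_coset_def)

lemma carrier_factor: "carrier (G Mod N) = (\<lambda>h. N #> h) ` carrier G"
  by (auto simp: FactGroup_def RCOSETS_def)

text \<open>A subgroup containing \<open>N\<close> is a union of cosets of \<open>N\<close>, so its
  image in the quotient determines it; \<open>P\<close> is the condition that cuts out this
  image.\<close>

lemma preimage_of_coset_set:
  assumes N: "N \<lhd> G" and S: "subgroup S G" "N \<subseteq> S"
    and eq: "(\<lambda>s. N #> s) ` S = {Y \<in> (\<lambda>h. N #> h) ` carrier G. P Y}"
  shows "S = {x \<in> carrier G. P (N #> x)}"
proof
  show "S \<subseteq> {x \<in> carrier G. P (N #> x)}" using eq subgroup.subset[OF S(1)] by blast
  show "{x \<in> carrier G. P (N #> x)} \<subseteq> S"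
  proof
    fix x assume x: "x \<in> {x \<in> carrier G. P (N #> x)}"
    then have "N #> x \<in> (\<lambda>s. N #> s) ` S" unfolding eq by blast
    then obtain s where s: "s \<in> S" "N #> x = N #> s" by blast
    then have "x \<in> N #> s" using rcos_self[OF _ normalD(1)[OF N], of x] x by simp
    then obtain n where "n \<in> N" "x = n \<otimes> s" by (auto simp: r_coset_def)
    then show "x \<in> S" using S s subgroup.m_closed[OF S(1)] by blast
  qed
qed

lemma preimage_center:
  assumes N: "N \<lhd> G" and S: "subgroup S G" "N \<subseteq> S"
    and eq: "carrier (G\<lparr>carrier := S\<rparr> Mod N) = center (G Mod N)"
  shows "S = {z \<in> carrier G. \<forall>x\<in>carrier G. commutator z x \<in> N}"
proof -
  have "S = {z \<in> carrier G. \<forall>Y\<in>carrier (G Mod N). (N #> z) \<otimes>\<^bsub>G Mod N\<^esub> Y = Y \<otimes>\<^bsub>G Mod N\<^esub> (N #> z)}"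
    by (rule preimage_of_coset_set[OF N S]) (use eq in \<open>simp add: carrier_subgroup_factor center_def carrier_factor\<close>)
  also have "\<dots> = {z \<in> carrier G. \<forall>x\<in>carrier G. commutator z x \<in> N}"
    unfolding carrier_factor using coset_commute_iff[OF N] by blast
  finally show ?thesis .
qed

lemma preimage_centralizer:
  assumes N: "N \<lhd> G" and S: "subgroup S G" "N \<subseteq> S" and H: "H \<subseteq> carrier G"
    and eq: "carrier (G\<lparr>carrier := S\<rparr> Mod N) = centralizer (G Mod N) (carrier (G\<lparr>carrier := H\<rparr> Mod N))"
  shows "S = {z \<in> carrier G. \<forall>x\<in>H. commutator z x \<in> N}"
proof -
  have "S = {z \<in> carrier G. \<forall>Y\<in>carrier (G\<lparr>carrier := H\<rparr> Mod N). (N #> z) \<otimes>\<^bsub>G Mod N\<^esub> Y = Y \<otimes>\<^bsub>G Mod N\<^esub> (N #> z)}"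
    by (rule preimage_of_coset_set[OF N S])
      (use eq in \<open>simp add: carrier_subgroup_factor centralizer_def carrier_factor\<close>)
  also have "\<dots> = {z \<in> carrier G. \<forall>x\<in>H. commutator z x \<in> N}"
    unfolding carrier_subgroup_factor using coset_commute_iff[OF N] H by blast
  finally show ?thesis .
qed

text \<open>Characters are class functions, so the generating set is closed under
  conjugation.\<close>

lemma vanishing_off_normal: "vanishing_off G \<lhd> G"
  unfolding vanishing_off_def
proof (rule normal_generateI)
  show "{g \<in> carrier G. \<exists>\<chi>\<in>nl G. \<chi> g \<noteq> 0} \<subseteq> carrier G" by blast
  fix h g assume h: "h \<in> {g \<in> carrier G. \<exists>\<chi>\<in>nl G. \<chi> g \<noteq> 0}" and g: "g \<in> carrier G"
  then obtain \<chi> where \<chi>: "\<chi> \<in> nl G" "\<chi> h \<noteq> 0" by blast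
  obtain n \<rho> where \<rho>: "irreducible_rep G n \<rho>" "\<chi> = character G \<rho>" using nlE[OF is_group \<chi>(1)] by blast
  have "\<chi> (g \<otimes> h \<otimes> inv g) = \<chi> h"
    using character_class_function[OF is_group irreducible_repD(2)[OF \<rho>(1)] g, of h] g h
    by (simp add: \<rho>(2) character_def)
  then show "g \<otimes> h \<otimes> inv g \<in> {g \<in> carrier G. \<exists>\<chi>\<in>nl G. \<chi> g \<noteq> 0}"
    using g h \<chi> by (intro CollectI conjI bexI[of _ \<chi>]) simp_all
qed

lemma class_is_coset_outside_vanishing_off:
  assumes "finite (carrier G)" "g \<in> carrier G" "g \<notin> vanishing_off G" "y \<in> derived G (carrier G)"
  shows "\<exists>x\<in>carrier G. commutator x g = y"
proof -
  have "\<chi> g = 0" if "\<chi> \<in> nl G" for \<chi>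
    using assms(2,3) that unfolding vanishing_off_def by (blast intro: generate.incl)
  then show ?thesis
    using class_is_coset_if_nl_vanishes[OF is_group assms(1,2) _ assms(4)] unfolding commutator_def by blast
qed

end

lemma vanishing_series_simps:
  "vanishing_series G 1 = vanishing_off G"
  "vanishing_series G 2 = commutator_subgroup G (vanishing_off G) (carrier G)"
  "vanishing_series G 3 = commutator_subgroup G (commutator_subgroup G (vanishing_off G) (carrier G)) (carrier G)"
  by (simp_all add: vanishing_series_def numeral_2_eq_2 numeral_3_eq_3)

lemma lower_central_3:
  "group G \<Longrightarrow> lower_central G 3 = commutator_subgroup G (derived G (carrier G)) (carrier G)"
  by (simp add: lower_central_def numeral_2_eq_2 numeral_3_eq_3 group.derived_eq_commutator_subgroup)

theorem theorem3:
  fixes G :: "('a, 'b) monoid_scheme"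
    and Z C :: "'a set"
  assumes "group G"
    and "finite (carrier G)"
    and "\<not> comm_group G"
    and "vanishing_series G 3 \<subset> lower_central G 3"
    and "subgroup Z G"
    and "vanishing_series G 3 \<subseteq> Z"
    and "carrier (G\<lparr>carrier := Z\<rparr> Mod vanishing_series G 3)
           = center (G Mod vanishing_series G 3)"
    and "subgroup C G"
    and "vanishing_series G 3 \<subseteq> C"
    and "carrier (G\<lparr>carrier := C\<rparr> Mod vanishing_series G 3)
           = centralizer (G Mod vanishing_series G 3)
               (carrier (G\<lparr>carrier := derived G (carrier G)\<rparr> Mod vanishing_series G 3))"
  shows "group_index G (carrier G) (vanishing_series G 1)
             = (group_index G (derived G (carrier G)) (vanishing_series G 2))\<^sup>2
    \<and> vanishing_series G 2 = Z \<inter> derived G (carrier G)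
    \<and> (group_index G (carrier G) C
             = group_index G (derived G (carrier G)) (vanishing_series G 2)
           \<or> C = vanishing_series G 1)
    \<and> vanishing_off (G\<lparr>carrier := C\<rparr>) \<subseteq> vanishing_series G 1
    \<and> (vanishing_series G 1 \<subset> C \<longrightarrow> derived G C = vanishing_series G 2)
    \<and> (vanishing_series G 1 \<subset> C \<and>
         commutator_subgroup G (vanishing_series G 1) C \<subset> vanishing_series G 2 \<longrightarrow>
         (\<exists>m::nat. group_index G (carrier G) C = m\<^sup>2))"
proof -
  interpret group G by fact
  let ?V = "vanishing_off G"
  interpret vs: vanishing_section G ?V
  proof (intro vanishing_section.intro vanishing_section_axioms.intro)
    show "group G" by fact
    show "finite (carrier G)" by fact
    show "?V \<lhd> G" by (rule vanishing_off_normal)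
    show "\<exists>x\<in>carrier G. commutator x g = y"
      if "g \<in> carrier G" "g \<notin> ?V" "y \<in> derived G (carrier G)" for g y
      by (rule class_is_coset_outside_vanishing_off[OF assms(2) that])
    show "commutator_subgroup G (commutator_subgroup G ?V (carrier G)) (carrier G) \<noteq>
        commutator_subgroup G (derived G (carrier G)) (carrier G)"
      using assms(4) unfolding vanishing_series_simps lower_central_3[OF assms(1)] by blast
  qed
  have Z: "Z = vs.Z"
    unfolding vs.Z_def
    by (rule preimage_center[OF vs.normals(3) assms(5)]) (use assms(6,7) in \<open>simp_all only: vanishing_series_simps\<close>)
  have C: "C = vs.C"
    unfolding vs.C_def
    by (rule preimage_centralizer[OF vs.normals(3) assms(8) _ vs.D_props(2)])
      (use assms(9,10) in \<open>simp_all only: vanishing_series_simps\<close>)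
  have sub: "subgroup vs.C G" using assms(8) C by simp
  show ?thesis
    unfolding vanishing_series_simps Z C
  proof (intro conjI impI)
    show "group_index G (carrier G) ?V = (group_index G (derived G (carrier G)) vs.V2)\<^sup>2"
      by (rule vs.index_V_eq)
    show "vs.V2 = vs.Z \<inter> derived G (carrier G)" by (rule vs.V2_eq)
    show "group_index G (carrier G) vs.C = group_index G (derived G (carrier G)) vs.V2 \<or> vs.C = ?V"
      using vs.index_C(1) by blast
    show "vanishing_off (G\<lparr>carrier := vs.C\<rparr>) \<subseteq> ?V" by (rule vs.vanishing_off_C_le_V[OF sub])
    show "derived G vs.C = vs.V2" if "?V \<subset> vs.C" using vs.derived_C that by blast
    show "\<exists>m::nat. group_index G (carrier G) vs.C = m\<^sup>2"
      if "?V \<subset> vs.C \<and> commutator_subgroup G ?V vs.C \<subset> vs.V2"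
      using vs.index_C_square[OF sub] that by blast
  qed
qed

end
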